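(* Let $M$ be a compact connected manifold of dimension $d\ge 1$ and let $L(x,v)=\frac12\|v\|_x^2+U(x)$ be a mechanical Lagrangian on $TM$, such that the potential $U$ belongs to $C^r(M)$ with $r\ge 2d-2$. Then the quotient Aubry set $(\bar{\mathcal A}_{L,0},\bar\delta_0)$, corresponding to the zero cohomology class, is totally disconnected, i.e., every connected component consists of a single point.
   Context: $M$ is a compact connected smooth manifold without boundary, with a fixed Riemannian metric and induced norms $\|\cdot\|_x$ on $T_xM$. A Tonelli Lagrangian is a function $L:TM\to\mathbb{R}$ such that (i) $L\in C^2(TM)$; (ii) $\frac{\partial^2L}{\partial v^2}(x,v)$ is positive definite for all $(x,v)\in TM$; (iii) $\lim_{\|v\|_x\to\infty}L(x,v)/\|v\|_x=+\infty$ for each $x$. A mechanical Lagrangian is a Tonelli Lagrangian of the form $L(x,v)=\frac12\|v\|_x^2+U(x)$ (so in particular $U\in C^2(M)$). Quotient Aubry set. For a closed ($C^2$) $1$-form $\eta$ with class $c=[\eta]\in H^1(M;\mathbb{R})$, let $L_\eta(x,v)=L(x,v)-\langle\eta(x),v\rangle_x$. Mather's $\alpha$ function is $\alpha(c)=-\min_\mu\int L_\eta\,d\mu$, the minimum being over Borel probability measures on $TM$ invariant under the Euler-Lagrange flow of $L$. For $t>0$ let $h_{\eta,t}(x,y)=\inf\int_0^tL_\eta(\gamma(s),\dot\gamma(s))\,ds$ over piecewise $C^1$ paths $\gamma:[0,t]\to M$ with $\gamma(0)=x$, $\gamma(t)=y$, and let $h_\eta(x,y)=\liminf_{t\to+\infty}(h_{\eta,t}(x,y)+\alpha(c)t)$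 (Peierls barrier). Let $\delta_c(x,y)=h_\eta(x,y)+h_\eta(y,x)$, which depends only on $c$. The Aubry set is $\mathcal{A}_{L,c}=\{x\in M:\delta_c(x,x)=0\}$; $\delta_c$ is a pseudometric on it. The quotient Aubry set $(\bar{\mathcal A}_{L,c},\bar\delta_c)$ is the metric space obtained from $(\mathcal A_{L,c},\delta_c)$ by identifying points at $\delta_c$-distance zero. Here $c=0$ (one may take $\eta=0$). *)

theory Defs
  imports "HOL-Analysis.Analysis" "HOL-Probability.Probability"
begin

text \<open>Meant for open \<open>S\<close> in a finite-dimensional space, where it is enough to ask that every
  directional derivative is of class $C^{k-1}$.\<close>

fun Ck_on :: "nat \<Rightarrow> 'a::real_normed_vector set \<Rightarrow> ('a \<Rightarrow> 'b::real_normed_vector) \<Rightarrow> bool" where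
  "Ck_on 0 S f \<longleftrightarrow> continuous_on S f"
| "Ck_on (Suc k) S f \<longleftrightarrow>
     (\<forall>x\<in>S. f differentiable (at x)) \<and>
     (\<forall>v. Ck_on k S (\<lambda>x. frechet_derivative f (at x) v))"

definition smooth_on :: "'a::real_normed_vector set \<Rightarrow> ('a \<Rightarrow> 'b::real_normed_vector) \<Rightarrow> bool" where
  "smooth_on S f \<longleftrightarrow> (\<forall>k. Ck_on k S f)"

text \<open>The manifold is the whole type \<open>'m\<close>, with its type class topology; the model space is
  \<open>'e\<close>, so the dimension is \<open>DIM('e)\<close>. A chart is a pair of a domain and a map, the values of
  the map outside of the domain being irrelevant.\<close>

type_synonym ('m, 'e) chart = "'m set \<times> ('m \<Rightarrow> 'e)"

definition chart_inv :: "('m, 'e) chart \<Rightarrow> 'e \<Rightarrow> 'm" where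
  "chart_inv \<kappa> = inv_into (fst \<kappa>) (snd \<kappa>)"

definition is_chart :: "('m::topological_space, 'e::euclidean_space) chart \<Rightarrow> bool" where
  "is_chart \<kappa> \<longleftrightarrow> open (fst \<kappa>) \<and> open (snd \<kappa> ` fst \<kappa>) \<and>
     homeomorphism (fst \<kappa>) (snd \<kappa> ` fst \<kappa>) (snd \<kappa>) (chart_inv \<kappa>)"

definition smooth_atlas :: "('m::topological_space, 'e::euclidean_space) chart set \<Rightarrow> bool" where
  "smooth_atlas A \<longleftrightarrow>
     (\<Union>\<kappa>\<in>A. fst \<kappa>) = UNIV \<and> (\<forall>\<kappa>\<in>A. is_chart \<kappa>) \<and>
     (\<forall>\<kappa>\<in>A. \<forall>\<kappa>'\<in>A. smooth_on (snd \<kappa> ` (fst \<kappa> \<inter> fst \<kappa>')) (snd \<kappa>' \<circ> chart_inv \<kappa>))"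

text \<open>Second countability need not be required, since it follows from compactness.\<close>

definition compact_connected_manifold ::
  "('m::t2_space, 'e::euclidean_space) chart set \<Rightarrow> bool" where
  "compact_connected_manifold A \<longleftrightarrow>
     smooth_atlas A \<and> compact (UNIV :: 'm set) \<and> connected (UNIV :: 'm set)"

definition Ck_function ::
  "('m::topological_space, 'e::euclidean_space) chart set \<Rightarrow> nat \<Rightarrow> ('m \<Rightarrow> real) \<Rightarrow> bool" where
  "Ck_function A k f \<longleftrightarrow> (\<forall>\<kappa>\<in>A. Ck_on k (snd \<kappa> ` fst \<kappa>) (f \<circ> chart_inv \<kappa>))"

text \<open>For each point \<open>x\<close> a chart \<open>chart_at A x\<close> around \<open>x\<close> is selected once and for all, and
  $T_xM$ is identified with \<open>'e\<close> by means of it. Thus $TM$ is, as a set, the type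
  \<open>'m \<times> 'e\<close>; its topology and its differentiable structure are not those of the product, but
  are given by the maps \<open>bundle_chart A \<kappa>\<close> below.\<close>

definition chart_at :: "('m, 'e) chart set \<Rightarrow> 'm \<Rightarrow> ('m, 'e) chart" where
  "chart_at A x = (SOME \<kappa>. \<kappa> \<in> A \<and> x \<in> fst \<kappa>)"

text \<open>The components in the chart \<open>\<kappa>'\<close> of the vector at \<open>x\<close> with components \<open>v\<close> in
  the chart \<open>\<kappa>\<close>.\<close>

definition change_coords ::
  "('m, 'e::euclidean_space) chart \<Rightarrow> ('m, 'e) chart \<Rightarrow> 'm \<Rightarrow> 'e \<Rightarrow> 'e" where
  "change_coords \<kappa> \<kappa>' x v = frechet_derivative (snd \<kappa>' \<circ> chart_inv \<kappa>) (at (snd \<kappa> x)) v"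

definition bundle_chart ::
  "('m, 'e::euclidean_space) chart set \<Rightarrow> ('m, 'e) chart \<Rightarrow> 'm \<times> 'e \<Rightarrow> 'e \<times> 'e" where
  "bundle_chart A \<kappa> = (\<lambda>(x, v). (snd \<kappa> x, change_coords (chart_at A x) \<kappa> x v))"

definition bundle_chart_inv ::
  "('m, 'e::euclidean_space) chart set \<Rightarrow> ('m, 'e) chart \<Rightarrow> 'e \<times> 'e \<Rightarrow> 'm \<times> 'e" where
  "bundle_chart_inv A \<kappa> = (\<lambda>(y, u). let x = chart_inv \<kappa> y in (x, change_coords \<kappa> (chart_at A x) x u))"

definition tangent_topology ::
  "('m, 'e::euclidean_space) chart set \<Rightarrow> ('m \<times> 'e) topology" where
  "tangent_topology A = topology_generated_by
     {{z. fst z \<in> fst \<kappa> \<and> bundle_chart A \<kappa> z \<in> W} | \<kappa> W. \<kappa> \<in> A \<and> open W}"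

definition tangent_borel :: "('m, 'e::euclidean_space) chart set \<Rightarrow> ('m \<times> 'e) measure" where
  "tangent_borel A = sigma UNIV {W. openin (tangent_topology A) W}"

definition riemannian_metric ::
  "('m, 'e::euclidean_space) chart set \<Rightarrow> ('m \<Rightarrow> 'e \<Rightarrow> 'e \<Rightarrow> real) \<Rightarrow> bool" where
  "riemannian_metric A g \<longleftrightarrow>
     (\<forall>x. bilinear (g x) \<and> (\<forall>v w. g x v w = g x w v) \<and> (\<forall>v. v \<noteq> 0 \<longrightarrow> g x v v > 0)) \<and>
     (\<forall>\<kappa>\<in>A. \<forall>u w. smooth_on (snd \<kappa> ` fst \<kappa>)
        (\<lambda>y. g (chart_inv \<kappa> y) (snd (bundle_chart_inv A \<kappa> (y, u)))
                                (snd (bundle_chart_inv A \<kappa> (y, w)))))"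

definition metric_norm :: "('m \<Rightarrow> 'e \<Rightarrow> 'e \<Rightarrow> real) \<Rightarrow> 'm \<Rightarrow> 'e \<Rightarrow> real" where
  "metric_norm g x v = sqrt (g x v v)"

definition tonelli_lagrangian ::
  "('m, 'e::euclidean_space) chart set \<Rightarrow> ('m \<Rightarrow> 'e \<Rightarrow> 'e \<Rightarrow> real) \<Rightarrow> ('m \<times> 'e \<Rightarrow> real) \<Rightarrow> bool" where
  "tonelli_lagrangian A g L \<longleftrightarrow>
     (\<forall>\<kappa>\<in>A. Ck_on 2 ((snd \<kappa> ` fst \<kappa>) \<times> UNIV) (L \<circ> bundle_chart_inv A \<kappa>)) \<and>
     (\<forall>x v w. w \<noteq> 0 \<longrightarrow>
        frechet_derivative (\<lambda>v'. frechet_derivative (\<lambda>v''. L (x, v'')) (at v') w) (at v) w > 0) \<and>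
     (\<forall>x. filterlim (\<lambda>v. L (x, v) / metric_norm g x v) at_top
            (filtercomap (metric_norm g x) at_top))"

definition mechanical_lagrangian ::
  "('m, 'e::euclidean_space) chart set \<Rightarrow> ('m \<Rightarrow> 'e \<Rightarrow> 'e \<Rightarrow> real) \<Rightarrow> ('m \<Rightarrow> real) \<Rightarrow>
     ('m \<times> 'e \<Rightarrow> real) \<Rightarrow> bool" where
  "mechanical_lagrangian A g U L \<longleftrightarrow> tonelli_lagrangian A g L \<and>
     (\<forall>x v. L (x, v) = (metric_norm g x v)\<^sup>2 / 2 + U x)"

definition shifted_lagrangian ::
  "('m \<times> 'e \<Rightarrow> real) \<Rightarrow> ('m \<Rightarrow> 'e \<Rightarrow> real) \<Rightarrow> 'm \<times> 'e \<Rightarrow> real" where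
  "shifted_lagrangian L \<eta> = (\<lambda>(x, v). L (x, v) - \<eta> x v)"

definition C1_curve_on ::
  "('m::topological_space, 'e::euclidean_space) chart set \<Rightarrow> real set \<Rightarrow> (real \<Rightarrow> 'm) \<Rightarrow> bool" where
  "C1_curve_on A J \<gamma> \<longleftrightarrow> continuous_on J \<gamma> \<and>
     (\<forall>\<kappa>\<in>A. \<exists>w. continuous_on {s \<in> J. \<gamma> s \<in> fst \<kappa>} w \<and>
        (\<forall>s\<in>J. \<gamma> s \<in> fst \<kappa> \<longrightarrow> ((snd \<kappa> \<circ> \<gamma>) has_vector_derivative w s) (at s within J)))"

text \<open>Each piece is $C^1$ up to its end points, so that velocities are bounded. This is
  why \<open>piecewise_C1_differentiable_on\<close>, which allows for unbounded velocities near the break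
  points, is not imitated here.\<close>

definition piecewise_C1_path ::
  "('m::topological_space, 'e::euclidean_space) chart set \<Rightarrow> real \<Rightarrow> (real \<Rightarrow> 'm) \<Rightarrow> bool" where
  "piecewise_C1_path A t \<gamma> \<longleftrightarrow>
     (\<exists>S. finite S \<and> {0, t} \<subseteq> S \<and> S \<subseteq> {0..t} \<and>
        (\<forall>a\<in>S. \<forall>b\<in>S. a < b \<and> S \<inter> {a<..<b} = {} \<longrightarrow> C1_curve_on A {a..b} \<gamma>))"

definition velocity ::
  "('m, 'e::euclidean_space) chart set \<Rightarrow> (real \<Rightarrow> 'm) \<Rightarrow> real \<Rightarrow> 'e" where
  "velocity A \<gamma> s = vector_derivative (snd (chart_at A (\<gamma> s)) \<circ> \<gamma>) (at s)"

text \<open>The equation $\frac{d}{dt}\frac{\partial L}{\partial v} = \frac{\partial L}{\partial x}$ in all charts.\<close>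

definition euler_lagrange ::
  "('m::topological_space, 'e::euclidean_space) chart set \<Rightarrow> ('m \<times> 'e \<Rightarrow> real) \<Rightarrow>
     (real \<Rightarrow> 'm) \<Rightarrow> bool" where
  "euler_lagrange A L \<gamma> \<longleftrightarrow> C1_curve_on A UNIV \<gamma> \<and>
     (\<forall>\<kappa>\<in>A. \<forall>s. \<gamma> s \<in> fst \<kappa> \<longrightarrow>
        (let L\<kappa> = L \<circ> bundle_chart_inv A \<kappa>;
             q = snd \<kappa> \<circ> \<gamma>;
             q' = (\<lambda>\<tau>. vector_derivative q (at \<tau>))
         in \<forall>w. ((\<lambda>\<tau>. frechet_derivative (\<lambda>u. L\<kappa> (q \<tau>, u)) (at (q' \<tau>)) w)
                   has_real_derivative
                 frechet_derivative (\<lambda>y. L\<kappa> (y, q' s)) (at (q s)) w) (at s)))"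

definition EL_flow ::
  "('m::topological_space, 'e::euclidean_space) chart set \<Rightarrow> ('m \<times> 'e \<Rightarrow> real) \<Rightarrow>
     real \<Rightarrow> 'm \<times> 'e \<Rightarrow> 'm \<times> 'e" where
  "EL_flow A L t z =
     (let \<gamma> = (THE \<gamma>. euler_lagrange A L \<gamma> \<and> (\<gamma> 0, velocity A \<gamma> 0) = z)
      in (\<gamma> t, velocity A \<gamma> t))"

definition invariant_measures ::
  "('m::topological_space, 'e::euclidean_space) chart set \<Rightarrow> ('m \<times> 'e \<Rightarrow> real) \<Rightarrow>
     ('m \<times> 'e) measure set" where
  "invariant_measures A L = {\<mu>. sets \<mu> = sets (tangent_borel A) \<and> prob_space \<mu> \<and>
     (\<forall>t. \<forall>B\<in>sets \<mu>. emeasure \<mu> (EL_flow A L t -` B) = emeasure \<mu> B)}"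

text \<open>\<open>integral\<^sup>L\<close> would assign the value 0 to Lagrangians that are not integrable, for which
  the right value is $+\infty$.\<close>

definition extended_integral :: "'a measure \<Rightarrow> ('a \<Rightarrow> real) \<Rightarrow> ereal" where
  "extended_integral \<mu> f =
     enn2ereal (\<integral>\<^sup>+ z. ennreal (f z) \<partial>\<mu>) - enn2ereal (\<integral>\<^sup>+ z. ennreal (- f z) \<partial>\<mu>)"

text \<open>In what follows the 1-form \<open>\<eta>\<close> represents the cohomology class. The infimum below is
  a minimum for Tonelli Lagrangians.\<close>

definition mather_alpha ::
  "('m::topological_space, 'e::euclidean_space) chart set \<Rightarrow> ('m \<times> 'e \<Rightarrow> real) \<Rightarrow>
     ('m \<Rightarrow> 'e \<Rightarrow> real) \<Rightarrow> ereal" where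
  "mather_alpha A L \<eta> =
     - (INF \<mu>\<in>invariant_measures A L. extended_integral \<mu> (shifted_lagrangian L \<eta>))"

definition min_action ::
  "('m::topological_space, 'e::euclidean_space) chart set \<Rightarrow> ('m \<times> 'e \<Rightarrow> real) \<Rightarrow>
     ('m \<Rightarrow> 'e \<Rightarrow> real) \<Rightarrow> real \<Rightarrow> 'm \<Rightarrow> 'm \<Rightarrow> ereal" where
  "min_action A L \<eta> t x y =
     (INF \<gamma>\<in>{\<gamma>. piecewise_C1_path A t \<gamma> \<and> \<gamma> 0 = x \<and> \<gamma> t = y}.
        ereal (integral {0..t} (\<lambda>s. shifted_lagrangian L \<eta> (\<gamma> s, velocity A \<gamma> s))))"

definition peierls_barrier ::
  "('m::topological_space, 'e::euclidean_space) chart set \<Rightarrow> ('m \<times> 'e \<Rightarrow> real) \<Rightarrow>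
     ('m \<Rightarrow> 'e \<Rightarrow> real) \<Rightarrow> 'm \<Rightarrow> 'm \<Rightarrow> ereal" where
  "peierls_barrier A L \<eta> x y =
     Liminf at_top (\<lambda>t::real. min_action A L \<eta> t x y + mather_alpha A L \<eta> * ereal t)"

definition aubry_delta ::
  "('m::topological_space, 'e::euclidean_space) chart set \<Rightarrow> ('m \<times> 'e \<Rightarrow> real) \<Rightarrow>
     ('m \<Rightarrow> 'e \<Rightarrow> real) \<Rightarrow> 'm \<Rightarrow> 'm \<Rightarrow> ereal" where
  "aubry_delta A L \<eta> x y = peierls_barrier A L \<eta> x y + peierls_barrier A L \<eta> y x"

definition aubry_set ::
  "('m::topological_space, 'e::euclidean_space) chart set \<Rightarrow> ('m \<times> 'e \<Rightarrow> real) \<Rightarrow>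
     ('m \<Rightarrow> 'e \<Rightarrow> real) \<Rightarrow> 'm set" where
  "aubry_set A L \<eta> = {x. aubry_delta A L \<eta> x x = 0}"

definition quotient_aubry_set ::
  "('m::topological_space, 'e::euclidean_space) chart set \<Rightarrow> ('m \<times> 'e \<Rightarrow> real) \<Rightarrow>
     ('m \<Rightarrow> 'e \<Rightarrow> real) \<Rightarrow> 'm set set" where
  "quotient_aubry_set A L \<eta> = aubry_set A L \<eta> //
     {(x, y). x \<in> aubry_set A L \<eta> \<and> y \<in> aubry_set A L \<eta> \<and> aubry_delta A L \<eta> x y = 0}"

definition quotient_aubry_dist ::
  "('m::topological_space, 'e::euclidean_space) chart set \<Rightarrow> ('m \<times> 'e \<Rightarrow> real) \<Rightarrow>
     ('m \<Rightarrow> 'e \<Rightarrow> real) \<Rightarrow> 'm set \<Rightarrow> 'm set \<Rightarrow> real" where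
  "quotient_aubry_dist A L \<eta> P Q =
     real_of_ereal (aubry_delta A L \<eta> (SOME x. x \<in> P) (SOME y. y \<in> Q))"

definition totally_disconnected_space :: "'a topology \<Rightarrow> bool" where
  "totally_disconnected_space X \<longleftrightarrow> (\<forall>C\<in>connected_components_of X. \<exists>a. C = {a})"

end

theory Submission
  imports Defs
begin

text \<open>The lower bound \<open>L \<ge> min U\<close> gives $\alpha(0) \le -\min U$. If the inequality is strict, the Peierls
  barrier is identically $-\infty$ and the Aubry set is empty. Otherwise the Aubry set is contained in
  the set \<open>Z\<close> of minima of \<open>U\<close>, and between points of \<open>Z\<close> the barrier is the infimum of the actions of
  \<open>L - min U\<close> over all times. Running through a curve of length \<open>l\<close> on which $U - \min U \le \sigma$
  in time $l / \sqrt\sigma$ bounds this infimum by a constant times $l \sqrt\sigma$.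

  By A. P. Morse's decomposition, \<open>Z\<close> is a countable union of pieces that lie on embedded discs of
  some dimension $m \le d$, along which $U - \min U$ is $o(t^{2d-2})$ at distance \<open>t\<close> from the piece. Hence
  \<open>\<delta>\<close> is $o(t^m)$ on each piece, and for a fixed \<open>a\<close> the values $\delta(a, x)$ with \<open>x\<close> in \<open>Z\<close> form a
  null set. A connected subset of the quotient containing two points would be mapped by the distance
  from one of them onto a set containing an interval.\<close>

section \<open>Functions of class $C^k$\<close>

text \<open>The exponent 2d - 2 comes from a scaling balance. If the potential exceeds its minimum
  by o(t^(2d-2)) along a segment of length t, a speed of the order of the square root of this excess
  gives a cost t * o(t^(d-1)) = o(t^d), which is exactly what a covering by N^d cells of mesh 1/N
  turns into total length o(1). On a piece of lower dimension m the same balance asks for 2m - 2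
  orders only. The obstacle is twofold: \<delta>(a, .) need not be differentiable, so that Sard's
  theorem cannot be applied to it, and the set of minima may be any closed set, at whose points the
  higher derivatives of U need not vanish. All smoothness is therefore taken from U, which vanishes
  to the required order in the parameters of each piece, while \<delta> enters only through a bound
  by length times the square root of the potential. The little o instead of a big O is essential,
  since it makes the covering sums tend to zero; its origin is the uniform continuity of the
  derivatives of highest order.\<close>

lemma Ck_on_cong:
  assumes "open S" "\<And>x. x \<in> S \<Longrightarrow> f x = g x"
  shows "Ck_on k S f \<longleftrightarrow> Ck_on k S g"
  using assms
proof (induction k arbitrary: f g)
  case 0
  then show ?case by (simp cong: continuous_on_cong)
next
  case (Suc k)
  have d: "f differentiable (at x) \<longleftrightarrow> g differentiable (at x)" if "x \<in> S" for x
    using has_derivative_transform_within_open[OF _ \<open>open S\<close> that, of f _ UNIV g]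
      has_derivative_transform_within_open[OF _ \<open>open S\<close> that, of g _ UNIV f] Suc.prems
    unfolding differentiable_def by auto
  have e: "frechet_derivative f (at x) = frechet_derivative g (at x)"
    if "x \<in> S" "f differentiable (at x)" for x
    using frechet_derivative_transform_within_open[OF that(2) \<open>open S\<close> that(1)] Suc.prems by auto
  show ?case
  proof (cases "\<forall>x\<in>S. f differentiable (at x)")
    case True
    have "Ck_on k S (\<lambda>x. frechet_derivative f (at x) v) \<longleftrightarrow>
      Ck_on k S (\<lambda>x. frechet_derivative g (at x) v)" for v
      by (rule Suc.IH) (use Suc.prems True e in auto)
    then show ?thesis using d by simp
  qed (use d in auto)
qed

lemma Ck_on_subset: "Ck_on k S f \<Longrightarrow> T \<subseteq> S \<Longrightarrow> Ck_on k T f"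
  by (induction k arbitrary: f) (auto intro: continuous_on_subset)

text \<open>\<open>frechet_derivative\<close> is a choice operator; this rule trades it for an
  explicit derivative formula, and the closure properties below rest on it.\<close>

lemma Ck_on_SucI:
  assumes "open S" "\<And>x. x \<in> S \<Longrightarrow> (f has_derivative f' x) (at x)"
    "\<And>v. Ck_on k S (\<lambda>x. f' x v)"
  shows "Ck_on (Suc k) S f"
proof -
  have e: "frechet_derivative f (at x) = f' x" if "x \<in> S" for x
    using frechet_derivative_at[OF assms(2)[OF that]] by simp
  have "Ck_on k S (\<lambda>x. frechet_derivative f (at x) v)" for v
    using Ck_on_cong[OF assms(1), of "\<lambda>x. frechet_derivative f (at x) v" "\<lambda>x. f' x v"] e assms(3)
    by auto
  then show ?thesis using assms(2) by (auto simp: differentiable_def)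
qed

lemma Ck_on_Suc_has_derivative:
  "Ck_on (Suc k) S f \<Longrightarrow> x \<in> S \<Longrightarrow> (f has_derivative frechet_derivative f (at x)) (at x)"
  by (simp add: frechet_derivative_works)

lemma Ck_on_Suc_lower: "Ck_on (Suc k) S f \<Longrightarrow> Ck_on k S f"
proof (induction k arbitrary: f)
  case 0
  then show ?case
    by (auto intro!: differentiable_imp_continuous_on differentiable_at_imp_differentiable_on)
next
  case (Suc k)
  show ?case unfolding Ck_on.simps(2)[of k]
    using Suc.prems Suc.IH unfolding Ck_on.simps(2)[of "Suc k"] by blast
qed

lemma Ck_on_mono: "Ck_on n S f \<Longrightarrow> k \<le> n \<Longrightarrow> Ck_on k S f"
  by (induction n rule: nat_induct) (auto simp del: Ck_on.simps simp: le_Suc_eq dest: Ck_on_Suc_lower)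

lemma Ck_on_continuous_on: "Ck_on k S f \<Longrightarrow> continuous_on S f"
  using Ck_on_mono[of k S f 0] by simp

lemma Ck_on_const: "open S \<Longrightarrow> Ck_on k S (\<lambda>x. c)"
proof (induction k arbitrary: c)
  case (Suc k)
  show ?case
    by (rule Ck_on_SucI[OF Suc.prems, of _ "\<lambda>x v. 0"]) (use Suc in auto)
qed simp

lemma Ck_on_bounded_linear:
  assumes "open S" "bounded_linear h"
  shows "Ck_on k S h"
proof (cases k)
  case 0
  then show ?thesis using assms by (simp add: linear_continuous_on)
next
  case (Suc n)
  show ?thesis unfolding Suc
    by (rule Ck_on_SucI[OF assms(1), of _ "\<lambda>x. h"])
      (use assms in \<open>auto intro: bounded_linear_imp_has_derivative Ck_on_const\<close>)
qed

lemma Ck_on_add: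
  assumes "open S"
  shows "Ck_on k S f \<Longrightarrow> Ck_on k S g \<Longrightarrow> Ck_on k S (\<lambda>x. f x + g x)"
proof (induction k arbitrary: f g)
  case 0
  then show ?case by (auto intro: continuous_on_add)
next
  case (Suc k)
  show ?case
    by (rule Ck_on_SucI[OF assms has_derivative_add])
      (use Suc Ck_on_Suc_has_derivative[of k S] in \<open>auto simp: frechet_derivative_works\<close>)
qed

lemma (in bounded_linear) Ck_on:
  assumes "open S"
  shows "Ck_on k S g \<Longrightarrow> Ck_on k S (\<lambda>x. f (g x))"
proof (induction k arbitrary: g)
  case 0
  then show ?case by (auto intro: continuous_on)
next
  case (Suc k)
  show ?case
    by (rule Ck_on_SucI[OF assms has_derivative])
      (use Suc in \<open>auto simp: frechet_derivative_works\<close>)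
qed

lemma Ck_on_diff:
  fixes f g :: "'a::real_normed_vector \<Rightarrow> 'b::real_normed_vector"
  assumes "open S" "Ck_on k S f" "Ck_on k S g"
  shows "Ck_on k S (\<lambda>x. f x - g x)"
  using Ck_on_add[OF assms(1,2), of "\<lambda>x. - g x"]
    bounded_linear.Ck_on[OF bounded_linear_minus[OF bounded_linear_ident] assms(1,3)] by simp

lemma Ck_on_sum:
  assumes "open S" "\<And>i. i \<in> I \<Longrightarrow> Ck_on k S (f i)"
  shows "Ck_on k S (\<lambda>x. \<Sum>i\<in>I. f i x)"
  using assms(2)
  by (induction I rule: infinite_finite_induct)
    (auto intro!: Ck_on_const Ck_on_add assms(1) simp del: Ck_on.simps)

lemma (in bounded_bilinear) Ck_on:
  assumes "open S"
  shows "Ck_on k S f \<Longrightarrow> Ck_on k S g \<Longrightarrow> Ck_on k S (\<lambda>x. prod (f x) (g x))"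
proof (induction k arbitrary: f g)
  case 0
  then show ?case by (auto intro: continuous_on)
next
  case (Suc k)
  show ?case
  proof (rule Ck_on_SucI[OF assms FDERIV])
    fix v
    show "Ck_on k S (\<lambda>x. prod (f x) (frechet_derivative g (at x) v) +
                         prod (frechet_derivative f (at x) v) (g x))"
      by (intro Ck_on_add assms Suc.IH)
        (use Suc.prems Ck_on_Suc_lower in \<open>auto simp del: Ck_on.simps(1)\<close>)
  qed (use Suc.prems in \<open>auto simp: frechet_derivative_works\<close>)
qed

lemma Ck_on_inverse:
  fixes f :: "'a::real_normed_vector \<Rightarrow> real"
  assumes "open S" "\<And>x. x \<in> S \<Longrightarrow> f x \<noteq> 0"
  shows "Ck_on k S f \<Longrightarrow> Ck_on k S (\<lambda>x. inverse (f x))"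
proof (induction k)
  case 0
  then show ?case using assms by (auto intro: continuous_on_inverse)
next
  case (Suc k)
  have inv: "Ck_on k S (\<lambda>x. inverse (f x))" using Suc Ck_on_Suc_lower by blast
  show ?case
  proof (rule Ck_on_SucI[OF assms(1)])
    fix v
    have "Ck_on k S (\<lambda>x. 0 - inverse (f x) * frechet_derivative f (at x) v * inverse (f x))"
      by (intro Ck_on_diff assms Ck_on_const bounded_bilinear.Ck_on[OF bounded_bilinear_mult] inv)
        (use Suc.prems in auto)
    then show "Ck_on k S (\<lambda>x. - (inverse (f x) * frechet_derivative f (at x) v * inverse (f x)))"
      by simp
  qed (rule Deriv.has_derivative_inverse, use Suc.prems assms in \<open>auto simp: frechet_derivative_works\<close>)
qed

lemma linear_eq_sum_Basis:
  fixes h :: "'a::euclidean_space \<Rightarrow> 'b::real_vector"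
  assumes "linear h"
  shows "h w = (\<Sum>b\<in>Basis. (w \<bullet> b) *\<^sub>R h b)"
proof -
  have "h w = h (\<Sum>b\<in>Basis. (w \<bullet> b) *\<^sub>R b)" by (simp add: euclidean_representation)
  then show ?thesis by (simp only: linear_sum[OF assms] linear_cmul[OF assms])
qed

text \<open>In the chain rule both the base point and the direction of the derivative of
  \<open>f\<close> depend on x, whereas \<open>Ck_on\<close> speaks of fixed directions. Expanding
  the direction in the basis leaves products of scalar functions with fixed directional derivatives
  of \<open>f\<close> composed with \<open>g\<close>, and to these the induction hypothesis
  applies.\<close>

lemma Ck_on_compose:
  fixes f :: "'b::euclidean_space \<Rightarrow> 'c::real_normed_vector"
    and g :: "'a::real_normed_vector \<Rightarrow> 'b"
  assumes "open S" "open T" "g ` S \<subseteq> T"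
  shows "Ck_on k T f \<Longrightarrow> Ck_on k S g \<Longrightarrow> Ck_on k S (\<lambda>x. f (g x))"
proof (induction k arbitrary: f)
  case 0
  then show ?case using assms by (auto intro: continuous_on_compose2)
next
  case (Suc k)
  let ?f' = "\<lambda>y. frechet_derivative f (at y)" and ?g' = "\<lambda>x. frechet_derivative g (at x)"
  have gk: "Ck_on k S g" using Suc.prems Ck_on_Suc_lower by blast
  have df: "(f has_derivative ?f' (g x)) (at (g x))" if "x \<in> S" for x
    using Suc.prems assms that by (intro Ck_on_Suc_has_derivative) auto
  have dg: "(g has_derivative ?g' x) (at x)" if "x \<in> S" for x
    using Suc.prems that by (intro Ck_on_Suc_has_derivative)
  show ?case
  proof (rule Ck_on_SucI[OF assms(1)])
    fix x assume x: "x \<in> S"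
    have "((\<lambda>x. f (g x)) has_derivative (\<lambda>v. ?f' (g x) (?g' x v))) (at x)"
      using has_derivative_compose[OF dg[OF x] df[OF x]] .
    also have "(\<lambda>v. ?f' (g x) (?g' x v)) = (\<lambda>v. \<Sum>b\<in>Basis. (?g' x v \<bullet> b) *\<^sub>R ?f' (g x) b)"
      by (rule ext linear_eq_sum_Basis[OF has_derivative_linear[OF df[OF x]]])+
    finally show "((\<lambda>x. f (g x)) has_derivative
        (\<lambda>v. \<Sum>b\<in>Basis. (?g' x v \<bullet> b) *\<^sub>R ?f' (g x) b)) (at x)" .
  next
    fix v
    show "Ck_on k S (\<lambda>x. \<Sum>b\<in>Basis. (?g' x v \<bullet> b) *\<^sub>R ?f' (g x) b)"
      by (intro Ck_on_sum assms(1) bounded_bilinear.Ck_on[OF bounded_bilinear_scaleR]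
          bounded_linear.Ck_on[OF bounded_linear_inner_left] Suc.IH gk)
        (use Suc.prems in auto)
  qed
qed

text \<open>\<open>Ck_on\<close> controls the derivative in a fixed direction; the moving direction
  \<open>q s\<close> is again expanded in the basis, with continuous coefficients.\<close>

lemma Ck_on_frechet_derivative_continuous:
  fixes f :: "'a::euclidean_space \<Rightarrow> 'b::real_normed_vector"
  assumes f: "Ck_on (Suc k) S f" and "continuous_on R p" "continuous_on R q" "p ` R \<subseteq> S"
  shows "continuous_on R (\<lambda>s. frechet_derivative f (at (p s)) (q s))"
proof -
  let ?D = "\<lambda>y. frechet_derivative f (at y)"
  have *: "?D (p s) (q s) = (\<Sum>b\<in>Basis. (q s \<bullet> b) *\<^sub>R ?D (p s) b)" if "s \<in> R" for s
    using Ck_on_Suc_has_derivative[OF f, of "p s"] assms(4) that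
    by (intro linear_eq_sum_Basis has_derivative_linear) auto
  have "continuous_on R (\<lambda>s. \<Sum>b\<in>Basis. (q s \<bullet> b) *\<^sub>R ?D (p s) b)"
    by (intro continuous_intros assms continuous_on_compose2[OF Ck_on_continuous_on _ assms(4), of k])
      (use f in auto)
  then show ?thesis
    by (rule continuous_on_eq) (rule *[symmetric])
qed

text \<open>The map straightening the hypersurface \<open>f = 0\<close> changes the coordinate \<open>b\<close> only, so that its
  inverse does as well, and the derivative of the inverse is given by an explicit formula, from
  which its regularity is read off.\<close>

lemma straightening:
  fixes f :: "'a::euclidean_space \<Rightarrow> real"
  assumes \<Omega>: "open \<Omega>" "p \<in> \<Omega>" and f: "Ck_on (Suc k) \<Omega> f"
    and b: "b \<in> Basis" "frechet_derivative f (at p) b \<noteq> 0"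
  defines "\<Phi> \<equiv> \<lambda>x. x + (f x - x \<bullet> b) *\<^sub>R b"
  obtains X Y g where "open X" "X \<subseteq> \<Omega>" "p \<in> X" "open Y" "homeomorphism X Y \<Phi> g"
    "Ck_on (Suc k) Y g"
proof -
  let ?D = "\<lambda>x. frechet_derivative f (at x)"
  let ?P = "\<lambda>x w. w + (?D x w - w \<bullet> b) *\<^sub>R b"
  \<comment> \<open>The inverse of \<open>?P x\<close>: a solution of \<open>?P x w = z\<close> has
    the form z - c b, and comparing the components along b gives D z - c D b = z \<bullet> b, where
    D is \<open>?D x\<close>.\<close>
  let ?Q = "\<lambda>x z. z - ((?D x z - z \<bullet> b) * inverse (?D x b)) *\<^sub>R b"
  have bb: "b \<bullet> b = 1" using b by simp
  have df: "(f has_derivative ?D x) (at x)" if "x \<in> \<Omega>" for x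
    using Ck_on_Suc_has_derivative[OF f that] .
  have lin: "linear (?D x)" if "x \<in> \<Omega>" for x
    using df[OF that] has_derivative_linear by blast
  have dP: "(\<Phi> has_derivative ?P x) (at x)" if "x \<in> \<Omega>" for x
    unfolding \<Phi>_def using df[OF that] by (auto intro!: derivative_eq_intros)
  have blP: "bounded_linear (?P x)" if "x \<in> \<Omega>" for x
    using dP[OF that] has_derivative_bounded_linear by blast
  have blQ: "bounded_linear (?Q x)" if "x \<in> \<Omega>" for x
    using df[OF that, THEN has_derivative_bounded_linear]
    by (intro bounded_linear_sub bounded_linear_ident bounded_linear_scaleR_const
        bounded_linear_mult_const bounded_linear_inner_left) auto
  have PQ: "?P x (?Q x z) = z" if "x \<in> \<Omega>" "?D x b \<noteq> 0" for x z
  proof -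
    have "?D x (?Q x z) = ?D x z - (?D x z - z \<bullet> b)"
      using lin[OF that(1)] that(2) by (simp add: linear_diff linear_cmul field_simps)
    then show ?thesis using that(2) bb by (simp add: inner_diff_left algebra_simps)
  qed
  have QP: "?Q x (?P x z) = z" if "x \<in> \<Omega>" "?D x b \<noteq> 0" for x z
  proof -
    have "?D x (?P x z) = ?D x z + (?D x z - z \<bullet> b) * ?D x b"
      using lin[OF that(1)] by (simp add: linear_add linear_cmul)
    moreover have "?P x z \<bullet> b = ?D x z" using bb by (simp add: inner_add_left)
    ultimately have "(?D x (?P x z) - ?P x z \<bullet> b) * inverse (?D x b) = ?D x z - z \<bullet> b"
      using that(2) by simp
    then show ?thesis by simp
  qed
  define P' where "P' x = Blinfun (?P x)" for x
  have P': "blinfun_apply (P' x) = ?P x" if "x \<in> \<Omega>" for x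
    unfolding P'_def using blP[OF that] by (rule bounded_linear_Blinfun_apply)
  have cont: "continuous_on \<Omega> P'"
  proof (rule continuous_on_blinfun_componentwise)
    fix i :: 'a
    have "continuous_on \<Omega> (\<lambda>x. ?D x i)"
      using f by (auto intro: Ck_on_continuous_on[of k])
    then have "continuous_on \<Omega> (\<lambda>x. ?P x i)"
      by (intro continuous_intros)
    then show "continuous_on \<Omega> (\<lambda>x. blinfun_apply (P' x) i)"
      using P' by (simp cong: continuous_on_cong)
  qed
  have "Blinfun (?Q p) o\<^sub>L P' p = id_blinfun"
    by (rule blinfun_eqI)
      (use P' blQ QP \<Omega> b in \<open>simp add: bounded_linear_Blinfun_apply\<close>)
  note inv = this
  obtain X Y g g' where X: "open X" "X \<subseteq> \<Omega>" "p \<in> X" "open Y"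
    and h: "homeomorphism X Y \<Phi> g"
    and g': "\<And>y. y \<in> Y \<Longrightarrow> (g has_derivative g' y) (at y)"
    "\<And>y. y \<in> Y \<Longrightarrow> g' y = inv (blinfun_apply (P' (g y)))"
    "\<And>y. y \<in> Y \<Longrightarrow> bij (blinfun_apply (P' (g y)))"
    by (rule inverse_function_theorem[OF \<Omega>(1) _ cont \<Omega>(2) inv, of \<Phi>])
      (simp only: P' dP, rule that)
  have gX: "g ` Y = X" using h by (simp add: homeomorphism_def)
  have g\<Omega>: "g y \<in> \<Omega>" if "y \<in> Y" for y using gX X that by blast
  \<comment> \<open>\<open>P' (g y)\<close> is bijective and maps b to \<open>?D (g y) b\<close>
    times b, so this factor cannot vanish. The formula for \<open>?Q\<close> is thus available on
    all of \<open>Y\<close>, not just at the image of p.\<close>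
  have nz: "?D (g y) b \<noteq> 0" if "y \<in> Y" for y
  proof
    assume "?D (g y) b = 0"
    then have "blinfun_apply (P' (g y)) b = blinfun_apply (P' (g y)) 0"
      using P'[OF g\<Omega>[OF that]] bb lin[OF g\<Omega>[OF that]] by (simp add: linear_0)
    then show False using g'(3)[OF that] b by (metis bij_def injD nonzero_Basis)
  qed
  have der: "(g has_derivative ?Q (g y)) (at y)" if "y \<in> Y" for y
  proof -
    have "g' y = ?Q (g y)"
      unfolding g'(2)[OF that] P'[OF g\<Omega>[OF that]]
      by (rule inv_equality) (use PQ QP g\<Omega>[OF that] nz[OF that] in auto)
    then show ?thesis using g'(1)[OF that] by simp
  qed
  \<comment> \<open>Bootstrap: the derivative of \<open>g\<close> is a rational expression in
    directional derivatives of \<open>f\<close> at \<open>g y\<close>, which are of class C^k. So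
    class C^j of \<open>g\<close> with j \<le> k makes the derivative of class C^j.\<close>
  have "j \<le> Suc k \<Longrightarrow> Ck_on j Y g" for j
  proof (induction j)
    case 0
    then show ?case using h by (simp add: homeomorphism_def)
  next
    case (Suc j)
    have D: "Ck_on j Y (\<lambda>y. ?D (g y) v)" for v
      by (rule Ck_on_compose[OF X(4) \<Omega>(1)])
        (use g\<Omega> Suc f in \<open>auto intro: Ck_on_mono[of k]\<close>)
    show ?case
      by (rule Ck_on_SucI[OF X(4) der], assumption)
        (intro Ck_on_diff Ck_on_const X bounded_bilinear.Ck_on[OF bounded_bilinear_scaleR]
          bounded_bilinear.Ck_on[OF bounded_bilinear_mult] D Ck_on_inverse nz; assumption)
  qed
  with that X h show thesis by blast
qed

section \<open>Morse decomposition\<close>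

definition coord_space :: "'a::euclidean_space set \<Rightarrow> 'a set" where
  "coord_space S = {x. \<forall>b\<in>Basis - S. x \<bullet> b = 0}"

lemma coord_spaceD: "x \<in> coord_space S \<Longrightarrow> b \<in> Basis \<Longrightarrow> b \<notin> S \<Longrightarrow> x \<bullet> b = 0"
  by (simp add: coord_space_def)

lemma convex_coord_space: "convex (coord_space S)"
  unfolding coord_space_def convex_def by (auto simp: inner_add_left)

text \<open>Since dimensions are types, \<open>card T\<close>-dimensional parameter spaces are modelled by coordinate
  subspaces of the ambient space, and \<open>\<psi>\<close> is defined on a full-dimensional ball.\<close>

definition morse_piece ::
  "nat \<Rightarrow> 'a::euclidean_space set \<Rightarrow> 'a set \<Rightarrow> 'a set \<Rightarrow> 'a set \<Rightarrow> bool" where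
  "morse_piece k S \<Omega> A P \<longleftrightarrow> (\<exists>T c \<rho> \<psi> K B. T \<subseteq> S \<and> B \<subseteq> coord_space T \<inter> ball c \<rho> \<and>
     P = \<psi> ` B \<and> P \<subseteq> A \<and> Ck_on 1 (ball c \<rho>) \<psi> \<and> \<psi> ` ball c \<rho> \<subseteq> \<Omega> \<and>
     \<psi> ` (coord_space T \<inter> ball c \<rho>) \<subseteq> coord_space S \<and>
     (\<forall>z\<in>ball c \<rho>. \<forall>v. norm (frechet_derivative \<psi> (at z) v) \<le> K * norm v) \<and>
     (\<forall>f::'a \<Rightarrow> real. Ck_on k \<Omega> f \<and> (\<forall>x\<in>A. f x = 0) \<longrightarrow>
       (\<forall>\<epsilon>>0. \<exists>\<delta>>0. \<forall>y\<in>B. \<forall>x\<in>coord_space T \<inter> ball c \<rho>. norm (x - y) < \<delta> \<longrightarrow>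
         \<bar>f (\<psi> x)\<bar> \<le> \<epsilon> * norm (x - y) ^ k)))"

lemma morse_pieceI:
  assumes "T \<subseteq> S" "B \<subseteq> coord_space T \<inter> ball c \<rho>" "P = \<psi> ` B" "P \<subseteq> A" "Ck_on 1 (ball c \<rho>) \<psi>"
    "\<psi> ` ball c \<rho> \<subseteq> \<Omega>" "\<psi> ` (coord_space T \<inter> ball c \<rho>) \<subseteq> coord_space S"
    "\<And>z v. z \<in> ball c \<rho> \<Longrightarrow> norm (frechet_derivative \<psi> (at z) v) \<le> K * norm v"
    "\<And>f::'a::euclidean_space \<Rightarrow> real. \<And>\<epsilon>. Ck_on k \<Omega> f \<Longrightarrow> \<forall>x\<in>A. f x = 0 \<Longrightarrow> \<epsilon> > 0 \<Longrightarrow>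
       \<exists>\<delta>>0. \<forall>y\<in>B. \<forall>x\<in>coord_space T \<inter> ball c \<rho>. norm (x - y) < \<delta> \<longrightarrow>
         \<bar>f (\<psi> x)\<bar> \<le> \<epsilon> * norm (x - y) ^ k"
  shows "morse_piece k S \<Omega> A P"
  unfolding morse_piece_def
  by (rule exI[of _ T], rule exI[of _ c], rule exI[of _ \<rho>], rule exI[of _ \<psi>], rule exI[of _ K],
      rule exI[of _ B], intro conjI allI impI ballI assms)
    (assumption | (elim conjE, assumption) | (elim conjE, erule bspec, assumption))+

lemma morse_pieceE:
  assumes "morse_piece k S \<Omega> A P"
  obtains T c \<rho> \<psi> K B where "T \<subseteq> S" "B \<subseteq> coord_space T \<inter> ball c \<rho>" "P = \<psi> ` B" "P \<subseteq> A"
    "Ck_on 1 (ball c \<rho>) \<psi>" "\<psi> ` ball c \<rho> \<subseteq> \<Omega>"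
    "\<psi> ` (coord_space T \<inter> ball c \<rho>) \<subseteq> coord_space S"
    "\<And>z v. z \<in> ball c \<rho> \<Longrightarrow> norm (frechet_derivative \<psi> (at z) v) \<le> K * norm v"
    "\<And>f::'a::euclidean_space \<Rightarrow> real. \<And>\<epsilon>. Ck_on k \<Omega> f \<Longrightarrow> \<forall>x\<in>A. f x = 0 \<Longrightarrow> \<epsilon> > 0 \<Longrightarrow>
       \<exists>\<delta>>0. \<forall>y\<in>B. \<forall>x\<in>coord_space T \<inter> ball c \<rho>. norm (x - y) < \<delta> \<longrightarrow>
         \<bar>f (\<psi> x)\<bar> \<le> \<epsilon> * norm (x - y) ^ k"
  using assms unfolding morse_piece_def
  apply (elim exE conjE)
  subgoal premises p for T c \<rho> \<psi> K B
    by (rule p(1)[of T B c \<rho> \<psi> K]) (use p(2-) in \<open>(assumption | simp)+\<close>)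
  done

text \<open>Mean value theorem along the segment from y to x in the parameter space: a bound of
  order k on the derivatives of \<open>f\<close> becomes one of order k + 1 on \<open>f\<close>.
  Derivatives in the directions of \<open>S\<close> suffice because the image of the segment runs
  inside \<open>coord_space S\<close>.\<close>

lemma vanishing_rate_Suc:
  fixes f :: "'a::euclidean_space \<Rightarrow> real" and \<psi> :: "'a \<Rightarrow> 'a" and K e \<rho> :: real
  assumes \<psi>: "Ck_on 1 (ball c \<rho>) \<psi>" "\<psi> ` ball c \<rho> \<subseteq> \<Omega>"
    "\<psi> ` (coord_space T \<inter> ball c \<rho>) \<subseteq> coord_space S"
    and S: "S \<subseteq> Basis"
    and K: "\<And>z v. z \<in> ball c \<rho> \<Longrightarrow> norm (frechet_derivative \<psi> (at z) v) \<le> K * norm v"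
    and f: "\<And>x. x \<in> \<Omega> \<Longrightarrow> f differentiable (at x)"
    and xy: "x \<in> coord_space T \<inter> ball c \<rho>" "y \<in> coord_space T \<inter> ball c \<rho>" "f (\<psi> y) = 0"
    and D: "\<And>b z. b \<in> S \<Longrightarrow> z \<in> closed_segment y x \<Longrightarrow>
       \<bar>frechet_derivative f (at (\<psi> z)) b\<bar> \<le> e * norm (z - y) ^ k"
    and e: "e \<ge> 0"
  shows "\<bar>f (\<psi> x)\<bar> \<le> (card S * \<bar>K\<bar>) * e * norm (x - y) ^ Suc k"
proof -
  define l where "l s = y + s *\<^sub>R (x - y)" for s :: real
  have l_seg: "l s \<in> closed_segment y x" if "s \<in> {0..1}" for s
    using that unfolding l_def closed_segment_def
    by (auto intro!: exI[of _ s] simp: algebra_simps)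
  have l_in: "l s \<in> coord_space T \<inter> ball c \<rho>" if "s \<in> {0..1}" for s
    using closed_segment_subset[OF xy(2,1) convex_Int[OF convex_coord_space convex_ball]]
      l_seg[OF that] by blast
  have dl: "(l has_derivative (\<lambda>t. t *\<^sub>R (x - y))) (at s)" for s
    unfolding l_def by (auto intro!: derivative_eq_intros)
  define w where "w s = frechet_derivative \<psi> (at (l s)) (x - y)" for s
  have d\<psi>: "(\<psi> has_derivative frechet_derivative \<psi> (at (l s))) (at (l s))" if "s \<in> {0..1}" for s
    using l_in[OF that] \<psi>(1) by (intro Ck_on_Suc_has_derivative[of 0]) auto
  have d\<psi>l: "((\<lambda>s. \<psi> (l s)) has_derivative (\<lambda>t. t *\<^sub>R w s)) (at s)" if "s \<in> {0..1}" for s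
    using has_derivative_compose[OF dl d\<psi>[OF that]]
      linear_cmul[OF has_derivative_linear[OF d\<psi>[OF that]]] by (simp add: w_def)
  have df: "(f has_derivative frechet_derivative f (at (\<psi> (l s)))) (at (\<psi> (l s)))"
    if "s \<in> {0..1}" for s
    unfolding frechet_derivative_works[symmetric] using l_in[OF that] \<psi>(2) by (intro f) auto
  have dF: "((\<lambda>s. f (\<psi> (l s))) has_real_derivative frechet_derivative f (at (\<psi> (l s))) (w s)) (at s)"
    if "s \<in> {0..1}" for s
    using has_derivative_compose[OF d\<psi>l[OF that] df[OF that]]
      linear_cmul[OF has_derivative_linear[OF df[OF that]]]
    by (simp add: has_field_derivative_def mult_commute_abs)
  have "\<exists>s>0. s < 1 \<and> f (\<psi> (l 1)) - f (\<psi> (l 0)) =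
      (1 - 0) * frechet_derivative f (at (\<psi> (l s))) (w s)"
    by (rule MVT2, simp, rule dF, simp)
  then obtain s where s: "0 < s" "s < 1" and
    mv: "f (\<psi> (l 1)) - f (\<psi> (l 0)) = (1 - 0) * frechet_derivative f (at (\<psi> (l s))) (w s)"
    by blast
  have s': "s \<in> {0..1}" using s by auto
  \<comment> \<open>The curve stays in \<open>coord_space S\<close> on an open interval around s, so
    its velocity has no components outside \<open>S\<close>. This uses that the mean value theorem
    provides an interior s.\<close>
  have w0: "w s \<bullet> b = 0" if "b \<in> Basis - S" for b
  proof -
    have 1: "((\<lambda>s. \<psi> (l s) \<bullet> b) has_real_derivative w s \<bullet> b) (at s)"
      using has_derivative_inner_left[OF d\<psi>l[OF s'], of b]
      by (simp add: has_field_derivative_def mult_commute_abs)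
    have "\<psi> (l t) \<bullet> b = 0" if "t \<in> {0<..<1}" for t
    proof -
      have "l t \<in> coord_space T \<inter> ball c \<rho>" using l_in[of t] that by simp
      then have "\<psi> (l t) \<in> coord_space S" using \<psi>(3) by blast
      then show ?thesis using \<open>b \<in> Basis - S\<close> by (simp add: coord_space_def)
    qed
    then have "((\<lambda>s. \<psi> (l s) \<bullet> b) has_real_derivative 0) (at s)"
      by (intro has_field_derivative_transform_within_open[OF DERIV_const[of 0], of "{0<..<1}"])
        (use s in simp_all)
    then show ?thesis by (rule DERIV_unique[OF 1])
  qed
  have "frechet_derivative f (at (\<psi> (l s))) (w s) =
      (\<Sum>b\<in>Basis. (w s \<bullet> b) *\<^sub>R frechet_derivative f (at (\<psi> (l s))) b)"
    by (rule linear_eq_sum_Basis[OF has_derivative_linear[OF df[OF s']]])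
  also have "\<dots> = (\<Sum>b\<in>S. (w s \<bullet> b) *\<^sub>R frechet_derivative f (at (\<psi> (l s))) b)"
    by (rule sum.mono_neutral_right) (use S w0 in auto)
  finally have eq: "f (\<psi> x) = (\<Sum>b\<in>S. (w s \<bullet> b) *\<^sub>R frechet_derivative f (at (\<psi> (l s))) b)"
    using mv xy(3) by (simp add: l_def)
  have "\<bar>(w s \<bullet> b) *\<^sub>R frechet_derivative f (at (\<psi> (l s))) b\<bar>
      \<le> (\<bar>K\<bar> * norm (x - y)) * (e * norm (x - y) ^ k)" if "b \<in> S" for b
  proof -
    have "\<bar>w s \<bullet> b\<bar> \<le> norm (w s)" using that S by (intro Basis_le_norm) auto
    also have "\<dots> \<le> K * norm (x - y)" unfolding w_def using l_in[OF s'] by (intro K) auto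
    also have "\<dots> \<le> \<bar>K\<bar> * norm (x - y)" by (intro mult_right_mono) auto
    finally have 1: "\<bar>w s \<bullet> b\<bar> \<le> \<bar>K\<bar> * norm (x - y)" .
    have "norm (l s - y) \<le> norm (x - y)" unfolding l_def using s
      by (simp add: mult_left_le_one_le)
    then have "e * norm (l s - y) ^ k \<le> e * norm (x - y) ^ k"
      using e by (intro mult_left_mono power_mono) auto
    with D[OF that l_seg[OF s']]
    have "\<bar>frechet_derivative f (at (\<psi> (l s))) b\<bar> \<le> e * norm (x - y) ^ k" by simp
    with 1 show ?thesis by (simp add: abs_mult mult_mono)
  qed
  then have "\<bar>f (\<psi> x)\<bar> \<le> (\<Sum>b\<in>S. (\<bar>K\<bar> * norm (x - y)) * (e * norm (x - y) ^ k))"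
    unfolding eq by (intro order_trans[OF sum_abs] sum_mono)
  then show ?thesis by (simp add: mult_ac)
qed

text \<open>By \<open>crit\<close> the derivatives along \<open>S\<close> of a C^(k+1) function
  vanishing on \<open>A\<close> are C^k functions vanishing on \<open>A'\<close>. The piece bounds
  them with order k, and integration along segments gains one order.\<close>

lemma morse_piece_Suc:
  assumes S: "S \<subseteq> Basis"
    and piece: "morse_piece k S \<Omega> A' P" and "A' \<subseteq> A"
    and crit: "\<And>f b x. Ck_on (Suc k) \<Omega> f \<Longrightarrow> (\<forall>x\<in>A. f x = 0) \<Longrightarrow> b \<in> S \<Longrightarrow> x \<in> A' \<Longrightarrow>
       frechet_derivative f (at x) b = (0::real)"
  shows "morse_piece (Suc k) S \<Omega> A P"
proof -
  from piece obtain T c \<rho> \<psi> K B where p: "T \<subseteq> S" "B \<subseteq> coord_space T \<inter> ball c \<rho>"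
     "P = \<psi> ` B" "P \<subseteq> A'" "Ck_on 1 (ball c \<rho>) \<psi>" "\<psi> ` ball c \<rho> \<subseteq> \<Omega>"
     "\<psi> ` (coord_space T \<inter> ball c \<rho>) \<subseteq> coord_space S"
     "\<And>z v. z \<in> ball c \<rho> \<Longrightarrow> norm (frechet_derivative \<psi> (at z) v) \<le> K * norm v"
     and rate: "\<And>f::'a \<Rightarrow> real. \<And>\<epsilon>. Ck_on k \<Omega> f \<Longrightarrow> (\<forall>x\<in>A'. f x = 0) \<Longrightarrow> \<epsilon> > 0 \<Longrightarrow>
       (\<exists>\<delta>>0. \<forall>y\<in>B. \<forall>x\<in>coord_space T \<inter> ball c \<rho>. norm (x - y) < \<delta> \<longrightarrow>
         \<bar>f (\<psi> x)\<bar> \<le> \<epsilon> * norm (x - y) ^ k)"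
    by (rule morse_pieceE) (rule that)
  have fS: "finite S" using S finite_Basis finite_subset by blast
  have "\<exists>\<delta>>0. \<forall>y\<in>B. \<forall>x\<in>coord_space T \<inter> ball c \<rho>. norm (x - y) < \<delta> \<longrightarrow>
         \<bar>f (\<psi> x)\<bar> \<le> \<epsilon> * norm (x - y) ^ Suc k"
    if f: "Ck_on (Suc k) \<Omega> f" "\<forall>x\<in>A. f x = 0" and \<epsilon>: "\<epsilon> > 0" for f :: "'a \<Rightarrow> real" and \<epsilon>
  proof -
    \<comment> \<open>The factor by which \<open>vanishing_rate_Suc\<close> loses is divided out;
      the summand 1 keeps the denominator positive.\<close>
    define e where "e = \<epsilon> / (card S * \<bar>K\<bar> + 1)"
    have e: "e > 0" "(card S * \<bar>K\<bar>) * e \<le> \<epsilon>" unfolding e_def using \<epsilon>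
      by (auto simp: field_simps add_pos_nonneg)
    have "\<exists>\<delta>>0. \<forall>y\<in>B. \<forall>x\<in>coord_space T \<inter> ball c \<rho>. norm (x - y) < \<delta> \<longrightarrow>
         \<bar>frechet_derivative f (at (\<psi> x)) b\<bar> \<le> e * norm (x - y) ^ k" if "b \<in> S" for b
      by (rule rate[of "\<lambda>x. frechet_derivative f (at x) b"]) (use f crit that e in auto)
    then obtain \<delta>' where \<delta>': "\<And>b. b \<in> S \<Longrightarrow> \<delta>' b > 0"
      "\<And>b x y. b \<in> S \<Longrightarrow> y \<in> B \<Longrightarrow> x\<in>coord_space T \<inter> ball c \<rho> \<Longrightarrow> norm (x - y) < \<delta>' b \<Longrightarrow>
         \<bar>frechet_derivative f (at (\<psi> x)) b\<bar> \<le> e * norm (x - y) ^ k"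
      by metis
    \<comment> \<open>One radius for all of the finitely many directions; the inserted 1 covers the
      case of empty \<open>S\<close>.\<close>
    define \<delta> where "\<delta> = Min (insert 1 (\<delta>' ` S))"
    have \<delta>: "\<delta> > 0" "\<And>b. b \<in> S \<Longrightarrow> \<delta> \<le> \<delta>' b"
      unfolding \<delta>_def using fS \<delta>'(1) by auto
    show ?thesis
    proof (intro exI[of _ \<delta>] conjI \<delta> ballI impI)
      fix y x assume xy: "y \<in> B" "x \<in> coord_space T \<inter> ball c \<rho>" "norm (x - y) < \<delta>"
      have yB: "y \<in> coord_space T \<inter> ball c \<rho>" using xy p by auto
      have fy: "f (\<psi> y) = 0" using f(2) xy(1) p(3,4) \<open>A' \<subseteq> A\<close> by blast
      have "\<bar>f (\<psi> x)\<bar> \<le> (card S * \<bar>K\<bar>) * e * norm (x - y) ^ Suc k"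
      proof (rule vanishing_rate_Suc[where f = f, OF p(5-7) S p(8) _ xy(2) yB fy])
        fix b z assume bz: "b \<in> S" "z \<in> closed_segment y x"
        have "norm (z - y) \<le> norm (x - y)"
          using segment_bound1[OF bz(2)] by (simp add: norm_minus_commute)
        moreover have "z \<in> coord_space T \<inter> ball c \<rho>"
          using closed_segment_subset[OF yB xy(2) convex_Int[OF convex_coord_space convex_ball]] bz
          by blast
        ultimately show "\<bar>frechet_derivative f (at (\<psi> z)) b\<bar> \<le> e * norm (z - y) ^ k"
          using \<delta>(2)[OF bz(1)] xy bz by (intro \<delta>'(2)) auto
      qed (use f e in auto)
      also have "\<dots> \<le> \<epsilon> * norm (x - y) ^ Suc k" using e by (intro mult_right_mono) auto
      finally show "\<bar>f (\<psi> x)\<bar> \<le> \<epsilon> * norm (x - y) ^ Suc k" .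
    qed
  qed
  moreover have "P \<subseteq> A" using p \<open>A' \<subseteq> A\<close> by auto
  ultimately show ?thesis using p(1-3,5-8) by (intro morse_pieceI[of T S B c \<rho> P \<psi>])
qed

text \<open>At order zero the rate is uniform continuity on the compact ball
  \<open>cball c \<rho>\<close>, compared with the value 0 on \<open>A\<close>; the parametrisation
  is the identity.\<close>

lemma morse_piece_0:
  assumes "cball c \<rho> \<subseteq> \<Omega>" "A \<subseteq> coord_space S"
  shows "morse_piece 0 S \<Omega> A (A \<inter> ball c \<rho>)"
proof -
  have fd: "frechet_derivative (\<lambda>x::'a. x) (at z) v = v" for z v :: 'a
    by (simp add: frechet_derivative_ident)
  have ck: "Ck_on 1 (ball c \<rho>) (\<lambda>x. x)"
    by (rule Ck_on_bounded_linear) (auto intro: bounded_linear_ident)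
  have "\<exists>\<delta>>0. \<forall>y\<in>A \<inter> ball c \<rho>. \<forall>x\<in>coord_space S \<inter> ball c \<rho>. norm (x - y) < \<delta> \<longrightarrow>
         \<bar>f x\<bar> \<le> \<epsilon> * norm (x - y) ^ 0"
    if f: "Ck_on 0 \<Omega> f" "\<forall>x\<in>A. f x = 0" and \<epsilon>: "\<epsilon> > 0" for f :: "'a \<Rightarrow> real" and \<epsilon>
  proof -
    have "uniformly_continuous_on (cball c \<rho>) f"
      using f(1) assms(1) by (intro compact_uniformly_continuous) (auto intro: continuous_on_subset)
    then obtain \<delta> where \<delta>: "\<delta> > 0" "\<And>x y. x \<in> cball c \<rho> \<Longrightarrow> y \<in> cball c \<rho> \<Longrightarrow>
      norm (x - y) < \<delta> \<Longrightarrow> \<bar>f x - f y\<bar> < \<epsilon>"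
      unfolding uniformly_continuous_on_def dist_norm using \<epsilon>
      by (metis real_norm_def)
    show ?thesis
    proof (intro exI[of _ \<delta>] conjI ballI impI)
      fix y x assume "y \<in> A \<inter> ball c \<rho>" "x \<in> coord_space S \<inter> ball c \<rho>" "norm (x - y) < \<delta>"
      then show "\<bar>f x\<bar> \<le> \<epsilon> * norm (x - y) ^ 0" using \<delta>(2)[of x y] f(2) by auto
    qed (fact \<delta>)
  qed
  then show ?thesis
    by (intro morse_pieceI[of S S "A \<inter> ball c \<rho>" c \<rho> _ "\<lambda>x. x" _ _ 1])
      (use ck fd assms in auto)
qed

text \<open>Composition with \<open>g\<close> turns C^k functions on \<open>\<Omega>\<close>
  vanishing on \<open>A\<close> into C^k functions on \<open>Y\<close> vanishing on
  \<open>A'\<close>, so the rate carries over with the same order. This lifts pieces found in a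
  straightened hypersurface back to the original set.\<close>

lemma morse_piece_image:
  assumes piece: "morse_piece k S' Y A' P" and "k \<ge> 1"
    and "S' \<subseteq> S" "open Y" "open \<Omega>"
    and g: "Ck_on k Y g" "g ` Y \<subseteq> \<Omega>" "g ` A' \<subseteq> A" "g ` (Y \<inter> coord_space S') \<subseteq> coord_space S"
    and C: "\<And>y v. y \<in> Y \<Longrightarrow> norm (frechet_derivative g (at y) v) \<le> C * norm v"
  shows "morse_piece k S \<Omega> A (g ` P)"
proof -
  from piece obtain T c \<rho> \<psi> K B where p: "T \<subseteq> S'" "B \<subseteq> coord_space T \<inter> ball c \<rho>"
     "P = \<psi> ` B" "P \<subseteq> A'" "Ck_on 1 (ball c \<rho>) \<psi>" "\<psi> ` ball c \<rho> \<subseteq> Y"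
     "\<psi> ` (coord_space T \<inter> ball c \<rho>) \<subseteq> coord_space S'"
     "\<And>z v. z \<in> ball c \<rho> \<Longrightarrow> norm (frechet_derivative \<psi> (at z) v) \<le> K * norm v"
     and rate: "\<And>f::'a \<Rightarrow> real. \<And>\<epsilon>. Ck_on k Y f \<Longrightarrow> (\<forall>x\<in>A'. f x = 0) \<Longrightarrow> \<epsilon> > 0 \<Longrightarrow>
       (\<exists>\<delta>>0. \<forall>y\<in>B. \<forall>x\<in>coord_space T \<inter> ball c \<rho>. norm (x - y) < \<delta> \<longrightarrow>
         \<bar>f (\<psi> x)\<bar> \<le> \<epsilon> * norm (x - y) ^ k)"
    by (rule morse_pieceE) (rule that)
  have g1: "Ck_on 1 Y g" using Ck_on_mono[OF g(1) \<open>k \<ge> 1\<close>] .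
  have "Ck_on 1 (ball c \<rho>) (\<lambda>x. g (\<psi> x))"
    by (rule Ck_on_compose[OF _ \<open>open Y\<close> p(6) g1 p(5)]) auto
  moreover have "norm (frechet_derivative (\<lambda>x. g (\<psi> x)) (at z) v) \<le> (\<bar>C\<bar> * \<bar>K\<bar>) * norm v"
    if "z \<in> ball c \<rho>" for z v
  proof -
    have 1: "(\<psi> has_derivative frechet_derivative \<psi> (at z)) (at z)"
      using p(5) that by (intro Ck_on_Suc_has_derivative[of 0]) auto
    have 2: "(g has_derivative frechet_derivative g (at (\<psi> z))) (at (\<psi> z))"
      using g1 p(6) that by (intro Ck_on_Suc_has_derivative[of 0 Y]) auto
    have "norm (frechet_derivative (\<lambda>x. g (\<psi> x)) (at z) v) =
        norm (frechet_derivative g (at (\<psi> z)) (frechet_derivative \<psi> (at z) v))"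
      using frechet_derivative_at[OF has_derivative_compose[OF 1 2]] by metis
    also have "\<dots> \<le> C * norm (frechet_derivative \<psi> (at z) v)" using p(6) that by (intro C) auto
    also have "\<dots> \<le> \<bar>C\<bar> * norm (frechet_derivative \<psi> (at z) v)" by (intro mult_right_mono) auto
    also have "\<dots> \<le> \<bar>C\<bar> * (K * norm v)" using p(8)[OF that] by (intro mult_left_mono) auto
    also have "\<dots> \<le> \<bar>C\<bar> * (\<bar>K\<bar> * norm v)" by (intro mult_left_mono mult_right_mono) auto
    finally show ?thesis by (simp add: mult_ac)
  qed
  moreover have "\<exists>\<delta>>0. \<forall>y\<in>B. \<forall>x\<in>coord_space T \<inter> ball c \<rho>. norm (x - y) < \<delta> \<longrightarrow>
         \<bar>f (g (\<psi> x))\<bar> \<le> \<epsilon> * norm (x - y) ^ k"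
    if f: "Ck_on k \<Omega> f" "\<forall>x\<in>A. f x = 0" and \<epsilon>: "\<epsilon> > 0" for f :: "'a \<Rightarrow> real" and \<epsilon>
    by (rule rate[OF Ck_on_compose[OF \<open>open Y\<close> \<open>open \<Omega>\<close> g(2) f(1) g(1)]]) (use f g \<epsilon> in auto)
  moreover have "(\<lambda>x. g (\<psi> x)) ` ball c \<rho> \<subseteq> \<Omega>" using p(6) g(2) by blast
  moreover have "(\<lambda>x. g (\<psi> x)) ` (coord_space T \<inter> ball c \<rho>) \<subseteq> coord_space S"
    using p(6,7) g(4) by blast
  moreover have "T \<subseteq> S" using p \<open>S' \<subseteq> S\<close> by auto
  moreover have "g ` P = (\<lambda>x. g (\<psi> x)) ` B" using p by auto
  moreover have "g ` P \<subseteq> A" using p(4) g(3) by auto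
  ultimately show ?thesis using p(2) by (intro morse_pieceI[of T S B c \<rho> _ "\<lambda>x. g (\<psi> x)"])
qed

lemma frechet_derivative_bounded_on_compact:
  fixes g :: "'a::euclidean_space \<Rightarrow> 'b::real_normed_vector"
  assumes g: "Ck_on (Suc k) Y g" and K: "compact K" "K \<subseteq> Y"
  obtains C where "C \<ge> 0" "\<And>y v. y \<in> K \<Longrightarrow> norm (frechet_derivative g (at y) v) \<le> C * norm v"
proof -
  have "\<exists>M. \<forall>y\<in>K. norm (frechet_derivative g (at y) b) \<le> M" for b
  proof -
    have "continuous_on K (\<lambda>y. frechet_derivative g (at y) b)"
      using g by (intro continuous_on_subset[OF _ K(2)] Ck_on_continuous_on[of k]) auto
    then have "bounded ((\<lambda>y. frechet_derivative g (at y) b) ` K)"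
      using K compact_continuous_image compact_imp_bounded by blast
    then show ?thesis unfolding bounded_iff by auto
  qed
  then obtain M where M: "\<And>b y. y \<in> K \<Longrightarrow> norm (frechet_derivative g (at y) b) \<le> M b"
    by metis
  have "norm (frechet_derivative g (at y) v) \<le> (\<Sum>b\<in>Basis. \<bar>M b\<bar>) * norm v" if y: "y \<in> K" for y v
  proof -
    have "linear (frechet_derivative g (at y))"
      using Ck_on_Suc_has_derivative[OF g] K y has_derivative_linear by blast
    then have "frechet_derivative g (at y) v
        = (\<Sum>b\<in>Basis. (v \<bullet> b) *\<^sub>R frechet_derivative g (at y) b)"
      by (rule linear_eq_sum_Basis)
    also have "norm \<dots> \<le> (\<Sum>b\<in>Basis. norm v * \<bar>M b\<bar>)"
    proof (intro order_trans[OF norm_sum] sum_mono)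
      fix b :: 'a assume "b \<in> Basis"
      then have "\<bar>v \<bullet> b\<bar> \<le> norm v" by (rule Basis_le_norm)
      moreover have "norm (frechet_derivative g (at y) b) \<le> \<bar>M b\<bar>" using M[OF y, of b] by linarith
      ultimately show "norm ((v \<bullet> b) *\<^sub>R frechet_derivative g (at y) b) \<le> norm v * \<bar>M b\<bar>"
        by (simp add: mult_mono)
    qed
    finally show ?thesis by (simp add: sum_distrib_left mult.commute)
  qed
  then show thesis by (intro that[of "\<Sum>b\<in>Basis. \<bar>M b\<bar>"]) (auto intro: sum_nonneg)
qed

text \<open>Sard's theorem in the form of A. P. Morse: \<open>A\<close> is split into the points where all the
  $C^{k+1}$ functions vanishing on \<open>A\<close> are critical, at which the number of derivatives is decreased,
  and the other ones, which lie on hypersurfaces of class $C^{k+1}$, where the dimension is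
  decreased. No regularity is lost since \<^emph>\<open>all\<close> functions vanishing on \<open>A\<close> are considered at once.\<close>

lemma morse_decomposition:
  fixes A :: "'a::euclidean_space set"
  assumes "S \<subseteq> Basis" "open \<Omega>" "A \<subseteq> \<Omega> \<inter> coord_space S"
  shows "\<exists>\<C>. countable \<C> \<and> A \<subseteq> \<Union>\<C> \<and> (\<forall>P\<in>\<C>. morse_piece k S \<Omega> A P)"
  using assms
proof (induction k arbitrary: S \<Omega> A)
  case 0
  have "\<exists>\<rho>. \<forall>x\<in>A. \<rho> x > 0 \<and> cball x (\<rho> x) \<subseteq> \<Omega>"
    using 0 open_contains_cball[of \<Omega>] by (intro bchoice) blast
  then obtain \<rho> where \<rho>: "\<And>x. x \<in> A \<Longrightarrow> \<rho> x > 0" "\<And>x. x \<in> A \<Longrightarrow> cball x (\<rho> x) \<subseteq> \<Omega>"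
    by blast
  obtain \<F> where \<F>: "\<F> \<subseteq> (\<lambda>x. ball x (\<rho> x)) ` A" "countable \<F>" "\<Union>\<F> = (\<Union>x\<in>A. ball x (\<rho> x))"
    using Lindelof[of "(\<lambda>x. ball x (\<rho> x)) ` A"] by auto
  have "morse_piece 0 S \<Omega> A P" if P: "P \<in> (\<inter>) A ` \<F>" for P
  proof -
    obtain x where x: "x \<in> A" and P: "P = A \<inter> ball x (\<rho> x)" using P \<F>(1) by auto
    show ?thesis unfolding P by (rule morse_piece_0[OF \<rho>(2)[OF x]]) (use 0 in auto)
  qed
  moreover have "A \<subseteq> \<Union> ((\<inter>) A ` \<F>)"
    using \<F>(3) \<rho>(1) centre_in_ball by fastforce
  ultimately show ?case using \<F>(2)
    by (intro exI[of _ "(\<inter>) A ` \<F>"] conjI countable_image ballI)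
next
  case (Suc k)
  note IHk = Suc.IH
  show ?case using Suc.prems
  \<comment> \<open>The order k + 1 is fixed during the inner induction, which lowers the number of
    coordinates. \<open>IHk\<close>, available for every number of coordinates, serves the critical
    points.\<close>
  proof (induction "card S" arbitrary: S \<Omega> A rule: less_induct)
    case less
    note S = less.prems(1) and \<Omega> = less.prems(2) and A = less.prems(3)
    have fS: "finite S" using S finite_Basis finite_subset by blast
    define A' where "A' = {x \<in> A. \<forall>f b. Ck_on (Suc k) \<Omega> f \<longrightarrow> (\<forall>x\<in>A. f x = 0) \<longrightarrow> b \<in> S \<longrightarrow>
       frechet_derivative f (at x) b = (0::real)}"
    have A': "A' \<subseteq> A" by (auto simp: A'_def)
    have "\<exists>\<C>. countable \<C> \<and> A' \<subseteq> \<Union>\<C> \<and> (\<forall>P\<in>\<C>. morse_piece k S \<Omega> A' P)"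
      by (rule IHk[OF S \<Omega> order_trans[OF A' A]])
    then obtain \<C>0 where \<C>0: "countable \<C>0" "A' \<subseteq> \<Union>\<C>0" "\<forall>P\<in>\<C>0. morse_piece k S \<Omega> A' P"
      by (elim exE conjE)
    have crit: "frechet_derivative f (at x) b = (0::real)"
      if "Ck_on (Suc k) \<Omega> f" "\<forall>x\<in>A. f x = 0" "b \<in> S" "x \<in> A'" for f b x
      using that unfolding A'_def by blast
    have \<C>0': "morse_piece (Suc k) S \<Omega> A P" if "P \<in> \<C>0" for P
      by (rule morse_piece_Suc[OF S bspec[OF \<C>0(3) that] A' crit])
    define covered where "covered X \<C> \<longleftrightarrow> countable \<C> \<and> A \<inter> X \<subseteq> \<Union>\<C> \<and>
        (\<forall>P\<in>\<C>. morse_piece (Suc k) S \<Omega> A P)" for X \<C>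
    \<comment> \<open>Open sets whose part of \<open>A\<close> is already decomposed. Every point
      off \<open>A'\<close> has such a neighbourhood, and Lindelof's theorem leaves countably many
      of them, so that the union of their decompositions stays countable.\<close>
    define \<F> where "\<F> = {X. open X \<and> (\<exists>\<C>. covered X \<C>)}"
    have \<F>: "\<exists>X\<in>\<F>. p \<in> X" if p: "p \<in> A - A'" for p
    proof -
      obtain f :: "'a \<Rightarrow> real" and b where f: "Ck_on (Suc k) \<Omega> f" "\<And>x. x \<in> A \<Longrightarrow> f x = 0"
        and b: "b \<in> S" "frechet_derivative f (at p) b \<noteq> 0"
        using p unfolding A'_def by blast
      have bB: "b \<in> Basis" and p\<Omega>: "p \<in> \<Omega>" using b S p A by auto
      define \<Phi> where "\<Phi> x = x + (f x - x \<bullet> b) *\<^sub>R b" for x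
      obtain X Y g where X: "open X" "X \<subseteq> \<Omega>" "p \<in> X" "open Y"
        and hom: "homeomorphism X Y \<Phi> g" and g: "Ck_on (Suc k) Y g"
        using straightening[OF \<Omega> p\<Omega> f(1) bB b(2)] unfolding \<Phi>_def by metis
      have g\<Phi>: "\<And>x. x \<in> X \<Longrightarrow> g (\<Phi> x) = x" "\<And>y. y \<in> Y \<Longrightarrow> \<Phi> (g y) = y"
        and gX: "\<And>y. y \<in> Y \<Longrightarrow> g y \<in> X" and \<Phi>Y: "\<And>x. x \<in> X \<Longrightarrow> \<Phi> x \<in> Y"
        and cont: "continuous_on X \<Phi>"
        using hom by (auto simp: homeomorphism_def)
      \<comment> \<open>The uniform derivative bound demanded by \<open>morse_piece_image\<close> is
        obtained for \<open>g\<close> on a compact ball, which is why \<open>Y\<close> is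
        shrunk.\<close>
      obtain r where r: "r > 0" "cball (\<Phi> p) r \<subseteq> Y"
        using X(4) \<Phi>Y[OF X(3)] by (metis open_contains_cball)
      obtain C where C: "\<And>y v. y \<in> cball (\<Phi> p) r \<Longrightarrow> norm (frechet_derivative g (at y) v) \<le> C * norm v"
        by (rule frechet_derivative_bounded_on_compact[OF g compact_cball r(2)]) (rule that)
      let ?Y = "ball (\<Phi> p) r" and ?X = "X \<inter> \<Phi> -` ball (\<Phi> p) r" and ?S = "S - {b}"
      have Y': "?Y \<subseteq> Y" using r(2) by auto
      have \<Phi>_other: "\<Phi> x \<bullet> b' = x \<bullet> b'" if "b' \<in> Basis" "b' \<noteq> b" for x b'
        unfolding \<Phi>_def using that bB by (simp add: inner_add_left inner_not_same_Basis)
      have \<Phi>_b: "\<Phi> x \<bullet> b = f x" for x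
        unfolding \<Phi>_def using bB by (simp add: inner_add_left)
      have oX: "open ?X" using X(1) cont by (intro continuous_open_preimage) auto
      \<comment> \<open>\<open>\<Phi>\<close> puts \<open>f\<close> in the place of the coordinate b
        and keeps the others. As \<open>f\<close> vanishes on \<open>A\<close>, the image of
        \<open>A\<close> loses one dimension.\<close>
      have sub: "\<Phi> ` (A \<inter> ?X) \<subseteq> ?Y \<inter> coord_space ?S"
      proof -
        have "\<Phi> x \<bullet> b' = 0" if "x \<in> A" "b' \<in> Basis - ?S" for x b'
        proof (cases "b' = b")
          case True
          then show ?thesis using that f(2) \<Phi>_b by simp
        next
          case False
          then have "x \<bullet> b' = 0" using that coord_spaceD[of x S b'] A by blast
          then show ?thesis using that \<Phi>_other False by simp
        qed
        then show ?thesis by (auto simp: coord_space_def)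
      qed
      have "\<exists>\<C>. countable \<C> \<and> \<Phi> ` (A \<inter> ?X) \<subseteq> \<Union>\<C> \<and>
          (\<forall>P\<in>\<C>. morse_piece (Suc k) ?S ?Y (\<Phi> ` (A \<inter> ?X)) P)"
        by (rule less.hyps[OF card_Diff1_less[OF fS b(1)] _ open_ball sub]) (use S in blast)
      then obtain \<C>' where \<C>': "countable \<C>'" "\<Phi> ` (A \<inter> ?X) \<subseteq> \<Union>\<C>'"
        and pieces: "\<forall>P\<in>\<C>'. morse_piece (Suc k) ?S ?Y (\<Phi> ` (A \<inter> ?X)) P"
        by (elim exE conjE)
      have g_coord: "g ` (?Y \<inter> coord_space ?S) \<subseteq> coord_space S"
      proof (rule image_subsetI)
        fix y assume y: "y \<in> ?Y \<inter> coord_space ?S"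
        then have "\<Phi> (g y) = y" using g\<Phi>(2) Y' by blast
        then have "g y \<bullet> b' = 0" if "b' \<in> Basis - S" for b'
        proof -
          have "b' \<in> Basis" "b' \<noteq> b" "b' \<notin> ?S" "y \<in> coord_space ?S" using that b(1) y by auto
          then show ?thesis using \<Phi>_other[of b' "g y"] coord_spaceD[of y ?S b'] \<open>\<Phi> (g y) = y\<close> by simp
        qed
        then show "g y \<in> coord_space S" unfolding coord_space_def by simp
      qed
      have g_\<Omega>: "g ` ?Y \<subseteq> \<Omega>" using gX Y' X by blast
      have g_A: "g ` \<Phi> ` (A \<inter> ?X) \<subseteq> A" using g\<Phi> by auto
      have "covered ?X ((`) g ` \<C>')" unfolding covered_def
      proof (intro conjI ballI subsetI)
        show "countable ((`) g ` \<C>')" using \<C>'(1) by (rule countable_image)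
      next
        fix x assume x: "x \<in> A \<inter> ?X"
        then obtain P where "P \<in> \<C>'" "\<Phi> x \<in> P" using \<C>'(2) by blast
        moreover have "x = g (\<Phi> x)" using g\<Phi> x by auto
        ultimately show "x \<in> \<Union> ((`) g ` \<C>')" by blast
      next
        fix P' assume "P' \<in> (`) g ` \<C>'"
        then obtain P where P: "P \<in> \<C>'" "P' = g ` P" by (rule imageE)
        show "morse_piece (Suc k) S \<Omega> A P'" unfolding P(2)
          by (rule morse_piece_image[OF bspec[OF pieces P(1)] _ _ open_ball \<Omega> Ck_on_subset[OF g Y']
              g_\<Omega> g_A g_coord, of C]) (use C in auto)
      qed
      with oX have "?X \<in> \<F>" unfolding \<F>_def by (intro CollectI conjI exI)
      moreover have "p \<in> ?X" using X r by simp
      ultimately show ?thesis by (intro bexI)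
    qed
    obtain \<F>' where \<F>': "\<F>' \<subseteq> \<F>" "countable \<F>'" "\<Union>\<F>' = \<Union>\<F>"
      by (rule Lindelof[of \<F>]) (auto simp: \<F>_def)
    have "\<forall>X\<in>\<F>'. \<exists>\<C>. covered X \<C>" using \<F>'(1) unfolding \<F>_def by blast
    from bchoice[OF this] obtain \<C> where \<C>: "\<forall>X\<in>\<F>'. covered X (\<C> X)" ..
    show ?case
    proof (intro exI[of _ "\<C>0 \<union> (\<Union>X\<in>\<F>'. \<C> X)"] conjI subsetI ballI)
      show "countable (\<C>0 \<union> (\<Union>X\<in>\<F>'. \<C> X))"
        using \<C>0(1) \<C> \<F>'(2) by (simp add: covered_def)
    next
      fix x assume x: "x \<in> A"
      show "x \<in> \<Union>(\<C>0 \<union> (\<Union>X\<in>\<F>'. \<C> X))"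
      proof (cases "x \<in> A'")
        case True
        then show ?thesis using \<C>0(2) by auto
      next
        case False
        then obtain X where X: "X \<in> \<F>'" "x \<in> X" using \<F> \<F>'(3) x by blast
        then have "A \<inter> X \<subseteq> \<Union>(\<C> X)" using \<C> by (simp add: covered_def)
        then show ?thesis using X x by blast
      qed
    next
      fix P assume "P \<in> \<C>0 \<union> (\<Union>X\<in>\<F>'. \<C> X)"
      then show "morse_piece (Suc k) S \<Omega> A P" using \<C> \<C>0' by (auto simp: covered_def)
    qed
  qed
qed

text \<open>The image of \<open>B\<close> is covered by as many short intervals as there are cells of a grid of mesh
  \<open>1 / N\<close> in the coordinate space containing \<open>B\<close>.\<close>

lemma negligible_image_rate:
  fixes F :: "'a::euclidean_space \<Rightarrow> real"
  assumes T: "T \<subseteq> Basis" and B: "B \<subseteq> coord_space T" "bounded B"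
    and rate: "\<And>\<epsilon>. \<epsilon> > 0 \<Longrightarrow> \<exists>\<delta>>0. \<forall>x\<in>B. \<forall>y\<in>B. norm (x - y) < \<delta> \<longrightarrow>
      \<bar>F x - F y\<bar> \<le> \<epsilon> * norm (x - y) ^ card T"
  shows "negligible (F ` B)"
  unfolding negligible_outer_le
proof (intro allI impI)
  fix e :: real assume "e > 0"
  define m where "m = card T"
  have fT: "finite T" using T finite_Basis finite_subset by blast
  obtain R0 where R0: "\<And>x. x \<in> B \<Longrightarrow> norm x \<le> R0" using B(2) unfolding bounded_iff by blast
  obtain R :: nat where R: "R0 \<le> real R" "R \<ge> 1"
    using real_arch_simple[of "max R0 1"] by (metis max.bounded_iff of_nat_1 of_nat_le_iff)
  have RB: "\<bar>x \<bullet> b\<bar> \<le> R" if "x \<in> B" "b \<in> T" for x b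
    using Basis_le_norm[of b x] R0[OF that(1)] R T that by force
  \<comment> \<open>Chosen backwards from the final count: at most (3 N R)^m intervals of length 2 h
    with h = \<epsilon> (m / N)^m have total length at most 2 (3 R m)^m \<epsilon>, whatever N
    is.\<close>
  define \<epsilon> where "\<epsilon> = e / (2 * (3 * R * m) ^ m + 1)"
  have \<epsilon>: "\<epsilon> > 0" "2 * (3 * R * m) ^ m * \<epsilon> \<le> e"
    unfolding \<epsilon>_def using \<open>e > 0\<close> by (auto simp: field_simps add_pos_nonneg)
  obtain \<delta> where \<delta>: "\<delta> > 0" "\<And>x y. x \<in> B \<Longrightarrow> y \<in> B \<Longrightarrow> norm (x - y) < \<delta> \<Longrightarrow>
      \<bar>F x - F y\<bar> \<le> \<epsilon> * norm (x - y) ^ m"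
    using rate[OF \<epsilon>(1)] unfolding m_def by blast
  obtain N :: nat where N: "m / \<delta> < real N" "N \<ge> 1"
  proof -
    obtain N where "max (m / \<delta>) 1 < real N" using reals_Archimedean2 by blast
    then show ?thesis by (intro that[of N]) (auto simp: Suc_le_eq)
  qed
  \<comment> \<open>The index of the grid cell of x. Since coordinates outside \<open>T\<close>
    vanish on \<open>B\<close>, two points in a cell are at distance at most m / N, first in the l1
    norm and then in the Euclidean one.\<close>
  define \<phi> where "\<phi> x = (\<lambda>b\<in>T. \<lfloor>N * (x \<bullet> b)\<rfloor>)" for x
  define h where "h = \<epsilon> * (m / N) ^ m"
  have h: "h \<ge> 0" unfolding h_def using \<epsilon> by simp
  have near: "\<bar>F x - F y\<bar> \<le> h" if xy: "x \<in> B" "y \<in> B" "\<phi> x = \<phi> y" for x y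
  proof -
    have "\<bar>(x - y) \<bullet> b\<bar> \<le> 1 / N" if "b \<in> T" for b
    proof -
      have "\<lfloor>N * (x \<bullet> b)\<rfloor> = \<lfloor>N * (y \<bullet> b)\<rfloor>"
        using fun_cong[OF xy(3), of b] that unfolding \<phi>_def by simp
      then have "\<bar>N * (x \<bullet> b) - N * (y \<bullet> b)\<bar> \<le> 1" by linarith
      then have "real N * \<bar>(x - y) \<bullet> b\<bar> \<le> 1"
        by (simp add: inner_diff_left abs_mult flip: right_diff_distrib)
      then show ?thesis using N(2) by (simp add: field_simps)
    qed
    then have "(\<Sum>b\<in>T. \<bar>(x - y) \<bullet> b\<bar>) \<le> m * (1 / N)"
      unfolding m_def by (intro sum_bounded_above) auto
    moreover have "(\<Sum>b\<in>Basis. \<bar>(x - y) \<bullet> b\<bar>) = (\<Sum>b\<in>T. \<bar>(x - y) \<bullet> b\<bar>)"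
      using T B xy by (intro sum.mono_neutral_right) (auto simp: inner_diff_left coord_spaceD[OF subsetD[OF B(1)]])
    ultimately have n: "norm (x - y) \<le> m / N" using norm_le_l1[of "x - y"] by simp
    moreover have "m / N < \<delta>" using N \<delta>(1) by (simp add: field_simps)
    ultimately have "\<bar>F x - F y\<bar> \<le> \<epsilon> * norm (x - y) ^ m" using \<delta>(2) xy by auto
    also have "\<dots> \<le> h" unfolding h_def using n \<epsilon> by (intro mult_left_mono power_mono) auto
    finally show ?thesis .
  qed
  let ?I = "{- int (N * R)..int (N * R)}"
  have sub: "\<phi> ` B \<subseteq> T \<rightarrow>\<^sub>E ?I"
  proof -
    have "\<lfloor>N * (x \<bullet> b)\<rfloor> \<in> ?I" if "x \<in> B" "b \<in> T" for x b
    proof -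
      have "N * \<bar>x \<bullet> b\<bar> \<le> N * R"
        unfolding of_nat_mult using that by (intro mult_left_mono RB) auto
      then have "\<bar>N * (x \<bullet> b)\<bar> \<le> N * R" by (simp add: abs_mult)
      then have "- real (N * R) \<le> N * (x \<bullet> b)" "N * (x \<bullet> b) \<le> real (N * R)" by linarith+
      then show ?thesis by (simp add: le_floor_iff floor_le_iff)
    qed
    then show ?thesis unfolding \<phi>_def by auto
  qed
  have fin: "finite (T \<rightarrow>\<^sub>E ?I)" using fT by (intro finite_PiE) auto
  have "card (T \<rightarrow>\<^sub>E ?I) = (2 * N * R + 1) ^ m"
    using fT by (simp add: card_funcsetE m_def algebra_simps nat_add_distrib nat_mult_distrib)
  then have "finite (\<phi> ` B)" and c1: "card (\<phi> ` B) \<le> (2 * N * R + 1) ^ m"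
    using finite_subset[OF sub fin] card_mono[OF fin sub] by simp_all
  \<comment> \<open>Here \<open>N\<close> and \<open>R\<close> being at least 1 absorbs the
    additional cell, so that the count is a pure power in which N cancels below.\<close>
  have "2 * N * R + 1 \<le> 3 * N * R" using N(2) R(2) by simp
  then have "(2 * N * R + 1) ^ m \<le> (3 * N * R) ^ m" by (rule power_mono) simp
  with c1 have c: "card (\<phi> ` B) \<le> (3 * N * R) ^ m" by simp
  define x where "x \<kappa> = (SOME x. x \<in> B \<and> \<phi> x = \<kappa>)" for \<kappa>
  have x: "x (\<phi> y) \<in> B" "\<phi> (x (\<phi> y)) = \<phi> y" if "y \<in> B" for y
    unfolding x_def using someI[of "\<lambda>x. x \<in> B \<and> \<phi> x = \<phi> y" y] that by auto
  let ?J = "\<lambda>\<kappa>. cbox (F (x \<kappa>) - h) (F (x \<kappa>) + h)"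
  let ?U = "\<Union>\<kappa>\<in>\<phi> ` B. ?J \<kappa>"
  have "F ` B \<subseteq> ?U"
  proof
    fix z assume "z \<in> F ` B"
    then obtain y where y: "y \<in> B" "z = F y" by auto
    then have "\<bar>F y - F (x (\<phi> y))\<bar> \<le> h" using x by (intro near) auto
    then show "z \<in> ?U" using y by (auto simp: abs_le_iff intro!: bexI[of _ y])
  qed
  moreover have "?U \<in> lmeasurable"
    using \<open>finite (\<phi> ` B)\<close> by (intro fmeasurable.finite_UN) auto
  moreover have "measure lebesgue ?U \<le> e"
  proof -
    have "measure lebesgue ?U \<le> (\<Sum>\<kappa>\<in>\<phi> ` B. measure lebesgue (?J \<kappa>))"
      using \<open>finite (\<phi> ` B)\<close> by (intro measure_UNION_le) auto
    also have "\<dots> = card (\<phi> ` B) * (2 * h)" using h by simp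
    also have "\<dots> \<le> real ((3 * N * R) ^ m) * (2 * h)"
      using c h by (intro mult_right_mono) (auto simp del: of_nat_power of_nat_mult)
    also have "\<dots> = 2 * ((3 * R * N) * (m / N)) ^ m * \<epsilon>"
      unfolding h_def by (simp only: power_mult_distrib of_nat_power of_nat_mult of_nat_numeral) simp
    also have "(3 * R * N) * (m / N) = 3 * real R * m" using N(2) by simp
    finally show ?thesis using \<epsilon>(2) by simp
  qed
  ultimately show "\<exists>T. F ` B \<subseteq> T \<and> T \<in> lmeasurable \<and> measure lebesgue T \<le> e" by blast
qed

text \<open>On an \<open>m\<close>-dimensional piece, a function vanishing to order \<open>2 m - 2\<close> has a square root
  vanishing to order \<open>m - 1\<close>, so that \<open>F\<close> varies by \<open>o(t\<^sup>m)\<close> between points at distance \<open>t\<close>.\<close>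

lemma negligible_image_morse_piece:
  fixes u F :: "'a::euclidean_space \<Rightarrow> real"
  assumes piece: "morse_piece k S \<Omega> A P" and "S \<subseteq> Basis" and k: "k \<ge> 2 * DIM('a) - 2"
    and u: "Ck_on k \<Omega> u" "\<And>x. x \<in> A \<Longrightarrow> u x = 0"
    and M: "\<And>q q' l \<sigma>. l > 0 \<Longrightarrow> \<sigma> > 0 \<Longrightarrow> q 0 \<in> A \<Longrightarrow> q 1 \<in> A \<Longrightarrow> continuous_on {0..1} q' \<Longrightarrow>
      (\<And>s. s \<in> {0..1} \<Longrightarrow> (q has_vector_derivative q' s) (at s within {0..1})) \<Longrightarrow>
      (\<And>s. s \<in> {0..1} \<Longrightarrow> norm (q' s) \<le> l) \<Longrightarrow> (\<And>s. s \<in> {0..1} \<Longrightarrow> q s \<in> \<Omega>) \<Longrightarrow>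
      (\<And>s. s \<in> {0..1} \<Longrightarrow> u (q s) \<le> \<sigma>) \<Longrightarrow> \<bar>F (q 0) - F (q 1)\<bar> \<le> M * l * sqrt \<sigma>"
  shows "negligible (F ` P)"
proof -
  from piece obtain T c \<rho> \<psi> K B where p: "T \<subseteq> S" "B \<subseteq> coord_space T \<inter> ball c \<rho>"
     "P = \<psi> ` B" "P \<subseteq> A" "Ck_on 1 (ball c \<rho>) \<psi>" "\<psi> ` ball c \<rho> \<subseteq> \<Omega>"
     "\<psi> ` (coord_space T \<inter> ball c \<rho>) \<subseteq> coord_space S"
     "\<And>z v. z \<in> ball c \<rho> \<Longrightarrow> norm (frechet_derivative \<psi> (at z) v) \<le> K * norm v"
     and rate: "\<And>f::'a \<Rightarrow> real. \<And>\<epsilon>. Ck_on k \<Omega> f \<Longrightarrow> (\<forall>x\<in>A. f x = 0) \<Longrightarrow> \<epsilon> > 0 \<Longrightarrow>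
       (\<exists>\<delta>>0. \<forall>y\<in>B. \<forall>x\<in>coord_space T \<inter> ball c \<rho>. norm (x - y) < \<delta> \<longrightarrow>
         \<bar>f (\<psi> x)\<bar> \<le> \<epsilon> * norm (x - y) ^ k)"
    by (rule morse_pieceE) (rule that)
  have T: "T \<subseteq> Basis" using p(1) assms(2) by blast
  then have "finite T" using finite_Basis finite_subset by blast
  define m where "m = card T"
  have m: "m \<le> DIM('a)" unfolding m_def using T by (intro card_mono) auto
  have "negligible ((\<lambda>x. F (\<psi> x)) ` B)"
  proof (rule negligible_image_rate[OF T])
    show "B \<subseteq> coord_space T" "bounded B"
      using p(2) bounded_subset[OF bounded_ball] by blast+
  next
    fix e :: real assume "e > 0"
    \<comment> \<open>The summand 1 makes the length bound \<open>K' * t\<close> strictly positive,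
      as \<open>M\<close> requires.\<close>
    define K' where "K' = \<bar>K\<bar> + 1"
    \<comment> \<open>The square anticipates the square root of \<sigma> in
      \<open>M\<close>.\<close>
    define \<epsilon> where "\<epsilon> = (e / (\<bar>M\<bar> * K' + 1))\<^sup>2"
    have K': "K' > 0" unfolding K'_def by simp
    have MK: "\<bar>M\<bar> * K' + 1 > 0" using K' by (simp add: add_nonneg_pos)
    then have "sqrt \<epsilon> = e / (\<bar>M\<bar> * K' + 1)" unfolding \<epsilon>_def using \<open>e > 0\<close> by simp
    then have \<epsilon>: "\<epsilon> > 0" "\<bar>M\<bar> * K' * sqrt \<epsilon> \<le> e"
      using MK \<open>e > 0\<close> by (simp_all add: \<epsilon>_def) (simp add: field_simps)
    obtain \<delta> where \<delta>: "\<delta> > 0" "\<And>y x. y \<in> B \<Longrightarrow> x \<in> coord_space T \<inter> ball c \<rho> \<Longrightarrow> norm (x - y) < \<delta> \<Longrightarrow>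
         \<bar>u (\<psi> x)\<bar> \<le> \<epsilon> * norm (x - y) ^ k"
      using rate[OF u(1) _ \<epsilon>(1)] u(2) by blast
    show "\<exists>\<delta>>0. \<forall>x\<in>B. \<forall>y\<in>B. norm (x - y) < \<delta> \<longrightarrow>
        \<bar>F (\<psi> x) - F (\<psi> y)\<bar> \<le> e * norm (x - y) ^ card T"
    \<comment> \<open>The radius is kept below 1 so that t^k \<le> t^(2(m - 1)) follows from k \<ge>
      2 \<open>DIM('a)\<close> - 2 and m \<le> \<open>DIM('a)\<close>.\<close>
    proof (intro exI[of _ "min \<delta> 1"] conjI ballI impI)
      fix x y assume B: "x \<in> B" "y \<in> B" and xy: "norm (x - y) < min \<delta> 1"
      show "\<bar>F (\<psi> x) - F (\<psi> y)\<bar> \<le> e * norm (x - y) ^ card T"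
      proof (cases "x = y")
        case True
        then show ?thesis using \<open>e > 0\<close> by simp
      next
        case False
        \<comment> \<open>In dimension zero the parameter space is a point, contrary to x \<noteq>
          y. Hence m - 1 below is a genuine subtraction and t * t^(m - 1) = t^m.\<close>
        have "T \<noteq> {}"
        proof
          assume "T = {}"
          then have "\<And>b. b \<in> Basis \<Longrightarrow> x \<bullet> b = y \<bullet> b"
            using B p(2) coord_spaceD[of _ T] by (metis IntD1 empty_iff subsetD)
          with False show False using euclidean_eqI by blast
        qed
        then have m1: "m \<ge> 1" unfolding m_def using \<open>finite T\<close> by (simp add: Suc_le_eq card_gt_0_iff)
        define t where "t = norm (y - x)"
        have t: "0 < t" "t < \<delta>" "t < 1" using False xy by (auto simp: t_def norm_minus_commute)
        define l where "l s = x + s *\<^sub>R (y - x)" for s :: real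
        have dl: "(l has_derivative (\<lambda>t. t *\<^sub>R (y - x))) (at s)" for s
          unfolding l_def by (auto intro!: derivative_eq_intros)
        have l_in: "l s \<in> coord_space T \<inter> ball c \<rho>" if "s \<in> {0..1}" for s
        proof -
          have "l s \<in> closed_segment x y" using that unfolding l_def closed_segment_def
            by (auto intro!: exI[of _ s] simp: algebra_simps)
          then show ?thesis
            using closed_segment_subset[OF _ _ convex_Int[OF convex_coord_space convex_ball], of x T c \<rho> y]
              B p(2) by blast
        qed
        let ?q' = "\<lambda>s. frechet_derivative \<psi> (at (l s)) (y - x)"
        have dq: "((\<lambda>s. \<psi> (l s)) has_vector_derivative ?q' s) (at s within {0..1})"
          if "s \<in> {0..1}" for s
        proof -
          have d\<psi>: "(\<psi> has_derivative frechet_derivative \<psi> (at (l s))) (at (l s))"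
            using l_in[OF that] p(5) by (intro Ck_on_Suc_has_derivative[of 0]) auto
          have "((\<lambda>s. \<psi> (l s)) has_derivative (\<lambda>t. t *\<^sub>R ?q' s)) (at s)"
            using has_derivative_compose[OF dl d\<psi>]
              linear_cmul[OF has_derivative_linear[OF d\<psi>]] by simp
          then show ?thesis unfolding has_vector_derivative_def by (rule has_derivative_at_withinI)
        qed
        have "continuous_on {0..1} l" unfolding l_def by (intro continuous_intros)
        moreover have "l ` {0..1} \<subseteq> ball c \<rho>" using l_in by blast
        ultimately have cq: "continuous_on {0..1} ?q'"
          using p(5) by (intro Ck_on_frechet_derivative_continuous[of 0 "ball c \<rho>"]) auto
        define \<sigma> where "\<sigma> = \<epsilon> * (t ^ (m - 1))\<^sup>2"
        have uq: "u (\<psi> (l s)) \<le> \<sigma>" if s: "s \<in> {0..1}" for s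
        proof -
          have n: "norm (l s - x) \<le> t" unfolding l_def t_def using s by (simp add: mult_left_le_one_le)
          have "u (\<psi> (l s)) \<le> \<epsilon> * norm (l s - x) ^ k"
            using \<delta>(2)[OF B(1) l_in[OF s]] n t by simp
          also have "\<dots> \<le> \<epsilon> * t ^ k" using n \<epsilon> by (intro mult_left_mono power_mono) auto
          also have "\<dots> \<le> \<epsilon> * t ^ (2 * (m - 1))"
            using k m t \<epsilon> by (intro mult_left_mono power_decreasing) auto
          also have "\<dots> = \<sigma>" unfolding \<sigma>_def by (simp add: power_mult[symmetric] mult.commute)
          finally show ?thesis .
        qed
        have "\<bar>F (\<psi> (l 0)) - F (\<psi> (l 1))\<bar> \<le> M * (K' * t) * sqrt \<sigma>"
        proof (rule M[OF _ _ _ _ cq dq])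
          fix s :: real assume s: "s \<in> {0..1}"
          have "norm (?q' s) \<le> K * t" unfolding t_def using l_in[OF s] by (intro p(8)) auto
          also have "\<dots> \<le> K' * t" unfolding K'_def using t by (intro mult_right_mono) auto
          finally show "norm (?q' s) \<le> K' * t" .
          show "\<psi> (l s) \<in> \<Omega>" using l_in[OF s] p(6) by blast
        qed (use uq t K' \<epsilon> B p(3,4) in \<open>auto simp: \<sigma>_def l_def\<close>)
        also have "sqrt \<sigma> = sqrt \<epsilon> * t ^ (m - 1)"
          unfolding \<sigma>_def using t by (simp add: real_sqrt_mult)
        also have "M * (K' * t) * (sqrt \<epsilon> * t ^ (m - 1)) = (M * K' * sqrt \<epsilon>) * t ^ m"
          using m1 by (simp add: power_eq_if)
        also have "\<dots> \<le> (\<bar>M\<bar> * K' * sqrt \<epsilon>) * t ^ m"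
          using t K' \<epsilon> by (intro mult_right_mono) auto
        also have "\<dots> \<le> e * t ^ m" using \<epsilon> t by (intro mult_right_mono) auto
        finally show ?thesis by (simp add: l_def m_def t_def norm_minus_commute)
      qed
    qed (use \<delta> in auto)
  qed
  then show ?thesis using p(3) by (simp add: image_image)
qed

lemma coord_space_Basis: "coord_space Basis = UNIV"
  by (simp add: coord_space_def)

text \<open>The Euclidean core, detached from the manifold. \<open>M\<close> is all that is known
  about \<open>F\<close>: between zeros of \<open>u\<close> it varies at most by a multiple of
  length times the square root of a bound for \<open>u\<close> along a connecting curve. The
  decomposition starts with all coordinates, and countably many null sets are united.\<close>

lemma negligible_image_zeros:
  fixes u F :: "'a::euclidean_space \<Rightarrow> real"
  assumes \<Omega>: "open \<Omega>" "A \<subseteq> \<Omega>" and k: "k \<ge> 2 * DIM('a) - 2"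
    and u: "Ck_on k \<Omega> u" "\<And>x. x \<in> A \<Longrightarrow> u x = 0"
    and M: "\<And>q q' l \<sigma>. l > 0 \<Longrightarrow> \<sigma> > 0 \<Longrightarrow> q 0 \<in> A \<Longrightarrow> q 1 \<in> A \<Longrightarrow> continuous_on {0..1} q' \<Longrightarrow>
      (\<And>s. s \<in> {0..1} \<Longrightarrow> (q has_vector_derivative q' s) (at s within {0..1})) \<Longrightarrow>
      (\<And>s. s \<in> {0..1} \<Longrightarrow> norm (q' s) \<le> l) \<Longrightarrow> (\<And>s. s \<in> {0..1} \<Longrightarrow> q s \<in> \<Omega>) \<Longrightarrow>
      (\<And>s. s \<in> {0..1} \<Longrightarrow> u (q s) \<le> \<sigma>) \<Longrightarrow> \<bar>F (q 0) - F (q 1)\<bar> \<le> M * l * sqrt \<sigma>"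
  shows "negligible (F ` A)"
proof -
  have "A \<subseteq> \<Omega> \<inter> coord_space Basis" using \<Omega> by (simp add: coord_space_Basis)
  from morse_decomposition[OF order_refl \<Omega>(1) this, of k]
  obtain \<C> where \<C>: "countable \<C>" "A \<subseteq> \<Union>\<C>" "\<forall>P\<in>\<C>. morse_piece k Basis \<Omega> A P"
    by (elim exE conjE)
  have "negligible (\<Union>P\<in>\<C>. F ` P)"
  proof (rule negligible_countable_Union)
    fix N assume "N \<in> (`) F ` \<C>"
    then obtain P where P: "P \<in> \<C>" "N = F ` P" by (rule imageE)
    show "negligible N" unfolding P(2)
      by (rule negligible_image_morse_piece[OF bspec[OF \<C>(3) P(1)] order_refl k u M])
  qed (use \<C>(1) in \<open>rule countable_image\<close>)
  then show ?thesis by (rule negligible_subset) (use \<C>(2) in blast)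
qed

section \<open>Mechanical systems in charts\<close>

text \<open>The kinetic term is written with \<open>g x v v\<close>, the square of
  \<open>metric_norm\<close>. Differentiability of the potential is added as an assumption where the
  Morse decomposition is applied.\<close>

locale mechanical_system =
  fixes A :: "('m::t2_space, 'e::euclidean_space) chart set"
    and g :: "'m \<Rightarrow> 'e \<Rightarrow> 'e \<Rightarrow> real"
    and U :: "'m \<Rightarrow> real"
    and L :: "'m \<times> 'e \<Rightarrow> real"
  assumes manifold: "compact_connected_manifold A"
    and metric: "riemannian_metric A g"
    and lagrangian: "\<And>x v. L (x, v) = g x v v / 2 + U x"
    and continuous_potential: "continuous_on UNIV U"
begin

lemma charts:
  assumes "\<kappa> \<in> A"
  shows "open (fst \<kappa>)" "open (snd \<kappa> ` fst \<kappa>)"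
    "continuous_on (fst \<kappa>) (snd \<kappa>)" "continuous_on (snd \<kappa> ` fst \<kappa>) (chart_inv \<kappa>)"
    "\<And>x. x \<in> fst \<kappa> \<Longrightarrow> chart_inv \<kappa> (snd \<kappa> x) = x"
    "\<And>y. y \<in> snd \<kappa> ` fst \<kappa> \<Longrightarrow> snd \<kappa> (chart_inv \<kappa> y) = y"
    "\<And>y. y \<in> snd \<kappa> ` fst \<kappa> \<Longrightarrow> chart_inv \<kappa> y \<in> fst \<kappa>"
proof -
  have "is_chart \<kappa>"
    using manifold assms by (simp add: compact_connected_manifold_def smooth_atlas_def)
  then have o: "open (fst \<kappa>)" "open (snd \<kappa> ` fst \<kappa>)"
    and h: "homeomorphism (fst \<kappa>) (snd \<kappa> ` fst \<kappa>) (snd \<kappa>) (chart_inv \<kappa>)"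
    by (simp_all add: is_chart_def)
  show "open (fst \<kappa>)" "open (snd \<kappa> ` fst \<kappa>)" by fact+
  show "continuous_on (fst \<kappa>) (snd \<kappa>)" "continuous_on (snd \<kappa> ` fst \<kappa>) (chart_inv \<kappa>)"
    using h by (simp_all add: homeomorphism_def)
  show "\<And>x. x \<in> fst \<kappa> \<Longrightarrow> chart_inv \<kappa> (snd \<kappa> x) = x"
    using h by (rule homeomorphism_apply1)
  show "\<And>y. y \<in> snd \<kappa> ` fst \<kappa> \<Longrightarrow> snd \<kappa> (chart_inv \<kappa> y) = y"
    using h by (rule homeomorphism_apply2)
  show "\<And>y. y \<in> snd \<kappa> ` fst \<kappa> \<Longrightarrow> chart_inv \<kappa> y \<in> fst \<kappa>"
    using homeomorphism_image2[OF h] by blast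
qed

lemma chart_at: "chart_at A x \<in> A" "x \<in> fst (chart_at A x)"
proof -
  have "(\<Union>\<kappa>\<in>A. fst \<kappa>) = UNIV"
    using manifold by (simp add: compact_connected_manifold_def smooth_atlas_def)
  then have "\<exists>\<kappa>. \<kappa> \<in> A \<and> x \<in> fst \<kappa>" by blast
  then have "chart_at A x \<in> A \<and> x \<in> fst (chart_at A x)"
    unfolding chart_at_def by (rule someI_ex)
  then show "chart_at A x \<in> A" "x \<in> fst (chart_at A x)" by auto
qed

section \<open>Transition maps and the metric in coordinates\<close>

definition overlap :: "('m, 'e) chart \<Rightarrow> ('m, 'e) chart \<Rightarrow> 'e set" where
  "overlap \<kappa> \<kappa>' = snd \<kappa> ` (fst \<kappa> \<inter> fst \<kappa>')"

lemma open_overlap: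
  assumes "\<kappa> \<in> A" "\<kappa>' \<in> A"
  shows "open (overlap \<kappa> \<kappa>')"
proof -
  have "overlap \<kappa> \<kappa>' = snd \<kappa> ` fst \<kappa> \<inter> chart_inv \<kappa> -` (fst \<kappa>')"
    unfolding overlap_def using charts(5)[OF assms(1)] by (auto simp: image_iff)
  then show ?thesis
    using continuous_open_preimage[OF charts(4,2)[OF assms(1)] charts(1)[OF assms(2)]] by simp
qed

lemma transition_smooth:
  assumes "\<kappa> \<in> A" "\<kappa>' \<in> A"
  shows "Ck_on k (overlap \<kappa> \<kappa>') (snd \<kappa>' \<circ> chart_inv \<kappa>)"
proof -
  have "smooth_on (overlap \<kappa> \<kappa>') (snd \<kappa>' \<circ> chart_inv \<kappa>)"
    using manifold assms unfolding compact_connected_manifold_def smooth_atlas_def overlap_def by blast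
  then show ?thesis by (simp add: smooth_on_def)
qed

lemma transition_has_derivative:
  assumes "\<kappa> \<in> A" "\<kappa>' \<in> A" "x \<in> fst \<kappa>" "x \<in> fst \<kappa>'"
  shows "((snd \<kappa>' \<circ> chart_inv \<kappa>) has_derivative change_coords \<kappa> \<kappa>' x) (at (snd \<kappa> x))"
proof -
  have "snd \<kappa> x \<in> overlap \<kappa> \<kappa>'" using assms by (auto simp: overlap_def)
  from Ck_on_Suc_has_derivative[OF transition_smooth[OF assms(1,2), of "Suc 0"] this]
  show ?thesis unfolding change_coords_def[abs_def] .
qed

lemma linear_change_coords:
  assumes "\<kappa> \<in> A" "\<kappa>' \<in> A" "x \<in> fst \<kappa>" "x \<in> fst \<kappa>'"
  shows "linear (change_coords \<kappa> \<kappa>' x)"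
  using transition_has_derivative[OF assms] by (rule has_derivative_linear)

lemma has_vector_derivative_change_chart:
  assumes \<kappa>: "\<kappa> \<in> A" "\<kappa>' \<in> A" "\<gamma> s \<in> fst \<kappa>" "\<gamma> s \<in> fst \<kappa>'"
    and s: "s \<in> J" and cont: "continuous_on J \<gamma>"
    and der: "((snd \<kappa> \<circ> \<gamma>) has_vector_derivative w) (at s within J)"
  shows "((snd \<kappa>' \<circ> \<gamma>) has_vector_derivative change_coords \<kappa> \<kappa>' (\<gamma> s) w) (at s within J)"
proof -
  let ?c = "change_coords \<kappa> \<kappa>' (\<gamma> s)"
  have t: "((snd \<kappa>' \<circ> chart_inv \<kappa>) has_derivative ?c) (at ((snd \<kappa> \<circ> \<gamma>) s))"
    using transition_has_derivative[OF \<kappa>] by simp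
  have "((\<lambda>s. (snd \<kappa>' \<circ> chart_inv \<kappa>) ((snd \<kappa> \<circ> \<gamma>) s)) has_derivative (\<lambda>h. ?c (h *\<^sub>R w)))
      (at s within J)"
    using has_derivative_compose[OF der[unfolded has_vector_derivative_def] t] .
  then have d: "((\<lambda>s. (snd \<kappa>' \<circ> chart_inv \<kappa>) ((snd \<kappa> \<circ> \<gamma>) s)) has_vector_derivative ?c w)
      (at s within J)"
    unfolding has_vector_derivative_def
    by (simp add: linear_cmul[OF linear_change_coords[OF \<kappa>]])
  \<comment> \<open>The factorisation of \<open>snd \<kappa>' \<circ> \<gamma>\<close> through
    \<kappa> is valid only while the curve stays in the domain of \<kappa>; by continuity this holds
    on a relative neighbourhood of s, and the derivative is local.\<close>
  obtain V where V: "open V" "V \<inter> J = \<gamma> -` fst \<kappa> \<inter> J"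
    using cont charts(1)[OF \<kappa>(1)] unfolding continuous_on_open_invariant by blast
  have sV: "s \<in> V" using V(2) s \<kappa>(3) by auto
  have "((\<lambda>s. (snd \<kappa>' \<circ> chart_inv \<kappa>) ((snd \<kappa> \<circ> \<gamma>) s)) has_vector_derivative ?c w)
      (at s within V \<inter> J)"
    using d by (rule has_vector_derivative_within_subset) auto
  then have "((snd \<kappa>' \<circ> \<gamma>) has_vector_derivative ?c w) (at s within V \<inter> J)"
    by (rule has_vector_derivative_transform[rotated 2])
      (use V(2) s sV charts(5)[OF \<kappa>(1)] in auto)
  moreover have "at s within V \<inter> J = at s within J"
    by (rule at_within_nhd[OF sV V(1)]) blast
  ultimately show ?thesis by simp
qed

text \<open>The coordinate matrix of the metric in the chart \<kappa>. As \<open>g x\<close> takes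
  components with respect to \<open>chart_at A x\<close>, components in \<kappa> have to be
  converted; the smoothness in \<open>riemannian_metric\<close> is required of this
  expression.\<close>

definition metric_in_chart :: "('m, 'e) chart \<Rightarrow> 'e \<Rightarrow> 'e \<Rightarrow> 'e \<Rightarrow> real" where
  "metric_in_chart \<kappa> y u w = (let x = chart_inv \<kappa> y in
     g x (change_coords \<kappa> (chart_at A x) x u) (change_coords \<kappa> (chart_at A x) x w))"

lemma metric_in_chart_continuous:
  assumes \<kappa>: "\<kappa> \<in> A"
  shows "continuous_on (snd \<kappa> ` fst \<kappa>) (\<lambda>y. metric_in_chart \<kappa> y u w)"
proof -
  have "smooth_on (snd \<kappa> ` fst \<kappa>) (\<lambda>y. g (chart_inv \<kappa> y)
     (snd (bundle_chart_inv A \<kappa> (y, u))) (snd (bundle_chart_inv A \<kappa> (y, w))))"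
    using metric \<kappa> unfolding riemannian_metric_def by blast
  then have "Ck_on 0 (snd \<kappa> ` fst \<kappa>) (\<lambda>y. metric_in_chart \<kappa> y u w)"
    unfolding smooth_on_def metric_in_chart_def bundle_chart_inv_def Let_def prod.case snd_conv by blast
  then show ?thesis by simp
qed

lemma metric_bilinear: "bilinear (g x)"
  and metric_nonneg: "g x v v \<ge> 0"
  and metric_pos: "v \<noteq> 0 \<Longrightarrow> g x v v > 0"
proof -
  show b: "bilinear (g x)" and p: "v \<noteq> 0 \<Longrightarrow> g x v v > 0" for v
    using metric unfolding riemannian_metric_def by blast+
  show "g x v v \<ge> 0"
    by (cases "v = 0") (use p[of v] bilinear_lzero[OF b] in auto)
qed

lemma metric_in_chart_nonneg: "metric_in_chart \<kappa> y u u \<ge> 0"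
  by (simp add: metric_in_chart_def Let_def metric_nonneg)

lemma metric_in_chart_bilinear:
  assumes \<kappa>: "\<kappa> \<in> A" and y: "y \<in> snd \<kappa> ` fst \<kappa>"
  shows "bilinear (metric_in_chart \<kappa> y)"
proof -
  let ?x = "chart_inv \<kappa> y"
  let ?c = "change_coords \<kappa> (chart_at A ?x) ?x"
  have c: "linear ?c"
    using linear_change_coords[OF \<kappa> chart_at(1) charts(7)[OF \<kappa> y] chart_at(2)] .
  have "linear (\<lambda>w. g ?x (?c u) (?c w))" "linear (\<lambda>w. g ?x (?c w) (?c u))" for u
    using linear_compose[OF c] metric_bilinear[of ?x] unfolding bilinear_def o_def by blast+
  then show ?thesis unfolding bilinear_def metric_in_chart_def Let_def by blast
qed

text \<open>Continuity of the metric in the base point is known for fixed coordinate vectors. This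
  expansion turns it into joint continuity and into bounds that are uniform on compact sets.\<close>

lemma metric_in_chart_eq_sum:
  assumes "\<kappa> \<in> A" "y \<in> snd \<kappa> ` fst \<kappa>"
  shows "metric_in_chart \<kappa> y u w =
    (\<Sum>b\<in>Basis. \<Sum>c\<in>Basis. (u \<bullet> b) * (w \<bullet> c) * metric_in_chart \<kappa> y b c)"
proof -
  note b = metric_in_chart_bilinear[OF assms]
  have "metric_in_chart \<kappa> y u w = (\<Sum>b\<in>Basis. (u \<bullet> b) *\<^sub>R metric_in_chart \<kappa> y b w)"
    using b unfolding bilinear_def by (intro linear_eq_sum_Basis) blast
  also have "\<dots> = (\<Sum>b\<in>Basis. (u \<bullet> b) *\<^sub>R (\<Sum>c\<in>Basis. (w \<bullet> c) *\<^sub>R metric_in_chart \<kappa> y b c))"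
    using b unfolding bilinear_def by (intro sum.cong refl arg_cong[of _ _ "scaleR _"] linear_eq_sum_Basis) blast
  finally show ?thesis by (simp add: sum_distrib_left mult.assoc)
qed

lemma metric_in_chart_continuous_on:
  assumes \<kappa>: "\<kappa> \<in> A" and p: "continuous_on R p" "p ` R \<subseteq> snd \<kappa> ` fst \<kappa>"
    and q: "continuous_on R q" "continuous_on R q'"
  shows "continuous_on R (\<lambda>s. metric_in_chart \<kappa> (p s) (q s) (q' s))"
proof -
  have "continuous_on R (\<lambda>s. \<Sum>b\<in>Basis. \<Sum>c\<in>Basis.
      (q s \<bullet> b) * (q' s \<bullet> c) * metric_in_chart \<kappa> (p s) b c)"
    by (intro continuous_intros q continuous_on_compose2[OF metric_in_chart_continuous[OF \<kappa>] p])
  then show ?thesis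
    by (rule continuous_on_eq) (use metric_in_chart_eq_sum[OF \<kappa>] p(2) in \<open>simp add: image_subset_iff\<close>)
qed

lemma metric_in_chart_upper_bound:
  assumes \<kappa>: "\<kappa> \<in> A" and K: "compact K" "K \<subseteq> snd \<kappa> ` fst \<kappa>"
  obtains C where "C > 0" "\<And>y v. y \<in> K \<Longrightarrow> metric_in_chart \<kappa> y v v \<le> C * (norm v)\<^sup>2"
proof -
  have "\<exists>M. \<forall>y\<in>K. \<bar>metric_in_chart \<kappa> y b c\<bar> \<le> M" for b c
  proof -
    have "continuous_on K (\<lambda>y. metric_in_chart \<kappa> y b c)"
      using metric_in_chart_continuous[OF \<kappa>] K(2) by (rule continuous_on_subset)
    then have "bounded ((\<lambda>y. metric_in_chart \<kappa> y b c) ` K)"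
      using K(1) compact_continuous_image compact_imp_bounded by blast
    then show ?thesis unfolding bounded_iff by auto
  qed
  then obtain M where M: "\<And>b c y. y \<in> K \<Longrightarrow> \<bar>metric_in_chart \<kappa> y b c\<bar> \<le> M b c"
    by metis
  define C where "C = (\<Sum>b\<in>(Basis::'e set). \<Sum>c\<in>(Basis::'e set). \<bar>M b c\<bar>)"
  have "metric_in_chart \<kappa> y v v \<le> (C + 1) * (norm v)\<^sup>2" if y: "y \<in> K" for y v
  proof -
    have y': "y \<in> snd \<kappa> ` fst \<kappa>" using y K by blast
    have "(v \<bullet> b) * (v \<bullet> c) * metric_in_chart \<kappa> y b c \<le> (norm v)\<^sup>2 * \<bar>M b c\<bar>"
      if "b \<in> Basis" "c \<in> Basis" for b c
    proof -
      have "\<bar>v \<bullet> b\<bar> * \<bar>v \<bullet> c\<bar> * \<bar>metric_in_chart \<kappa> y b c\<bar> \<le> norm v * norm v * \<bar>M b c\<bar>"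
        using Basis_le_norm[OF that(1), of v] Basis_le_norm[OF that(2), of v] M[OF y, of b c]
        by (intro mult_mono) auto
      moreover have "(v \<bullet> b) * (v \<bullet> c) * metric_in_chart \<kappa> y b c
          \<le> \<bar>v \<bullet> b\<bar> * \<bar>v \<bullet> c\<bar> * \<bar>metric_in_chart \<kappa> y b c\<bar>"
        unfolding abs_mult[symmetric] by (rule abs_ge_self)
      ultimately show ?thesis by (simp add: power2_eq_square)
    qed
    then have "metric_in_chart \<kappa> y v v \<le> (\<Sum>b\<in>Basis. \<Sum>c\<in>Basis. (norm v)\<^sup>2 * \<bar>M b c\<bar>)"
      unfolding metric_in_chart_eq_sum[OF \<kappa> y', of v v] by (intro sum_mono)
    also have "\<dots> = C * (norm v)\<^sup>2" unfolding C_def by (simp add: sum_distrib_left mult.commute)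
    finally show ?thesis by (simp add: distrib_right add_increasing2)
  qed
  moreover have "C \<ge> 0" unfolding C_def by (intro sum_nonneg) auto
  ultimately show thesis by (intro that[of "C + 1"]) auto
qed

lemma C1_curve_onD:
  assumes "C1_curve_on A J \<gamma>"
  shows "continuous_on J \<gamma>"
    and "\<kappa> \<in> A \<Longrightarrow> \<exists>w. continuous_on {s \<in> J. \<gamma> s \<in> fst \<kappa>} w \<and>
        (\<forall>s\<in>J. \<gamma> s \<in> fst \<kappa> \<longrightarrow> ((snd \<kappa> \<circ> \<gamma>) has_vector_derivative w s) (at s within J))"
  using assms unfolding C1_curve_on_def by blast+

text \<open>The Lagrangian along the curve, that is kinetic term plus U; the quantity conserved by
  the Euler-Lagrange flow has the opposite sign before U.\<close>

definition energy :: "(real \<Rightarrow> 'm) \<Rightarrow> real \<Rightarrow> real" where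
  "energy \<gamma> s = L (\<gamma> s, velocity A \<gamma> s)"

lemma energy_ge: "energy \<gamma> s \<ge> U (\<gamma> s)"
  by (simp add: energy_def lagrangian metric_nonneg)

text \<open>\<open>velocity\<close> refers to the chart selected at \<open>\<gamma> s\<close>, which
  may jump with s. Here the same quantity is computed in one fixed chart.\<close>

lemma energy_in_chart:
  assumes "\<kappa> \<in> A" "\<gamma> s \<in> fst \<kappa>" "open J" "s \<in> J" "continuous_on J \<gamma>"
    and "((snd \<kappa> \<circ> \<gamma>) has_vector_derivative w) (at s)"
  shows "energy \<gamma> s = metric_in_chart \<kappa> (snd \<kappa> (\<gamma> s)) w w / 2 + U (\<gamma> s)"
proof -
  have J: "at s within J = at s" using assms(4,3) by (rule at_within_open)
  have "((snd (chart_at A (\<gamma> s)) \<circ> \<gamma>) has_vector_derivative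
      change_coords \<kappa> (chart_at A (\<gamma> s)) (\<gamma> s) w) (at s within J)"
    by (rule has_vector_derivative_change_chart[where J = J])
      (use assms(1,2,4,5,6) J chart_at in simp_all)
  then have "velocity A \<gamma> s = change_coords \<kappa> (chart_at A (\<gamma> s)) (\<gamma> s) w"
    unfolding velocity_def J by (rule vector_derivative_at)
  then show ?thesis unfolding energy_def lagrangian metric_in_chart_def Let_def
    using charts(5)[OF assms(1,2)] by simp
qed

end

section \<open>The action of curves\<close>

text \<open>Splitting at any break point in the interior leaves fewer break points on both sides.
  Thus properties that pass to adjacent intervals, such as integrability and continuity, need only
  be checked on the C^1 pieces.\<close>

lemma consecutive_induct:
  fixes S :: "real set"
  assumes "finite S" "a \<in> S" "b \<in> S" "a < b"
    and step: "\<And>a b. a \<in> S \<Longrightarrow> b \<in> S \<Longrightarrow> a < b \<Longrightarrow> S \<inter> {a<..<b} = {} \<Longrightarrow> P a b"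
    and trans: "\<And>a b c. a < b \<Longrightarrow> b < c \<Longrightarrow> P a b \<Longrightarrow> P b c \<Longrightarrow> P a c"
  shows "P a b"
  using assms(2-4)
proof (induction "card (S \<inter> {a<..<b})" arbitrary: a b rule: less_induct)
  case less
  show ?case
  proof (cases "S \<inter> {a<..<b} = {}")
    case True
    then show ?thesis using step less.prems by blast
  next
    case False
    then obtain c where c: "c \<in> S" "a < c" "c < b" by auto
    have fin: "finite (S \<inter> {a<..<b})" using assms(1) by simp
    have "card (S \<inter> {a<..<c}) < card (S \<inter> {a<..<b})" "card (S \<inter> {c<..<b}) < card (S \<inter> {a<..<b})"
      using c by (auto intro!: psubset_card_mono[OF fin])
    then have "P a c" "P c b" using less c by auto
    then show ?thesis using trans c by blast
  qed
qed

text \<open>Finds the C^1 piece having a given time in its interior, where the two-sided derivative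
  of the path exists.\<close>

lemma consecutive_around:
  fixes S :: "real set"
  assumes "finite S" "a \<in> S" "b \<in> S" "a < s" "s < b" "s \<notin> S"
  obtains a' b' where "a' \<in> S" "b' \<in> S" "a' < s" "s < b'" "S \<inter> {a'<..<b'} = {}"
proof -
  let ?l = "Max {x \<in> S. x < s}" and ?u = "Min {x \<in> S. s < x}"
  have "?l \<in> {x \<in> S. x < s}" "?u \<in> {x \<in> S. s < x}"
    using assms by (intro Max_in Min_in; auto)+
  moreover have "S \<inter> {?l<..<?u} = {}"
  proof -
    have False if "x \<in> S" "?l < x" "x < ?u" for x
    proof (cases "x < s")
      case True
      then have "x \<le> ?l" using that assms(1) by (intro Max_ge) auto
      then show False using that by simp
    next
      case False
      then have "s < x" using that assms(6) by (cases "x = s") auto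
      then have "?u \<le> x" using that assms(1) by (intro Min_le) auto
      then show False using that by simp
    qed
    then show ?thesis by auto
  qed
  ultimately show thesis by (intro that[of ?l ?u]) auto
qed

text \<open>At break points and end points \<open>vector_derivative\<close> may be an arbitrary
  choice, so an estimate of the speed bounds the Lagrangian off a finite set only.\<close>

lemma integral_le_except_finite:
  fixes f :: "real \<Rightarrow> real"
  assumes "f integrable_on {a..b}" "a \<le> b" "finite S" "\<And>s. s \<in> {a..b} - S \<Longrightarrow> f s \<le> B"
  shows "integral {a..b} f \<le> B * (b - a)"
proof -
  let ?h = "\<lambda>s. if s \<in> S then B else f s"
  have eq: "integral {a..b} f = integral {a..b} ?h"
    by (rule integral_spike[OF negligible_finite[OF assms(3)]]) auto
  have "?h integrable_on {a..b}"
    by (rule integrable_spike[OF assms(1) negligible_finite[OF assms(3)]]) auto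
  then have "integral {a..b} ?h \<le> integral {a..b} (\<lambda>s. B)"
    using assms(4) by (intro integral_le) auto
  then show ?thesis using eq assms(2) by (simp add: mult.commute)
qed

lemma integral_ge_except_finite:
  fixes f :: "real \<Rightarrow> real"
  assumes "f integrable_on {a..b}" "a \<le> b" "finite S" "\<And>s. s \<in> {a..b} - S \<Longrightarrow> B \<le> f s"
  shows "B * (b - a) \<le> integral {a..b} f"
  using integral_le_except_finite[of "\<lambda>s. - f s" a b S "- B"] assms integrable_neg[OF assms(1)]
  by (simp add: integral_neg)

lemma has_vector_derivative_shift_iff:
  "((\<lambda>s. h (s - c)) has_vector_derivative w) (at s) \<longleftrightarrow> (h has_vector_derivative w) (at (s - c :: real))"
proof
  have 1: "((\<lambda>s. s + c) has_vector_derivative 1) (at (s - c))"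
    by (auto intro!: derivative_eq_intros)
  assume "((\<lambda>s. h (s - c)) has_vector_derivative w) (at s)"
  then show "(h has_vector_derivative w) (at (s - c))"
    using vector_diff_chain_at[OF 1, of "\<lambda>s. h (s - c)" w] by (simp add: o_def)
next
  have 1: "((\<lambda>s. s - c) has_vector_derivative 1) (at s)"
    by (auto intro!: derivative_eq_intros)
  assume "(h has_vector_derivative w) (at (s - c))"
  then show "((\<lambda>s. h (s - c)) has_vector_derivative w) (at s)"
    using vector_diff_chain_at[OF 1, of h w] by (simp add: o_def)
qed

section \<open>Regularity and concatenation of paths\<close>

context mechanical_system
begin

text \<open>\<open>e\<close> is formed with derivatives within the closed interval, hence one-sided
  ones at its ends, where \<open>energy\<close> itself may be a meaningless value. Continuity at
  \<open>s0\<close> is checked in the one chart selected at \<open>\<gamma> s0\<close>.\<close>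

lemma C1_curve_energy_continuous:
  assumes C1: "C1_curve_on A {a..b} \<gamma>" and ab: "a < b"
  obtains e where "continuous_on {a..b} e" "\<And>s. s \<in> {a<..<b} \<Longrightarrow> energy \<gamma> s = e s"
proof -
  let ?J = "{a..b}"
  note cont = C1_curve_onD(1)[OF C1]
  define vd where "vd s = vector_derivative (snd (chart_at A (\<gamma> s)) \<circ> \<gamma>) (at s within ?J)" for s
  define e where "e s = g (\<gamma> s) (vd s) (vd s) / 2 + U (\<gamma> s)" for s
  have e_chart: "e s = metric_in_chart \<kappa> (snd \<kappa> (\<gamma> s)) w w / 2 + U (\<gamma> s)"
    if "\<kappa> \<in> A" "\<gamma> s \<in> fst \<kappa>" "s \<in> ?J" "((snd \<kappa> \<circ> \<gamma>) has_vector_derivative w) (at s within ?J)" for \<kappa> s w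
  proof -
    have "((snd (chart_at A (\<gamma> s)) \<circ> \<gamma>) has_vector_derivative
        change_coords \<kappa> (chart_at A (\<gamma> s)) (\<gamma> s) w) (at s within ?J)"
      by (rule has_vector_derivative_change_chart[OF that(1) chart_at(1) that(2) chart_at(2)
            that(3) cont that(4)])
    then have "vd s = change_coords \<kappa> (chart_at A (\<gamma> s)) (\<gamma> s) w"
      unfolding vd_def by (rule vector_derivative_within_closed_interval[OF ab that(3)])
    then show ?thesis unfolding e_def metric_in_chart_def Let_def
      using charts(5)[OF that(1,2)] by simp
  qed
  have "continuous (at s0 within ?J) e" if s0: "s0 \<in> ?J" for s0
  proof -
    define \<kappa> where "\<kappa> = chart_at A (\<gamma> s0)"
    have \<kappa>: "\<kappa> \<in> A" "\<gamma> s0 \<in> fst \<kappa>" unfolding \<kappa>_def by (rule chart_at)+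
    let ?N = "{s \<in> ?J. \<gamma> s \<in> fst \<kappa>}"
    obtain w where w: "continuous_on ?N w"
      "\<forall>s\<in>?J. \<gamma> s \<in> fst \<kappa> \<longrightarrow> ((snd \<kappa> \<circ> \<gamma>) has_vector_derivative w s) (at s within ?J)"
      using C1_curve_onD(2)[OF C1 \<kappa>(1)] by (elim exE conjE)
    have cN: "continuous_on ?N \<gamma>" by (rule continuous_on_subset[OF cont]) blast
    have "continuous_on ?N (\<lambda>s. metric_in_chart \<kappa> (snd \<kappa> (\<gamma> s)) (w s) (w s) / 2 + U (\<gamma> s))"
    proof (intro continuous_on_add continuous_on_divide continuous_on_const
        metric_in_chart_continuous_on[OF \<kappa>(1)] w(1))
      show "continuous_on ?N (\<lambda>s. snd \<kappa> (\<gamma> s))"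
        by (rule continuous_on_compose2[OF charts(3)[OF \<kappa>(1)] cN]) blast
      show "continuous_on ?N (\<lambda>s. U (\<gamma> s))"
        by (rule continuous_on_compose2[OF continuous_potential cN]) blast
    qed auto
    then have "continuous_on ?N e"
    proof (rule continuous_on_eq)
      fix s assume "s \<in> ?N"
      then have s: "s \<in> ?J" "\<gamma> s \<in> fst \<kappa>" by blast+
      show "metric_in_chart \<kappa> (snd \<kappa> (\<gamma> s)) (w s) (w s) / 2 + U (\<gamma> s) = e s"
        by (rule e_chart[OF \<kappa>(1) s(2,1) mp[OF bspec[OF w(2) s(1)] s(2)], symmetric])
    qed
    then have "continuous (at s0 within ?N) e"
      using s0 \<kappa>(2) unfolding continuous_on_eq_continuous_within by blast
    moreover obtain V where V: "open V" "V \<inter> ?J = \<gamma> -` fst \<kappa> \<inter> ?J"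
      using cont charts(1)[OF \<kappa>(1)] unfolding continuous_on_open_invariant by blast
    have "s0 \<in> V" using V(2) s0 \<kappa>(2) by blast
    then have "at s0 within ?N = at s0 within ?J"
      by (rule at_within_nhd[OF _ V(1)]) (use V(2) in blast)
    ultimately show ?thesis by simp
  qed
  then have "continuous_on ?J e" by (simp add: continuous_on_eq_continuous_within)
  moreover have "energy \<gamma> s = e s" if s: "s \<in> {a<..<b}" for s
  proof -
    define \<kappa> where "\<kappa> = chart_at A (\<gamma> s)"
    have \<kappa>: "\<kappa> \<in> A" "\<gamma> s \<in> fst \<kappa>" unfolding \<kappa>_def by (rule chart_at)+
    have sJ: "s \<in> ?J" using s by simp
    obtain w' where "\<forall>s\<in>?J. \<gamma> s \<in> fst \<kappa> \<longrightarrow>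
        ((snd \<kappa> \<circ> \<gamma>) has_vector_derivative w' s) (at s within ?J)"
      using C1_curve_onD(2)[OF C1 \<kappa>(1)] by (elim exE conjE)
    note w = mp[OF bspec[OF this sJ] \<kappa>(2)]
    have "at s within ?J = at s" using s by (intro at_within_Icc_at) auto
    with w have "((snd \<kappa> \<circ> \<gamma>) has_vector_derivative w' s) (at s)" by simp
    then have "energy \<gamma> s = metric_in_chart \<kappa> (snd \<kappa> (\<gamma> s)) (w' s) (w' s) / 2 + U (\<gamma> s)"
      by (intro energy_in_chart[where J = "{a<..<b}" and \<gamma> = \<gamma> and s = s, OF \<kappa> _ s] continuous_on_subset[OF cont]) auto
    then show ?thesis using e_chart[OF \<kappa> sJ w] by simp
  qed
  ultimately show thesis by (rule that)
qed

lemma C1_curve_energy_integrable: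
  assumes C1: "C1_curve_on A {a..b} \<gamma>" and ab: "a < b"
  shows "energy \<gamma> integrable_on {a..b}"
proof -
  obtain e where e: "continuous_on {a..b} e" "\<And>s. s \<in> {a<..<b} \<Longrightarrow> energy \<gamma> s = e s"
    by (rule C1_curve_energy_continuous[OF assms]) (rule that)
  have "e integrable_on {a..b}" using e(1) by (rule integrable_continuous_real)
  then show ?thesis
    by (rule integrable_spike[OF _ negligible_finite[of "{a, b}"]]) (use e(2) in auto)
qed

lemma piecewise_C1_pathE:
  assumes "piecewise_C1_path A t \<gamma>"
  obtains S where "finite S" "0 \<in> S" "t \<in> S" "S \<subseteq> {0..t}"
    "\<And>a b. a \<in> S \<Longrightarrow> b \<in> S \<Longrightarrow> a < b \<Longrightarrow> S \<inter> {a<..<b} = {} \<Longrightarrow> C1_curve_on A {a..b} \<gamma>"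
proof -
  from assms obtain S where S: "finite S" "{0, t} \<subseteq> S" "S \<subseteq> {0..t}"
    "\<forall>a\<in>S. \<forall>b\<in>S. a < b \<and> S \<inter> {a<..<b} = {} \<longrightarrow> C1_curve_on A {a..b} \<gamma>"
    unfolding piecewise_C1_path_def by (elim exE conjE)
  show thesis
  proof (rule that[OF S(1) _ _ S(3)])
    fix a b assume "a \<in> S" "b \<in> S" "a < b" "S \<inter> {a<..<b} = {}"
    then show "C1_curve_on A {a..b} \<gamma>" using S(4) by simp
  qed (use S(2) in simp_all)
qed

definition connects :: "real \<Rightarrow> 'm \<Rightarrow> 'm \<Rightarrow> (real \<Rightarrow> 'm) \<Rightarrow> bool" where
  "connects t x y \<gamma> \<longleftrightarrow> 0 < t \<and> piecewise_C1_path A t \<gamma> \<and> \<gamma> 0 = x \<and> \<gamma> t = y"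

lemma piecewise_C1_path_energy_integrable:
  assumes "piecewise_C1_path A t \<gamma>" "t > 0"
  shows "energy \<gamma> integrable_on {0..t}"
proof -
  obtain S where S: "finite S" "0 \<in> S" "t \<in> S"
    "\<And>a b. a \<in> S \<Longrightarrow> b \<in> S \<Longrightarrow> a < b \<Longrightarrow> S \<inter> {a<..<b} = {} \<Longrightarrow> C1_curve_on A {a..b} \<gamma>"
    by (rule piecewise_C1_pathE[OF assms(1)]) (rule that)
  show ?thesis
    by (rule consecutive_induct[OF S(1-3) assms(2)])
      (auto intro: C1_curve_energy_integrable S(4) Henstock_Kurzweil_Integration.integrable_combine[OF less_imp_le less_imp_le])
qed

lemma piecewise_C1_path_continuous:
  assumes "piecewise_C1_path A t \<gamma>" "t > 0"
  shows "continuous_on {0..t} \<gamma>"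
proof -
  obtain S where S: "finite S" "0 \<in> S" "t \<in> S"
    "\<And>a b. a \<in> S \<Longrightarrow> b \<in> S \<Longrightarrow> a < b \<Longrightarrow> S \<inter> {a<..<b} = {} \<Longrightarrow> C1_curve_on A {a..b} \<gamma>"
    by (rule piecewise_C1_pathE[OF assms(1)]) (rule that)
  show ?thesis
  proof (rule consecutive_induct[OF S(1-3) assms(2)])
    fix a b c assume "a < b" "b < c" "continuous_on {a..b} \<gamma>" "continuous_on {b..c} \<gamma>"
    moreover from this have "{a..c} = {a..b} \<union> {b..c}" by auto
    ultimately show "continuous_on {a..c} \<gamma>"
      using continuous_on_closed_Un[of "{a..b}" "{b..c}" \<gamma>] by simp
  qed (use S(4) C1_curve_onD(1) in blast)
qed

lemma C1_curve_on_cong: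
  assumes "C1_curve_on A J \<gamma>" and eq: "\<And>s. s \<in> J \<Longrightarrow> \<gamma> s = \<gamma>' s"
  shows "C1_curve_on A J \<gamma>'"
  unfolding C1_curve_on_def
proof (intro conjI ballI)
  show "continuous_on J \<gamma>'" using C1_curve_onD(1)[OF assms(1)] eq by (rule continuous_on_eq)
  fix \<kappa> assume "\<kappa> \<in> A"
  from C1_curve_onD(2)[OF assms(1) this] obtain w where
    w: "continuous_on {s \<in> J. \<gamma> s \<in> fst \<kappa>} w"
      "\<forall>s\<in>J. \<gamma> s \<in> fst \<kappa> \<longrightarrow> ((snd \<kappa> \<circ> \<gamma>) has_vector_derivative w s) (at s within J)"
    by (elim exE conjE)
  show "\<exists>w. continuous_on {s \<in> J. \<gamma>' s \<in> fst \<kappa>} w \<and>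
        (\<forall>s\<in>J. \<gamma>' s \<in> fst \<kappa> \<longrightarrow> ((snd \<kappa> \<circ> \<gamma>') has_vector_derivative w s) (at s within J))"
  proof (intro exI[of _ w] conjI ballI impI)
    have "{s \<in> J. \<gamma> s \<in> fst \<kappa>} = {s \<in> J. \<gamma>' s \<in> fst \<kappa>}" using eq by auto
    then show "continuous_on {s \<in> J. \<gamma>' s \<in> fst \<kappa>} w" using w(1) by simp
    fix s assume s: "s \<in> J" "\<gamma>' s \<in> fst \<kappa>"
    have "\<gamma> s \<in> fst \<kappa>" using s eq by simp
    from mp[OF bspec[OF w(2) s(1)] this]
    show "((snd \<kappa> \<circ> \<gamma>') has_vector_derivative w s) (at s within J)"
      by (rule has_vector_derivative_transform[OF s(1), rotated]) (simp add: eq)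
  qed
qed

lemma C1_curve_on_shift:
  assumes "C1_curve_on A {a - c..b - c} \<gamma>"
  shows "C1_curve_on A {a..b} (\<lambda>s. \<gamma> (s - c))"
  unfolding C1_curve_on_def
proof (intro conjI ballI)
  have im: "(\<lambda>s. s - c) ` {a..b} = {a - c..b - c}" by simp
  have shift: "continuous_on X (\<lambda>s. s - c)" for X by (intro continuous_intros)
  show "continuous_on {a..b} (\<lambda>s. \<gamma> (s - c))"
    by (rule continuous_on_compose2[OF C1_curve_onD(1)[OF assms] shift]) auto
  fix \<kappa> assume "\<kappa> \<in> A"
  from C1_curve_onD(2)[OF assms this] obtain w where
    w: "continuous_on {s \<in> {a - c..b - c}. \<gamma> s \<in> fst \<kappa>} w"
      "\<forall>s\<in>{a - c..b - c}. \<gamma> s \<in> fst \<kappa> \<longrightarrow>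
         ((snd \<kappa> \<circ> \<gamma>) has_vector_derivative w s) (at s within {a - c..b - c})"
    by (elim exE conjE)
  show "\<exists>w. continuous_on {s \<in> {a..b}. \<gamma> (s - c) \<in> fst \<kappa>} w \<and>
        (\<forall>s\<in>{a..b}. \<gamma> (s - c) \<in> fst \<kappa> \<longrightarrow>
          ((snd \<kappa> \<circ> (\<lambda>s. \<gamma> (s - c))) has_vector_derivative w s) (at s within {a..b}))"
  proof (intro exI[of _ "\<lambda>s. w (s - c)"] conjI ballI impI)
    show "continuous_on {s \<in> {a..b}. \<gamma> (s - c) \<in> fst \<kappa>} (\<lambda>s. w (s - c))"
      by (rule continuous_on_compose2[OF w(1) shift]) auto
    fix s assume s: "s \<in> {a..b}" "\<gamma> (s - c) \<in> fst \<kappa>"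
    have s': "s - c \<in> {a - c..b - c}" using s by simp
    have 1: "((\<lambda>s. s - c) has_vector_derivative 1) (at s within {a..b})"
      by (auto intro!: derivative_eq_intros)
    have 2: "((snd \<kappa> \<circ> \<gamma>) has_vector_derivative w (s - c)) (at (s - c) within (\<lambda>s. s - c) ` {a..b})"
      unfolding im using mp[OF bspec[OF w(2) s'] s(2)] .
    show "((snd \<kappa> \<circ> (\<lambda>s. \<gamma> (s - c))) has_vector_derivative w (s - c)) (at s within {a..b})"
      using vector_diff_chain_within[OF 1 2] by (simp add: o_def)
  qed
qed

lemma energy_cong:
  assumes "open J" "s \<in> J" "\<And>s. s \<in> J \<Longrightarrow> \<gamma> s = \<gamma>' s"
  shows "energy \<gamma> s = energy \<gamma>' s"
proof -
  have "eventually (\<lambda>r. r \<in> UNIV \<longrightarrow> (snd (chart_at A (\<gamma> s)) \<circ> \<gamma>) r = (snd (chart_at A (\<gamma>' s)) \<circ> \<gamma>') r) (nhds s)"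
    using eventually_nhds_in_open[OF assms(1,2)] by eventually_elim (simp add: assms(2,3))
  then have "velocity A \<gamma> s = velocity A \<gamma>' s"
    unfolding velocity_def by (rule vector_derivative_cong_eq) auto
  then show ?thesis using assms(2,3) by (simp add: energy_def)
qed

lemma energy_shift: "energy (\<lambda>s. \<gamma> (s - c)) s = energy \<gamma> (s - c)"
proof -
  have "velocity A (\<lambda>s. \<gamma> (s - c)) s = velocity A \<gamma> (s - c)"
    unfolding velocity_def vector_derivative_def o_def
    using has_vector_derivative_shift_iff[of "\<lambda>r. snd (chart_at A (\<gamma> (s - c))) (\<gamma> r)" c _ s] by simp
  then show ?thesis by (simp add: energy_def)
qed

definition action :: "(real \<Rightarrow> 'm) \<Rightarrow> real \<Rightarrow> real" where
  "action \<gamma> t = integral {0..t} (energy \<gamma>)"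

text \<open>Source of the triangle inequality and of the arguments by waiting. The Lagrangian of the
  joined path agrees with those of its parts except at \<open>t1\<close>, where the velocity may
  jump.\<close>

lemma action_concat:
  assumes 1: "connects t1 x y \<gamma>1" and 2: "connects t2 y z \<gamma>2"
  shows "\<exists>\<gamma>. connects (t1 + t2) x z \<gamma> \<and> action \<gamma> (t1 + t2) = action \<gamma>1 t1 + action \<gamma>2 t2"
proof -
  define \<gamma> where "\<gamma> s = (if s \<le> t1 then \<gamma>1 s else \<gamma>2 (s - t1))" for s
  have t: "t1 > 0" "t2 > 0" and p1: "piecewise_C1_path A t1 \<gamma>1" and p2: "piecewise_C1_path A t2 \<gamma>2"
    and ends: "\<gamma>1 0 = x" "\<gamma>1 t1 = y" "\<gamma>2 0 = y" "\<gamma>2 t2 = z"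
    using 1 2 by (simp_all add: connects_def)
  have left: "\<gamma>1 s = \<gamma> s" if "s \<le> t1" for s using that by (simp add: \<gamma>_def)
  have right: "\<gamma>2 (s - t1) = \<gamma> s" if "t1 \<le> s" for s
    using that ends by (cases "s = t1") (auto simp: \<gamma>_def)
  obtain S1 where S1: "finite S1" "0 \<in> S1" "t1 \<in> S1" "S1 \<subseteq> {0..t1}"
    "\<And>a b. a \<in> S1 \<Longrightarrow> b \<in> S1 \<Longrightarrow> a < b \<Longrightarrow> S1 \<inter> {a<..<b} = {} \<Longrightarrow> C1_curve_on A {a..b} \<gamma>1"
    by (rule piecewise_C1_pathE[OF p1]) (rule that)
  obtain S2 where S2: "finite S2" "0 \<in> S2" "t2 \<in> S2" "S2 \<subseteq> {0..t2}"
    "\<And>a b. a \<in> S2 \<Longrightarrow> b \<in> S2 \<Longrightarrow> a < b \<Longrightarrow> S2 \<inter> {a<..<b} = {} \<Longrightarrow> C1_curve_on A {a..b} \<gamma>2"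
    by (rule piecewise_C1_pathE[OF p2]) (rule that)
  let ?S = "S1 \<union> (\<lambda>s. s + t1) ` S2"
  have low: "a \<in> S1" if "a \<in> ?S" "a \<le> t1" for a
    using that S1(3) S2(4) by auto
  have high: "a - t1 \<in> S2" if "a \<in> ?S" "t1 \<le> a" for a
    using that S1(4) S2(2) by auto
  have "piecewise_C1_path A (t1 + t2) \<gamma>"
    unfolding piecewise_C1_path_def
  proof (intro exI[of _ ?S] conjI ballI impI)
    show "finite ?S" using S1 S2 by simp
    show "{0, t1 + t2} \<subseteq> ?S" using S1 S2 by (auto simp: image_iff add.commute)
    show "?S \<subseteq> {0..t1 + t2}" using S1(4) S2(4) t by fastforce
    fix a b assume ab: "a \<in> ?S" "b \<in> ?S" "a < b \<and> ?S \<inter> {a<..<b} = {}"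
    \<comment> \<open>Since the junction is a break point, no piece extends across it.\<close>
    have "t1 \<in> ?S" using S1 by simp
    then have "b \<le> t1 \<or> t1 \<le> a" using ab by (metis Int_iff empty_iff greaterThanLessThan_iff not_le)
    then show "C1_curve_on A {a..b} \<gamma>"
    proof
      assume b: "b \<le> t1"
      have "C1_curve_on A {a..b} \<gamma>1" using ab b by (intro S1(5) low) auto
      then show ?thesis by (rule C1_curve_on_cong) (use b left in auto)
    next
      assume a: "t1 \<le> a"
      have "S2 \<inter> {a - t1<..<b - t1} = {}"
      proof -
        have False if "s \<in> S2" "a - t1 < s" "s < b - t1" for s
        proof -
          have "s + t1 \<in> ?S \<inter> {a<..<b}" using that by auto
          then show False using ab by blast
        qed
        then show ?thesis by auto
      qed
      then have "C1_curve_on A {a - t1..b - t1} \<gamma>2" using ab a by (intro S2(5) high) auto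
      from C1_curve_on_shift[OF this]
      show ?thesis by (rule C1_curve_on_cong) (use a right in auto)
    qed
  qed
  then have conn: "connects (t1 + t2) x z \<gamma>"
    using t ends by (simp add: connects_def \<gamma>_def)
  have "(energy \<gamma>1 has_integral action \<gamma>1 t1) {0..t1}"
    using piecewise_C1_path_energy_integrable[OF p1 t(1)] unfolding action_def by (rule integrable_integral)
  then have i1: "(energy \<gamma> has_integral action \<gamma>1 t1) {0..t1}"
  proof (rule has_integral_spike_finite[rotated 2, of _ _ _ "{t1}"])
    fix s assume "s \<in> {0..t1} - {t1}"
    then show "energy \<gamma> s = energy \<gamma>1 s"
      by (intro energy_cong[of "{..<t1}"]) (auto simp: \<gamma>_def)
  qed simp
  have "(energy \<gamma>2 has_integral action \<gamma>2 t2) {0..t2}"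
    using piecewise_C1_path_energy_integrable[OF p2 t(2)] unfolding action_def by (rule integrable_integral)
  then have "((\<lambda>s. energy \<gamma>2 (s - t1)) has_integral action \<gamma>2 t2) {t1..t1 + t2}"
    using has_integral_affinity[of "energy \<gamma>2" "action \<gamma>2 t2" 0 t2 1 "- t1"] by (simp add: add.commute)
  then have i2: "(energy \<gamma> has_integral action \<gamma>2 t2) {t1..t1 + t2}"
  proof (rule has_integral_spike_finite[rotated 2, of _ _ _ "{t1}"])
    fix s assume "s \<in> {t1..t1 + t2} - {t1}"
    then show "energy \<gamma> s = energy \<gamma>2 (s - t1)"
      unfolding energy_shift[symmetric]
      by (intro energy_cong[of "{t1<..}"]) (auto simp: \<gamma>_def)
  qed simp
  have "(energy \<gamma> has_integral action \<gamma>1 t1 + action \<gamma>2 t2) {0..t1 + t2}"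
    using t by (intro has_integral_combine[OF _ _ i1 i2]) auto
  then have "action \<gamma> (t1 + t2) = action \<gamma>1 t1 + action \<gamma>2 t2"
    unfolding action_def[of \<gamma>] by (rule integral_unique)
  with conn show ?thesis by (intro exI[of _ \<gamma>] conjI)
qed

lemma connects_const:
  assumes "t > 0"
  shows "connects t x x (\<lambda>_. x)" "action (\<lambda>_. x) t = U x * t"
proof -
  have C1: "C1_curve_on A {a..b} (\<lambda>_. x)" for a b
    unfolding C1_curve_on_def
  proof (intro conjI ballI continuous_on_const)
    fix \<kappa> assume "\<kappa> \<in> A"
    have "snd \<kappa> \<circ> (\<lambda>_::real. x) = (\<lambda>_. snd \<kappa> x)" by auto
    then show "\<exists>w. continuous_on {s \<in> {a..b}. x \<in> fst \<kappa>} w \<and>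
        (\<forall>s\<in>{a..b}. x \<in> fst \<kappa> \<longrightarrow> ((snd \<kappa> \<circ> (\<lambda>_. x)) has_vector_derivative w s) (at s within {a..b}))"
      by (intro exI[of _ "\<lambda>_. 0"]) simp
  qed
  have "piecewise_C1_path A t (\<lambda>_. x)"
    unfolding piecewise_C1_path_def
    by (intro exI[of _ "{0, t}"] conjI ballI impI C1) (use assms in auto)
  then show "connects t x x (\<lambda>_. x)" using assms by (simp add: connects_def)
  have "velocity A (\<lambda>_. x) s = 0" for s by (simp add: velocity_def o_def)
  then have "energy (\<lambda>_. x) = (\<lambda>_. U x)"
    by (simp add: energy_def lagrangian bilinear_lzero[OF metric_bilinear] fun_eq_iff)
  then show "action (\<lambda>_. x) t = U x * t" using assms by (simp add: action_def)
qed

text \<open>Run through in time T, the curve has coordinate speed at most l / T, so the kinetic term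
  is at most C l^2 / (2 T^2), and integration multiplies this by T.\<close>

lemma chart_path_action:
  assumes \<kappa>: "\<kappa> \<in> A" and T: "T > 0"
    and q: "\<And>s. s \<in> {0..1} \<Longrightarrow> (q has_vector_derivative q' s) (at s within {0..1})"
      "continuous_on {0..1} q'" "\<And>s. s \<in> {0..1} \<Longrightarrow> q s \<in> snd \<kappa> ` fst \<kappa>"
    and C: "\<And>s v. s \<in> {0..1} \<Longrightarrow> metric_in_chart \<kappa> (q s) v v \<le> C * (norm v)\<^sup>2" "C \<ge> 0"
    and l: "\<And>s. s \<in> {0..1} \<Longrightarrow> norm (q' s) \<le> l"
    and B: "\<And>s. s \<in> {0..1} \<Longrightarrow> U (chart_inv \<kappa> (q s)) \<le> B"
  shows "\<exists>\<gamma>. connects T (chart_inv \<kappa> (q 0)) (chart_inv \<kappa> (q 1)) \<gamma> \<and>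
    action \<gamma> T \<le> C * l\<^sup>2 / (2 * T) + B * T"
proof -
  define p where "p s = q (s / T)" for s
  define p' where "p' s = (1 / T) *\<^sub>R q' (s / T)" for s
  define \<gamma> where "\<gamma> s = chart_inv \<kappa> (p s)" for s
  have sT: "s / T \<in> {0..1}" if "s \<in> {0..T}" for s using that T by (simp add: divide_le_eq)
  have im: "(\<lambda>s. s / T) ` {0..T} = {0..1}"
    using T by (auto simp: image_iff divide_le_eq intro!: bexI[of _ "_ * T"])
  have dp: "(p has_vector_derivative p' s) (at s within {0..T})" if "s \<in> {0..T}" for s
  proof -
    have 1: "((\<lambda>s. s / T) has_vector_derivative 1 / T) (at s within {0..T})"
      using T by (auto intro!: derivative_eq_intros)
    have 2: "(q has_vector_derivative q' (s / T)) (at (s / T) within (\<lambda>s. s / T) ` {0..T})"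
      unfolding im by (rule q(1)[OF sT[OF that]])
    show ?thesis using vector_diff_chain_within[OF 1 2] unfolding p_def[abs_def] p'_def o_def .
  qed
  have cT: "continuous_on {0..T} (\<lambda>s. s / T)" using T by (intro continuous_intros) auto
  have cp': "continuous_on {0..T} p'"
    unfolding p'_def using im
    by (intro continuous_intros continuous_on_compose2[OF q(2) cT]) auto
  have cp: "continuous_on {0..T} p"
    unfolding continuous_on_eq_continuous_within
    by (intro ballI has_vector_derivative_continuous[OF dp])
  have p_in: "p s \<in> snd \<kappa> ` fst \<kappa>" if "s \<in> {0..T}" for s
    unfolding p_def by (rule q(3)[OF sT[OF that]])
  have \<gamma>_in: "\<gamma> s \<in> fst \<kappa>" and p_eq: "snd \<kappa> (\<gamma> s) = p s" if "s \<in> {0..T}" for s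
    unfolding \<gamma>_def using charts(6,7)[OF \<kappa> p_in[OF that]] by auto
  have c\<gamma>: "continuous_on {0..T} \<gamma>"
    unfolding \<gamma>_def by (rule continuous_on_compose2[OF charts(4)[OF \<kappa>] cp]) (use p_in in auto)
  have d\<kappa>: "((snd \<kappa> \<circ> \<gamma>) has_vector_derivative p' s) (at s within {0..T})" if "s \<in> {0..T}" for s
    by (rule has_vector_derivative_transform[OF that _ dp[OF that]]) (simp add: p_eq)
  have C1: "C1_curve_on A {0..T} \<gamma>"
    unfolding C1_curve_on_def
  proof (intro conjI ballI c\<gamma>)
    fix \<kappa>' assume \<kappa>': "\<kappa>' \<in> A"
    let ?N = "{s \<in> {0..T}. \<gamma> s \<in> fst \<kappa>'}"
    show "\<exists>w. continuous_on ?N w \<and> (\<forall>s\<in>{0..T}. \<gamma> s \<in> fst \<kappa>' \<longrightarrow>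
        ((snd \<kappa>' \<circ> \<gamma>) has_vector_derivative w s) (at s within {0..T}))"
    \<comment> \<open>Being C^1 is demanded in every chart of the atlas: the velocity in another
      chart is the derivative of the transition map applied to \<open>p'\<close>, continuous because
      the transition map is smooth.\<close>
    proof (intro exI[of _ "\<lambda>s. change_coords \<kappa> \<kappa>' (\<gamma> s) (p' s)"] conjI ballI impI)
      have "continuous_on ?N (\<lambda>s. frechet_derivative (snd \<kappa>' \<circ> chart_inv \<kappa>) (at (p s)) (p' s))"
      proof (rule Ck_on_frechet_derivative_continuous[OF transition_smooth[OF \<kappa> \<kappa>', of "Suc 0"]])
        show "continuous_on ?N p" "continuous_on ?N p'"
          by (rule continuous_on_subset[OF cp] continuous_on_subset[OF cp']; blast)+
        show "p ` ?N \<subseteq> overlap \<kappa> \<kappa>'"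
        proof (rule image_subsetI)
          fix s assume "s \<in> ?N"
          then have "s \<in> {0..T}" "\<gamma> s \<in> fst \<kappa>'" by blast+
          then show "p s \<in> overlap \<kappa> \<kappa>'"
            unfolding overlap_def using \<gamma>_in[of s] p_eq[of s, symmetric] by blast
        qed
      qed
      then show "continuous_on ?N (\<lambda>s. change_coords \<kappa> \<kappa>' (\<gamma> s) (p' s))"
        by (rule continuous_on_eq) (simp add: change_coords_def p_eq)
      fix s assume s: "s \<in> {0..T}" "\<gamma> s \<in> fst \<kappa>'"
      show "((snd \<kappa>' \<circ> \<gamma>) has_vector_derivative change_coords \<kappa> \<kappa>' (\<gamma> s) (p' s)) (at s within {0..T})"
        by (rule has_vector_derivative_change_chart[OF \<kappa> \<kappa>' \<gamma>_in[OF s(1)] s(2,1) c\<gamma> d\<kappa>[OF s(1)]])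
    qed
  qed
  have pw: "piecewise_C1_path A T \<gamma>"
    unfolding piecewise_C1_path_def
  proof (intro exI[of _ "{0, T}"] conjI ballI impI)
    fix a b assume "a \<in> {0, T}" "b \<in> {0, T}" "a < b \<and> {0, T} \<inter> {a<..<b} = {}"
    then have "a = 0" "b = T" using T by auto
    then show "C1_curve_on A {a..b} \<gamma>" using C1 by simp
  qed (use T in auto)
  have conn: "connects T (chart_inv \<kappa> (q 0)) (chart_inv \<kappa> (q 1)) \<gamma>"
    using pw T by (simp add: connects_def \<gamma>_def p_def)
  have "energy \<gamma> s \<le> C * l\<^sup>2 / (2 * T\<^sup>2) + B" if s: "s \<in> {0..T} - {0, T}" for s
  proof -
    have s': "s \<in> {0<..<T}" "s \<in> {0..T}" using s by auto
    have "at s within {0..T} = at s" using s' by (intro at_within_Icc_at) auto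
    then have "((snd \<kappa> \<circ> \<gamma>) has_vector_derivative p' s) (at s)" using d\<kappa>[OF s'(2)] by simp
    moreover have "continuous_on {0<..<T} \<gamma>" by (rule continuous_on_subset[OF c\<gamma>]) auto
    ultimately have "energy \<gamma> s = metric_in_chart \<kappa> (p s) (p' s) (p' s) / 2 + U (\<gamma> s)"
      using energy_in_chart[where J = "{0<..<T}" and \<gamma> = \<gamma> and s = s, OF \<kappa> \<gamma>_in[OF s'(2)] _ s'(1)]
        p_eq[OF s'(2)] by simp
    also have "metric_in_chart \<kappa> (p s) (p' s) (p' s) \<le> C * (norm (p' s))\<^sup>2"
      unfolding p_def by (rule C(1)[OF sT[OF s'(2)]])
    also have "\<dots> \<le> C * (l / T)\<^sup>2"
      using l[OF sT[OF s'(2)]] T C(2) unfolding p'_def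
      by (intro mult_left_mono power_mono) (auto simp: divide_right_mono)
    also have "U (\<gamma> s) \<le> B" unfolding \<gamma>_def p_def by (rule B[OF sT[OF s'(2)]])
    finally show ?thesis by (simp add: power_divide)
  qed
  then have "action \<gamma> T \<le> (C * l\<^sup>2 / (2 * T\<^sup>2) + B) * (T - 0)"
    unfolding action_def
    using piecewise_C1_path_energy_integrable[OF pw T] T
    by (intro integral_le_except_finite[where S = "{0, T}"]) auto
  also have "\<dots> = C * l\<^sup>2 / (2 * T) + B * T"
    using T by (simp add: field_simps power2_eq_square)
  finally show ?thesis using conn by blast
qed

text \<open>Serves only to join nearby points, so the bound on the action and the time 1 are
  immaterial.\<close>

lemma chart_segment:
  assumes \<kappa>: "\<kappa> \<in> A" and seg: "closed_segment a b \<subseteq> snd \<kappa> ` fst \<kappa>"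
  shows "\<exists>\<gamma>. connects 1 (chart_inv \<kappa> a) (chart_inv \<kappa> b) \<gamma>"
proof -
  obtain C where C: "C > 0" "\<And>y v. y \<in> closed_segment a b \<Longrightarrow> metric_in_chart \<kappa> y v v \<le> C * (norm v)\<^sup>2"
    by (rule metric_in_chart_upper_bound[OF \<kappa> compact_segment seg]) (rule that)
  have "compact ((\<lambda>y. U (chart_inv \<kappa> y)) ` closed_segment a b)"
    by (intro compact_continuous_image compact_segment
        continuous_on_compose2[OF continuous_potential continuous_on_subset[OF charts(4)[OF \<kappa>] seg]]) auto
  then have "bounded ((\<lambda>y. U (chart_inv \<kappa> y)) ` closed_segment a b)" by (rule compact_imp_bounded)
  then obtain B where B: "\<And>y. y \<in> closed_segment a b \<Longrightarrow> \<bar>U (chart_inv \<kappa> y)\<bar> \<le> B"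
    unfolding bounded_iff by auto
  define q where "q s = a + s *\<^sub>R (b - a)" for s :: real
  have q_in: "q s \<in> closed_segment a b" if "s \<in> {0..1}" for s
    using that unfolding q_def closed_segment_def
    by (auto intro!: exI[of _ s] simp: algebra_simps)
  have "\<exists>\<gamma>. connects 1 (chart_inv \<kappa> (q 0)) (chart_inv \<kappa> (q 1)) \<gamma> \<and>
    action \<gamma> 1 \<le> C * (norm (b - a))\<^sup>2 / (2 * 1) + B * 1"
  proof (rule chart_path_action[OF \<kappa>, where q' = "\<lambda>_. b - a"])
    fix s :: real assume s: "s \<in> {0..1}"
    show "(q has_vector_derivative b - a) (at s within {0..1})"
      unfolding q_def by (auto intro!: derivative_eq_intros)
    show "q s \<in> snd \<kappa> ` fst \<kappa>" using q_in[OF s] seg by blast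
    show "metric_in_chart \<kappa> (q s) v v \<le> C * (norm v)\<^sup>2" for v by (rule C(2)[OF q_in[OF s]])
    show "U (chart_inv \<kappa> (q s)) \<le> B" using B[OF q_in[OF s]] by linarith
  qed (use C in auto)
  then show ?thesis by (auto simp: q_def)
qed

section \<open>Joining arbitrary points\<close>

lemma connects_trans:
  assumes "\<exists>t \<gamma>. connects t x y \<gamma>" "\<exists>t \<gamma>. connects t y z \<gamma>"
  shows "\<exists>t \<gamma>. connects t x z \<gamma>"
  using assms action_concat by metis

text \<open>Points near \<open>a\<close> are joined to it by segments in a chart, and connectedness
  extends this to the whole manifold. The relation contains both directions so that it is symmetric
  without reversing paths.\<close>

lemma connects_ex: "\<exists>t \<gamma>. connects t x y \<gamma>"
proof -
  define R where "R a b \<longleftrightarrow> (\<exists>t \<gamma>. connects t a b \<gamma>) \<and> (\<exists>t \<gamma>. connects t b a \<gamma>)" for a b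
  have "R x y"
  proof (rule connected_equivalence_relation[where R = R and S = UNIV])
    show "connected (UNIV :: 'm set)" using manifold by (simp add: compact_connected_manifold_def)
    show "R b a" if "R a b" for a b using that unfolding R_def by blast
    show "R a c" if "R a b" "R b c" for a b c
      using that connects_trans unfolding R_def by meson
    fix a
    define \<kappa> where "\<kappa> = chart_at A a"
    have \<kappa>: "\<kappa> \<in> A" "a \<in> fst \<kappa>" unfolding \<kappa>_def by (rule chart_at)+
    obtain r where r: "r > 0" "ball (snd \<kappa> a) r \<subseteq> snd \<kappa> ` fst \<kappa>"
      using charts(2)[OF \<kappa>(1)] \<kappa>(2) by (metis imageI open_contains_ball)
    let ?V = "fst \<kappa> \<inter> snd \<kappa> -` ball (snd \<kappa> a) r"
    have "open ?V" by (rule continuous_open_preimage[OF charts(3,1)[OF \<kappa>(1)] open_ball])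
    moreover have "a \<in> ?V" using \<kappa> r by simp
    moreover have "R a b" if b: "b \<in> ?V" for b
    proof -
      have seg: "closed_segment (snd \<kappa> a) (snd \<kappa> b) \<subseteq> snd \<kappa> ` fst \<kappa>"
        using b r by (intro order_trans[OF closed_segment_subset r(2)]) auto
      have inv: "chart_inv \<kappa> (snd \<kappa> a) = a" "chart_inv \<kappa> (snd \<kappa> b) = b"
        using charts(5)[OF \<kappa>(1)] \<kappa>(2) b by auto
      show ?thesis unfolding R_def
        using chart_segment[OF \<kappa>(1) seg] chart_segment[OF \<kappa>(1), of "snd \<kappa> b" "snd \<kappa> a"] seg inv
        by (metis closed_segment_commute)
    qed
    ultimately show "\<exists>T. openin (top_of_set UNIV) T \<and> a \<in> T \<and> (\<forall>x\<in>T. R a x)"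
      by (intro exI[of _ ?V] conjI ballI) auto
  qed auto
  then show ?thesis by (simp add: R_def)
qed

section \<open>The excess of the action over the minimum of the potential\<close>

lemma compact_UNIV: "compact (UNIV :: 'm set)"
  using manifold by (simp add: compact_connected_manifold_def)

definition umin :: real where "umin = (INF x. U x)"

lemma umin: "umin \<le> U x" "\<exists>x. U x = umin"
proof -
  obtain x0 where x0: "\<And>x. U x0 \<le> U x"
    using continuous_attains_inf[OF compact_UNIV _ continuous_potential] by auto
  have "umin = U x0" unfolding umin_def by (rule cInf_eq_minimum) (use x0 in auto)
  then show "umin \<le> U x" "\<exists>x. U x = umin" using x0 by auto
qed

lemma action_ge:
  assumes "connects t x y \<gamma>"
  shows "umin * t \<le> action \<gamma> t"
proof -
  have "energy \<gamma> integrable_on {0..t}" "0 \<le> t"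
    using assms piecewise_C1_path_energy_integrable by (simp_all add: connects_def)
  then have "umin * (t - 0) \<le> action \<gamma> t"
    unfolding action_def
    by (rule integral_ge_except_finite[OF _ _ finite.emptyI])
      (rule order_trans[OF umin(1) energy_ge])
  then show ?thesis by simp
qed

text \<open>Mane's potential of L - min U, the infimum being over all positive times. It is
  real-valued, which spares extended reals in the estimates, and it equals the Peierls barrier when
  \<alpha>(0) = - min U and the first point is a minimum.\<close>

definition excess :: "'m \<Rightarrow> 'm \<Rightarrow> real" where
  "excess x y = Inf {action \<gamma> t - umin * t |t \<gamma>. connects t x y \<gamma>}"

lemma excess_le: "connects t x y \<gamma> \<Longrightarrow> excess x y \<le> action \<gamma> t - umin * t"
  unfolding excess_def
  by (rule cInf_lower) (auto intro!: bdd_belowI[of _ 0] simp: action_ge)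

text \<open>Relies on the existence of some path, since an infimum of reals is a greatest lower
  bound only for a nonempty set.\<close>

lemma excess_greatest:
  assumes "\<And>t \<gamma>. connects t x y \<gamma> \<Longrightarrow> c \<le> action \<gamma> t - umin * t"
  shows "c \<le> excess x y"
  unfolding excess_def
  by (rule cInf_greatest) (use connects_ex[of x y] assms in auto)

lemma excess_nonneg: "0 \<le> excess x y"
  by (rule excess_greatest) (simp add: action_ge)

lemma excess_triangle: "excess x z \<le> excess x y + excess y z"
proof -
  have "excess x z - excess y z \<le> excess x y"
  proof (rule excess_greatest)
    fix t1 \<gamma>1 assume 1: "connects t1 x y \<gamma>1"
    have "excess x z - (action \<gamma>1 t1 - umin * t1) \<le> excess y z"
    proof (rule excess_greatest)
      fix t2 \<gamma>2 assume "connects t2 y z \<gamma>2"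
      from action_concat[OF 1 this] obtain \<gamma> where
        "connects (t1 + t2) x z \<gamma>" "action \<gamma> (t1 + t2) = action \<gamma>1 t1 + action \<gamma>2 t2" by blast
      with excess_le[of "t1 + t2" x z \<gamma>]
      show "excess x z - (action \<gamma>1 t1 - umin * t1) \<le> action \<gamma>2 t2 - umin * t2"
        by (simp add: algebra_simps)
    qed
    then show "excess x z - excess y z \<le> action \<gamma>1 t1 - umin * t1" by simp
  qed
  then show ?thesis by simp
qed

text \<open>The curve is traversed in the time that balances the kinetic and the
  potential part of the action.\<close>

lemma excess_chart_estimate:
  assumes \<kappa>: "\<kappa> \<in> A" and l: "l > 0" and \<sigma>: "\<sigma> > 0"
    and q: "\<And>s. s \<in> {0..1} \<Longrightarrow> (q has_vector_derivative q' s) (at s within {0..1})"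
      "continuous_on {0..1} q'" "\<And>s. s \<in> {0..1} \<Longrightarrow> q s \<in> snd \<kappa> ` fst \<kappa>"
    and C: "\<And>s v. s \<in> {0..1} \<Longrightarrow> metric_in_chart \<kappa> (q s) v v \<le> C * (norm v)\<^sup>2" "C \<ge> 0"
    and q': "\<And>s. s \<in> {0..1} \<Longrightarrow> norm (q' s) \<le> l"
    and u: "\<And>s. s \<in> {0..1} \<Longrightarrow> U (chart_inv \<kappa> (q s)) - umin \<le> \<sigma>"
  shows "excess (chart_inv \<kappa> (q 0)) (chart_inv \<kappa> (q 1)) \<le> (C / 2 + 1) * l * sqrt \<sigma>"
proof -
  \<comment> \<open>This minimises C l^2 / (2 T) + \<sigma> T up to a factor depending on C only,
    and makes both terms multiples of l sqrt \<sigma>.\<close>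
  define T where "T = l / sqrt \<sigma>"
  have T: "T > 0" using l \<sigma> by (simp add: T_def)
  obtain \<gamma> where \<gamma>: "connects T (chart_inv \<kappa> (q 0)) (chart_inv \<kappa> (q 1)) \<gamma>"
    "action \<gamma> T \<le> C * l\<^sup>2 / (2 * T) + (umin + \<sigma>) * T"
    using chart_path_action[OF \<kappa> T q C q', of "umin + \<sigma>"] u by (auto simp: algebra_simps)
  have "excess (chart_inv \<kappa> (q 0)) (chart_inv \<kappa> (q 1)) \<le> C * l\<^sup>2 / (2 * T) + \<sigma> * T"
    using excess_le[OF \<gamma>(1)] \<gamma>(2) by (simp add: algebra_simps)
  also have "\<sigma> * T = \<sigma> / sqrt \<sigma> * l" unfolding T_def by simp
  also have "\<sigma> / sqrt \<sigma> * l = l * sqrt \<sigma>" using \<sigma> by (simp add: real_div_sqrt)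
  also have "C * l\<^sup>2 / (2 * T) = C / 2 * l * sqrt \<sigma>"
    unfolding T_def using \<sigma> l by (simp add: field_simps power2_eq_square)
  finally show ?thesis by (simp add: algebra_simps)
qed

section \<open>The cost of paths starting off the minima\<close>

lemma change_coords_inject:
  assumes \<kappa>: "\<kappa> \<in> A" "\<kappa>' \<in> A" "x \<in> fst \<kappa>" "x \<in> fst \<kappa>'" and v: "change_coords \<kappa> \<kappa>' x v = 0"
  shows "v = 0"
proof -
  let ?t = "snd \<kappa>' \<circ> chart_inv \<kappa>" and ?t' = "snd \<kappa> \<circ> chart_inv \<kappa>'"
  have tx: "?t (snd \<kappa> x) = snd \<kappa>' x" using charts(5)[OF \<kappa>(1,3)] by simp
  have d: "((\<lambda>y. ?t' (?t y)) has_derivative (\<lambda>v. change_coords \<kappa>' \<kappa> x (change_coords \<kappa> \<kappa>' x v)))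
      (at (snd \<kappa> x))"
    by (rule has_derivative_compose[OF transition_has_derivative[OF \<kappa>]])
      (unfold tx, rule transition_has_derivative[OF \<kappa>(2,1,4,3)])
  \<comment> \<open>The two transition maps are inverse to each other on the overlap, so by the
    chain rule the derivative of one is a left inverse of that of the other.\<close>
  have "?t' (?t y) = y" if "y \<in> overlap \<kappa> \<kappa>'" for y
    using that charts(5)[OF \<kappa>(1)] charts(5)[OF \<kappa>(2)] unfolding overlap_def by auto
  moreover have "snd \<kappa> x \<in> overlap \<kappa> \<kappa>'" using \<kappa> by (auto simp: overlap_def)
  ultimately have "((\<lambda>y. y) has_derivative (\<lambda>v. change_coords \<kappa>' \<kappa> x (change_coords \<kappa> \<kappa>' x v)))
      (at (snd \<kappa> x))"
    by (intro has_derivative_transform_within_open[OF d open_overlap[OF \<kappa>(1,2)]])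
  from fun_cong[OF has_derivative_unique[OF this has_derivative_ident], of v]
  have "v = change_coords \<kappa>' \<kappa> x 0" using v by simp
  then show ?thesis using linear_0[OF linear_change_coords[OF \<kappa>(2,1,4,3)]] by simp
qed

lemma metric_in_chart_pos:
  assumes \<kappa>: "\<kappa> \<in> A" and y: "y \<in> snd \<kappa> ` fst \<kappa>" and v: "v \<noteq> 0"
  shows "metric_in_chart \<kappa> y v v > 0"
  unfolding metric_in_chart_def Let_def
  using change_coords_inject[OF \<kappa> chart_at(1) charts(7)[OF \<kappa> y] chart_at(2)] v
  by (intro metric_pos) blast

text \<open>The minimum over the compact product of \<open>K\<close> with the unit sphere is
  positive because the metric is definite at each point; homogeneity of degree two extends the bound
  to all vectors.\<close>

lemma metric_in_chart_lower_bound: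
  assumes \<kappa>: "\<kappa> \<in> A" and K: "compact K" "K \<subseteq> snd \<kappa> ` fst \<kappa>"
  obtains c where "c > 0" "\<And>y v. y \<in> K \<Longrightarrow> c * (norm v)\<^sup>2 \<le> metric_in_chart \<kappa> y v v"
proof (cases "K = {}")
  case True
  then show ?thesis by (intro that[of 1]) auto
next
  case False
  let ?S = "sphere (0::'e) 1"
  have "?S \<noteq> {}" by simp
  then have ne: "K \<times> ?S \<noteq> {}" using False by simp
  have "continuous_on (K \<times> ?S) (\<lambda>z. metric_in_chart \<kappa> (fst z) (snd z) (snd z))"
    by (intro metric_in_chart_continuous_on[OF \<kappa>] continuous_intros) (use K in auto)
  from continuous_attains_inf[OF compact_Times[OF K(1) compact_sphere] ne this]
  obtain z where z: "z \<in> K \<times> ?S"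
    "\<forall>z'\<in>K \<times> ?S. metric_in_chart \<kappa> (fst z) (snd z) (snd z) \<le> metric_in_chart \<kappa> (fst z') (snd z') (snd z')"
    by (elim bexE)
  define c where "c = metric_in_chart \<kappa> (fst z) (snd z) (snd z)"
  have "c > 0" unfolding c_def
    using z(1) K(2) by (intro metric_in_chart_pos[OF \<kappa>]) auto
  moreover have "c * (norm v)\<^sup>2 \<le> metric_in_chart \<kappa> y v v" if y: "y \<in> K" for y v
  proof (cases "v = 0")
    case True
    then show ?thesis by (simp add: metric_in_chart_nonneg)
  next
    case False
    let ?w = "v /\<^sub>R norm v"
    have b: "bilinear (metric_in_chart \<kappa> y)" using metric_in_chart_bilinear[OF \<kappa>] y K by blast
    have "c \<le> metric_in_chart \<kappa> y ?w ?w"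
      unfolding c_def using bspec[OF z(2), of "(y, ?w)"] y False by simp
    then have "c * (norm v)\<^sup>2 \<le> metric_in_chart \<kappa> y ?w ?w * (norm v)\<^sup>2"
      by (intro mult_right_mono) auto
    also have "\<dots> = metric_in_chart \<kappa> y (norm v *\<^sub>R ?w) (norm v *\<^sub>R ?w)"
      unfolding bilinear_lmul[OF b] bilinear_rmul[OF b] by (simp add: power2_eq_square)
    also have "norm v *\<^sub>R ?w = v" using False by simp
    finally show ?thesis .
  qed
  ultimately show ?thesis by (rule that)
qed

text \<open>L - min U is nonnegative, so cutting off the end of a path can only lower the integral.
  Estimates near the starting point therefore bound the whole path.\<close>

lemma action_initial_part_le:
  assumes c: "connects t x y \<gamma>" and "0 \<le> \<tau>" "\<tau> \<le> t"
  shows "energy \<gamma> integrable_on {0..\<tau>}"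
    "integral {0..\<tau>} (\<lambda>s. energy \<gamma> s - umin) \<le> action \<gamma> t - umin * t"
proof -
  have t: "t > 0" and i: "energy \<gamma> integrable_on {0..t}"
    using c piecewise_C1_path_energy_integrable by (simp_all add: connects_def)
  show i': "energy \<gamma> integrable_on {0..\<tau>}"
    by (rule integrable_on_subinterval[OF i]) (use assms in auto)
  have "integral {0..\<tau>} (\<lambda>s. energy \<gamma> s - umin) \<le> integral {0..t} (\<lambda>s. energy \<gamma> s - umin)"
    using assms i i' order_trans[OF umin(1) energy_ge]
    by (intro integral_subset_le integrable_diff) auto
  also have "\<dots> = action \<gamma> t - umin * t"
    unfolding action_def
    using Henstock_Kurzweil_Integration.integral_diff[OF i integrable_const_ivl[of umin]] t
    by (simp add: mult.commute)
  finally show "integral {0..\<tau>} (\<lambda>s. energy \<gamma> s - umin) \<le> action \<gamma> t - umin * t" .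
qed

text \<open>This rests on \<open>c a\<^sup>2 / 2 + \<epsilon> \<ge> sqrt (2 c \<epsilon>) a\<close> with the speed in the chart as \<open>a\<close>.\<close>

lemma length_le_excess:
  assumes conn: "connects t x y \<gamma>" and \<tau>: "0 \<le> \<tau>" "\<tau> \<le> t" and \<kappa>: "\<kappa> \<in> A"
    and stay: "\<And>s. s \<in> {0..\<tau>} \<Longrightarrow> \<gamma> s \<in> fst \<kappa>"
    and c: "c > 0" "\<And>s v. s \<in> {0..\<tau>} \<Longrightarrow> c * (norm v)\<^sup>2 \<le> metric_in_chart \<kappa> (snd \<kappa> (\<gamma> s)) v v"
    and \<epsilon>: "\<epsilon> > 0" "\<And>s. s \<in> {0..\<tau>} \<Longrightarrow> umin + \<epsilon> \<le> U (\<gamma> s)"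
  shows "sqrt (2 * c * \<epsilon>) * norm (snd \<kappa> (\<gamma> \<tau>) - snd \<kappa> (\<gamma> 0)) \<le> action \<gamma> t - umin * t"
proof -
  define k where "k = sqrt (2 * c * \<epsilon>)"
  have k: "k > 0" using c(1) \<epsilon>(1) by (simp add: k_def)
  have t: "t > 0" and pw: "piecewise_C1_path A t \<gamma>" using conn by (simp_all add: connects_def)
  obtain S where S: "finite S" "0 \<in> S" "t \<in> S"
    "\<And>a b. a \<in> S \<Longrightarrow> b \<in> S \<Longrightarrow> a < b \<Longrightarrow> S \<inter> {a<..<b} = {} \<Longrightarrow> C1_curve_on A {a..b} \<gamma>"
    by (rule piecewise_C1_pathE[OF pw]) (rule that)
  define q where "q = snd \<kappa> \<circ> \<gamma>"
  \<comment> \<open>With the value 0 at the exceptional times the bound on the norm holds at all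
    times, there simply because L \<ge> min U.\<close>
  define q' where "q' s = (if s \<in> {0<..<\<tau>} - S then vector_derivative q (at s) else 0)" for s
  have c\<gamma>: "continuous_on {0..\<tau>} \<gamma>"
    by (rule continuous_on_subset[OF piecewise_C1_path_continuous[OF pw t]]) (use \<tau> in auto)
  have cq: "continuous_on {0..\<tau>} q"
    unfolding q_def by (rule continuous_on_compose[OF c\<gamma> continuous_on_subset[OF charts(3)[OF \<kappa>]]])
      (use stay in auto)
  have der: "(q has_vector_derivative q' s) (at s)" "k * norm (q' s) \<le> energy \<gamma> s - umin"
    if s: "s \<in> {0<..<\<tau>} - S" for s
  proof -
    have s0: "0 < s" "s < t" "s \<notin> S" "s \<in> {0..\<tau>}" using s \<tau> by auto
    obtain a b where ab: "a \<in> S" "b \<in> S" "a < s" "s < b" "S \<inter> {a<..<b} = {}"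
      by (rule consecutive_around[OF S(1-3) s0(1-3)]) (rule that)
    have C1: "C1_curve_on A {a..b} \<gamma>" using ab by (intro S(4)) auto
    have sab: "s \<in> {a..b}" "s \<in> {a<..<b}" using ab by auto
    obtain w where w: "\<forall>s\<in>{a..b}. \<gamma> s \<in> fst \<kappa> \<longrightarrow>
        ((snd \<kappa> \<circ> \<gamma>) has_vector_derivative w s) (at s within {a..b})"
      using C1_curve_onD(2)[OF C1 \<kappa>] by (elim exE conjE)
    have "at s within {a..b} = at s" using ab by (intro at_within_Icc_at) auto
    with mp[OF bspec[OF w sab(1)] stay[OF s0(4)]]
    have d: "((snd \<kappa> \<circ> \<gamma>) has_vector_derivative w s) (at s)" by simp
    then have q': "q' s = w s" using s unfolding q'_def q_def by (simp add: vector_derivative_at)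
    show "(q has_vector_derivative q' s) (at s)" unfolding q' q_def by (rule d)
    have "continuous_on {a<..<b} \<gamma>"
      by (rule continuous_on_subset[OF C1_curve_onD(1)[OF C1]]) auto
    from energy_in_chart[where J = "{a<..<b}" and \<gamma> = \<gamma> and s = s, OF \<kappa> stay[OF s0(4)] _ sab(2) this d]
    have "energy \<gamma> s = metric_in_chart \<kappa> (snd \<kappa> (\<gamma> s)) (q' s) (q' s) / 2 + U (\<gamma> s)"
      unfolding q' by simp
    moreover have "k * norm (q' s) \<le> c * (norm (q' s))\<^sup>2 / 2 + \<epsilon>"
    proof -
      have "0 \<le> (sqrt (c / 2) * norm (q' s) - sqrt \<epsilon>)\<^sup>2" by simp
      also have "\<dots> = c * (norm (q' s))\<^sup>2 / 2 + \<epsilon> - 2 * (sqrt (c / 2) * sqrt \<epsilon>) * norm (q' s)"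
        using c(1) \<epsilon>(1) by (simp add: power2_diff power_mult_distrib algebra_simps)
      also have "2 * (sqrt (c / 2) * sqrt \<epsilon>) = sqrt (4 * (c / 2 * \<epsilon>))"
        by (simp only: real_sqrt_mult real_sqrt_four)
      also have "\<dots> = k" unfolding k_def by simp
      finally show ?thesis by simp
    qed
    ultimately show "k * norm (q' s) \<le> energy \<gamma> s - umin"
      using c(2)[OF s0(4), of "q' s"] \<epsilon>(2)[OF s0(4)] by linarith
  qed
  have "(q' has_integral q \<tau> - q 0) {0..\<tau>}"
    by (rule fundamental_theorem_of_calculus_interior_strong[OF S(1) \<tau>(1) der(1) cq])
  then have qi: "q' integrable_on {0..\<tau>}" "integral {0..\<tau>} q' = q \<tau> - q 0"
    by (auto simp: integral_unique)
  have "norm (integral {0..\<tau>} (\<lambda>s. k *\<^sub>R q' s)) \<le> integral {0..\<tau>} (\<lambda>s. energy \<gamma> s - umin)"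
  proof (rule integral_norm_bound_integral)
    show "(\<lambda>s. k *\<^sub>R q' s) integrable_on {0..\<tau>}" using qi(1) by (rule integrable_cmul)
    show "(\<lambda>s. energy \<gamma> s - umin) integrable_on {0..\<tau>}"
      using action_initial_part_le(1)[OF conn \<tau>] by (intro integrable_diff) auto
    fix s assume "s \<in> {0..\<tau>}"
    show "norm (k *\<^sub>R q' s) \<le> energy \<gamma> s - umin"
    proof (cases "s \<in> {0<..<\<tau>} - S")
      case True
      then show ?thesis using der(2) k by simp
    next
      case False
      then have "q' s = 0" unfolding q'_def by (rule if_not_P)
      then show ?thesis using order_trans[OF umin(1) energy_ge, of \<gamma> s] by simp
    qed
  qed
  then show ?thesis using action_initial_part_le(2)[OF conn \<tau>] k qi
    by (simp add: q_def k_def)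
qed

text \<open>During the first unit of time a path from x either stays in a neighbourhood where U
  exceeds its minimum by \<epsilon>, at a cost of at least \<epsilon>, or has to cross part of this
  neighbourhood, at a cost proportional to its radius by \<open>length_le_excess\<close>. The
  condition t \<ge> 1 excludes short paths, whose cost can be arbitrarily small.\<close>

lemma excess_loop_pos:
  assumes x: "U x > umin"
  obtains c where "c > 0" "\<And>t y \<gamma>. connects t x y \<gamma> \<Longrightarrow> t \<ge> 1 \<Longrightarrow> c \<le> action \<gamma> t - umin * t"
proof -
  define \<kappa> where "\<kappa> = chart_at A x"
  have \<kappa>: "\<kappa> \<in> A" "x \<in> fst \<kappa>" unfolding \<kappa>_def by (rule chart_at)+
  define \<epsilon> where "\<epsilon> = (U x - umin) / 2"
  have \<epsilon>: "\<epsilon> > 0" "U x > umin + \<epsilon>" using x by (auto simp: \<epsilon>_def field_simps)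
  have cU: "continuous_on (snd \<kappa> ` fst \<kappa>) (\<lambda>y. U (chart_inv \<kappa> y))"
    by (rule continuous_on_compose2[OF continuous_potential charts(4)[OF \<kappa>(1)]]) auto
  let ?Y = "snd \<kappa> ` fst \<kappa> \<inter> (\<lambda>y. U (chart_inv \<kappa> y)) -` {umin + \<epsilon><..}"
  have "open ?Y" by (rule continuous_open_preimage[OF cU charts(2)[OF \<kappa>(1)]]) auto
  moreover have "snd \<kappa> x \<in> ?Y" using \<kappa> \<epsilon> charts(5)[OF \<kappa>] by auto
  ultimately obtain r where r: "r > 0" "cball (snd \<kappa> x) r \<subseteq> ?Y" by (metis open_contains_cball)
  have rY: "cball (snd \<kappa> x) r \<subseteq> snd \<kappa> ` fst \<kappa>" using r by blast
  obtain c where c: "c > 0" "\<And>y v. y \<in> cball (snd \<kappa> x) r \<Longrightarrow> c * (norm v)\<^sup>2 \<le> metric_in_chart \<kappa> y v v"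
    by (rule metric_in_chart_lower_bound[OF \<kappa>(1) compact_cball rY]) (rule that)
  define k where "k = sqrt (2 * c * \<epsilon>)"
  have k: "k > 0" using c(1) \<epsilon>(1) by (simp add: k_def)
  \<comment> \<open>The first bound is for paths staying near x for a unit of time, the second for
    paths that move by r / 2 in the chart. A path violating both is shown to stay near x, which
    contradicts the first.\<close>
  have main: "min \<epsilon> (k * r / 2) \<le> action \<gamma> t - umin * t"
    if conn: "connects t x y \<gamma>" and t1: "t \<ge> 1" for t y \<gamma>
  proof (rule ccontr)
    assume "\<not> min \<epsilon> (k * r / 2) \<le> action \<gamma> t - umin * t"
    then have small: "action \<gamma> t - umin * t < \<epsilon>" "action \<gamma> t - umin * t < k * r / 2" by auto
    have \<gamma>0: "\<gamma> 0 = x" and pw: "piecewise_C1_path A t \<gamma>" and t: "t > 0"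
      using conn by (auto simp: connects_def)
    let ?W = "chart_inv \<kappa> ` cball (snd \<kappa> x) (r / 2)"
    let ?V = "fst \<kappa> \<inter> snd \<kappa> -` ball (snd \<kappa> x) r"
    have c\<gamma>: "continuous_on {0..1} \<gamma>"
      by (rule continuous_on_subset[OF piecewise_C1_path_continuous[OF pw t]]) (use t1 in auto)
    have in_W: "p \<in> fst \<kappa>" "snd \<kappa> p \<in> cball (snd \<kappa> x) (r / 2)" if "p \<in> ?W" for p
    proof -
      from that obtain z where z: "p = chart_inv \<kappa> z" "z \<in> cball (snd \<kappa> x) (r / 2)" by (rule imageE)
      then have "z \<in> snd \<kappa> ` fst \<kappa>" using rY r(1) by auto
      then show "p \<in> fst \<kappa>" "snd \<kappa> p \<in> cball (snd \<kappa> x) (r / 2)"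
        using z charts(6,7)[OF \<kappa>(1)] by auto
    qed
    have W_iff: "p \<in> ?W" if "p \<in> fst \<kappa>" "snd \<kappa> p \<in> cball (snd \<kappa> x) (r / 2)" for p
      using that charts(5)[OF \<kappa>(1) that(1)] by (metis imageI)
    have WV: "?W \<subseteq> ?V" using in_W r(1) by fastforce
    have ball_r: "snd \<kappa> p \<in> cball (snd \<kappa> x) r" if "p \<in> ?V" for p using that by auto
    have oV: "open ?V" by (rule continuous_open_preimage[OF charts(3,1)[OF \<kappa>(1)] open_ball])
    have "compact ?W"
      using rY r(1)
      by (intro compact_continuous_image continuous_on_subset[OF charts(4)[OF \<kappa>(1)]]) auto
    \<comment> \<open>Closedness in the whole manifold, for which the Hausdorff property is used;
      the image of a closed ball is a priori closed only in the chart domain.\<close>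
    then have cW: "closed ?W" by (rule compact_imp_closed)
    have short: "\<gamma> \<tau> \<in> ?W" if \<tau>: "\<tau> \<in> {0..1}" and stay: "\<And>s. s \<in> {0..\<tau>} \<Longrightarrow> \<gamma> s \<in> ?V" for \<tau>
    proof -
      have "k * norm (snd \<kappa> (\<gamma> \<tau>) - snd \<kappa> (\<gamma> 0)) \<le> action \<gamma> t - umin * t"
        unfolding k_def
      proof (rule length_le_excess[OF conn _ _ \<kappa>(1) _ c(1) _ \<epsilon>(1)])
        fix s assume s: "s \<in> {0..\<tau>}"
        show "\<gamma> s \<in> fst \<kappa>" using stay[OF s] by blast
        show "c * (norm v)\<^sup>2 \<le> metric_in_chart \<kappa> (snd \<kappa> (\<gamma> s)) v v" for v
          by (rule c(2)[OF ball_r[OF stay[OF s]]])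
        have "snd \<kappa> (\<gamma> s) \<in> ?Y" using r(2) ball_r[OF stay[OF s]] by blast
        then show "umin + \<epsilon> \<le> U (\<gamma> s)" using charts(5)[OF \<kappa>(1), of "\<gamma> s"] stay[OF s] by simp
      qed (use \<tau> t1 in auto)
      also have "\<dots> \<le> k * (r / 2)" using small by simp
      finally have "norm (snd \<kappa> (\<gamma> \<tau>) - snd \<kappa> x) \<le> r / 2" using k \<gamma>0 by simp
      moreover have "\<gamma> \<tau> \<in> fst \<kappa>" using stay[of \<tau>] \<tau> by simp
      ultimately show ?thesis by (intro W_iff) (simp_all add: dist_norm norm_minus_commute)
    qed
    \<comment> \<open>At the first time \<tau> outside the open set \<open>?V\<close>, the path is a
      limit of points in \<open>?W\<close> by \<open>short\<close>. As \<open>?W\<close> is closed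
      and contained in \<open>?V\<close>, the path has not left \<open>?V\<close> at \<tau>
      either.\<close>
    have all: "\<gamma> s \<in> ?V" if "s \<in> {0..1}" for s
    proof (rule ccontr)
      assume "\<gamma> s \<notin> ?V"
      let ?N = "{0..1} \<inter> \<gamma> -` (- ?V)"
      have "closed ?N"
        by (rule continuous_closed_preimage[OF c\<gamma> closed_atLeastAtMost closed_Compl[OF oV]])
      from compact_Int_closed[OF compact_Icc this, of 0 1]
      have cN: "compact ?N" by (simp only: Int_assoc[symmetric] Int_absorb)
      have sN: "s \<in> ?N" using that \<open>\<gamma> s \<notin> ?V\<close> by simp
      then have "?N \<noteq> {}" by (rule ex_in_conv[THEN iffD1, OF exI])
      from compact_attains_inf[OF cN this] obtain \<tau> where \<tau>: "\<tau> \<in> ?N" "\<forall>s\<in>?N. \<tau> \<le> s"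
        by (elim bexE)
      have "x \<in> ?V" using \<kappa> r by simp
      then have "\<tau> \<noteq> 0" using \<tau>(1) \<gamma>0 by auto
      then have \<tau>0: "\<tau> > 0" "\<tau> \<le> 1" using \<tau>(1) by auto
      have before: "\<gamma> s \<in> ?V" if s: "s \<in> {0..<\<tau>}" for s
      proof (rule ccontr)
        assume "\<gamma> s \<notin> ?V"
        then have "s \<in> ?N" using s \<tau>0 by simp
        from bspec[OF \<tau>(2) this] show False using s by simp
      qed
      let ?T = "{0..1} \<inter> \<gamma> -` ?W"
      have "{0..<\<tau>} \<subseteq> ?T"
      proof
        fix s assume s: "s \<in> {0..<\<tau>}"
        have "\<gamma> s \<in> ?W" by (rule short) (use s \<tau>0 before in auto)
        then show "s \<in> ?T" using s \<tau>0 by simp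
      qed
      moreover have "closed ?T" by (rule continuous_closed_preimage[OF c\<gamma> closed_atLeastAtMost cW])
      ultimately have "closure {0..<\<tau>} \<subseteq> ?T" by (rule closure_minimal)
      then have "\<tau> \<in> ?T" using \<tau>0 by (simp add: subset_iff)
      then show False using WV \<tau>(1) by blast
    qed
    have "\<epsilon> * (1 - 0) \<le> integral {0..1} (\<lambda>s. energy \<gamma> s - umin)"
    proof (rule integral_ge_except_finite[OF _ _ finite.emptyI])
      show "(\<lambda>s. energy \<gamma> s - umin) integrable_on {0..1}"
        using action_initial_part_le(1)[OF conn _ t1] by (intro integrable_diff) auto
      fix s :: real assume "s \<in> {0..1} - {}"
      then have s: "\<gamma> s \<in> ?V" using all by simp
      have "snd \<kappa> (\<gamma> s) \<in> ?Y" using r(2) ball_r[OF s] by blast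
      then have "umin + \<epsilon> \<le> U (\<gamma> s)" using charts(5)[OF \<kappa>(1), of "\<gamma> s"] s by simp
      then show "\<epsilon> \<le> energy \<gamma> s - umin" using energy_ge[of \<gamma> s] by simp
    qed simp
    then show False using action_initial_part_le(2)[OF conn _ t1] small(1) by simp
  qed
  show thesis by (rule that[OF _ main]) (use \<epsilon> k r in auto)
qed

end

section \<open>The quotient Aubry set\<close>

text \<open>For m \<ge> 0 the negative part vanishes. For m < 0 its integral is at most - m since
  the total mass is 1, so that no difference of infinities occurs.\<close>

lemma extended_integral_ge:
  assumes "prob_space \<mu>" "\<And>z. m \<le> f z"
  shows "ereal m \<le> extended_integral \<mu> f"
proof -
  interpret prob_space \<mu> by fact
  have const: "(\<integral>\<^sup>+ z. ennreal c \<partial>\<mu>) = ennreal c" for c by (simp add: emeasure_space_1)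
  show ?thesis
  proof (cases "m \<ge> 0")
    case True
    have neg: "ennreal (- f z) = 0" for z
      by (rule ennreal_neg) (use assms(2)[of z] True in linarith)
    have "(\<integral>\<^sup>+ z. ennreal m \<partial>\<mu>) \<le> (\<integral>\<^sup>+ z. ennreal (f z) \<partial>\<mu>)"
      by (intro nn_integral_mono ennreal_leI assms(2))
    then have "enn2ereal (ennreal m) \<le> enn2ereal (\<integral>\<^sup>+ z. ennreal (f z) \<partial>\<mu>)"
      unfolding const less_eq_ennreal.rep_eq .
    then show ?thesis using True by (simp add: extended_integral_def neg zero_ennreal.rep_eq)
  next
    case False
    have "(\<integral>\<^sup>+ z. ennreal (- f z) \<partial>\<mu>) \<le> (\<integral>\<^sup>+ z. ennreal (- m) \<partial>\<mu>)"
      by (intro nn_integral_mono ennreal_leI) (simp add: assms(2))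
    then have "enn2ereal (\<integral>\<^sup>+ z. ennreal (- f z) \<partial>\<mu>) \<le> enn2ereal (ennreal (- m))"
      unfolding const less_eq_ennreal.rep_eq .
    also have "\<dots> = ereal (- m)" using False by simp
    finally have "0 - ereal (- m) \<le> extended_integral \<mu> f"
      unfolding extended_integral_def by (intro ereal_minus_mono) auto
    then show ?thesis by simp
  qed
qed

section \<open>Mather's alpha function and the Peierls barrier\<close>

context mechanical_system
begin

abbreviation "zero_form \<equiv> (\<lambda>(x::'m) (v::'e). 0 :: real)"

lemma mather_alpha_le: "mather_alpha A L zero_form \<le> ereal (- umin)"
proof -
  have "ereal umin \<le> (INF \<mu>\<in>invariant_measures A L. extended_integral \<mu> (shifted_lagrangian L zero_form))"
  proof (rule INF_greatest)
    fix \<mu> assume "\<mu> \<in> invariant_measures A L"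
    then have "prob_space \<mu>" by (simp add: invariant_measures_def)
    moreover have "umin \<le> shifted_lagrangian L zero_form z" for z
      using order_trans[OF umin(1)[of "fst z"]]
      by (cases z) (simp add: shifted_lagrangian_def lagrangian metric_nonneg)
    ultimately show "ereal umin \<le> extended_integral \<mu> (shifted_lagrangian L zero_form)"
      by (rule extended_integral_ge)
  qed
  then have "mather_alpha A L zero_form \<le> - ereal umin"
    unfolding mather_alpha_def by (subst ereal_minus_le_minus)
  then show ?thesis by simp
qed

lemma min_action_eq:
  assumes "t > 0"
  shows "min_action A L zero_form t x y = (INF \<gamma>\<in>{\<gamma>. connects t x y \<gamma>}. ereal (action \<gamma> t))"
proof -
  have "(\<lambda>s. shifted_lagrangian L zero_form (\<gamma> s, velocity A \<gamma> s)) = energy \<gamma>" for \<gamma>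
    by (simp add: shifted_lagrangian_def energy_def fun_eq_iff)
  then show ?thesis
    unfolding min_action_def action_def connects_def using assms by simp
qed

lemma min_action_le:
  assumes "connects t x y \<gamma>"
  shows "min_action A L zero_form t x y \<le> ereal (action \<gamma> t)"
proof -
  have "t > 0" using assms by (simp add: connects_def)
  then show ?thesis unfolding min_action_eq[OF \<open>t > 0\<close>] by (rule_tac INF_lower) (simp add: assms)
qed

text \<open>The term \<alpha>(0) t cancels the minimal cost of a duration t, and as the lower limit
  is taken at infinity only long paths matter.\<close>

lemma barrier_ge:
  assumes \<alpha>: "mather_alpha A L zero_form = ereal (- umin)"
    and c: "\<And>t \<gamma>. connects t x y \<gamma> \<Longrightarrow> t \<ge> 1 \<Longrightarrow> c \<le> action \<gamma> t - umin * t"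
  shows "ereal c \<le> peierls_barrier A L zero_form x y"
  unfolding peierls_barrier_def \<alpha>
proof (rule Liminf_bounded)
  have "ereal c \<le> min_action A L zero_form t x y + ereal (- umin) * ereal t" if t: "t \<ge> 1" for t
  proof -
    have "ereal (c + umin * t) \<le> min_action A L zero_form t x y"
      unfolding min_action_eq[OF less_le_trans[OF zero_less_one t]]
      by (rule INF_greatest) (use c t in \<open>fastforce simp: algebra_simps\<close>)
    from add_right_mono[OF this, of "ereal (- umin) * ereal t"]
    show ?thesis by simp
  qed
  then show "\<forall>\<^sub>F t in at_top. ereal c \<le> min_action A L zero_form t x y + ereal (- umin) * ereal t"
    using eventually_ge_at_top[of 1] by (rule eventually_mono[rotated])
qed

lemma barrier_nonneg:
  assumes "mather_alpha A L zero_form = ereal (- umin)"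
  shows "0 \<le> peierls_barrier A L zero_form x y"
  using barrier_ge[OF assms, of x y 0] action_ge by (simp add: zero_ereal_def)

text \<open>Waiting at a minimum of \<open>U\<close> costs nothing, so that the lower limit is an infimum.\<close>

lemma barrier_eq_excess:
  assumes \<alpha>: "mather_alpha A L zero_form = ereal (- umin)" and x: "U x = umin"
  shows "peierls_barrier A L zero_form x y = ereal (excess x y)"
proof (rule antisym)
  show "ereal (excess x y) \<le> peierls_barrier A L zero_form x y"
    by (rule barrier_ge[OF \<alpha>]) (rule excess_le)
  show "peierls_barrier A L zero_form x y \<le> ereal (excess x y)"
  proof (rule ereal_le_epsilon2)
    fix e :: real assume e: "e > 0"
    have "\<exists>t0 \<gamma>0. connects t0 x y \<gamma>0 \<and> action \<gamma>0 t0 - umin * t0 < excess x y + e"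
    proof (rule ccontr)
      assume "\<not> ?thesis"
      then have "excess x y + e \<le> excess x y" by (intro excess_greatest) (meson not_le)
      then show False using e by simp
    qed
    then obtain t0 \<gamma>0 where 0: "connects t0 x y \<gamma>0" "action \<gamma>0 t0 - umin * t0 < excess x y + e"
      by (elim exE conjE)
    \<comment> \<open>A nearly optimal path of duration \<open>t0\<close> is preceded by resting at
      x for t - t0; the inequality is strict since \<open>connects\<close> asks for positive
      durations.\<close>
    have "min_action A L zero_form t x y + ereal (- umin) * ereal t \<le> ereal (excess x y + e)" if t: "t > t0" for t
    proof -
      have "connects (t - t0) x x (\<lambda>_. x)" "action (\<lambda>_. x) (t - t0) = umin * (t - t0)"
        using connects_const[of "t - t0" x] t x by simp_all
      then obtain \<gamma> where "connects t x y \<gamma>" "action \<gamma> t = umin * (t - t0) + action \<gamma>0 t0"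
        using action_concat[OF _ 0(1), of "t - t0" x "\<lambda>_. x"] by auto
      from add_right_mono[OF min_action_le[OF this(1)], of "ereal (- umin) * ereal t"] this(2)
      have "min_action A L zero_form t x y + ereal (- umin) * ereal t \<le> ereal (action \<gamma>0 t0 - umin * t0)"
        by (simp add: algebra_simps)
      also have "\<dots> \<le> ereal (excess x y + e)" using 0(2) by simp
      finally show ?thesis .
    qed
    then have "peierls_barrier A L zero_form x y \<le> ereal (excess x y + e)"
      unfolding peierls_barrier_def \<alpha>
      by (intro Liminf_le eventually_mono[OF eventually_gt_at_top[of t0]]) auto
    then show "peierls_barrier A L zero_form x y \<le> ereal (excess x y) + ereal e" by simp
  qed
qed

text \<open>Off the minima all loops of duration at least 1 have a common positive excess, so the
  barrier from x to itself is positive.\<close>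

lemma aubry_set_subset:
  assumes \<alpha>: "mather_alpha A L zero_form = ereal (- umin)" and x: "x \<in> aubry_set A L zero_form"
  shows "U x = umin"
proof (rule ccontr)
  assume "U x \<noteq> umin"
  then have "U x > umin" using umin(1)[of x] by simp
  then obtain c where c: "c > 0" "\<And>t y \<gamma>. connects t x y \<gamma> \<Longrightarrow> t \<ge> 1 \<Longrightarrow> c \<le> action \<gamma> t - umin * t"
    by (rule excess_loop_pos) (rule that)
  have "ereal c \<le> peierls_barrier A L zero_form x x" by (rule barrier_ge[OF \<alpha> c(2)])
  then have "ereal (c + c) \<le> aubry_delta A L zero_form x x"
    unfolding aubry_delta_def plus_ereal.simps(1)[symmetric] by (intro add_mono)
  then show False using x c(1) by (simp add: aubry_set_def)
qed

text \<open>In fact equality holds in \<open>mather_alpha_le\<close>, but treating the strict inequality as a degenerate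
  case avoids any study of the Euler-Lagrange flow.\<close>

lemma barrier_eq_minus_infinity:
  assumes \<alpha>: "mather_alpha A L zero_form < ereal (- umin)"
  shows "peierls_barrier A L zero_form x y = - \<infinity>"
proof (rule ereal_bot)
  fix B :: real
  obtain z where z: "U z = umin" using umin(2) by blast
  obtain t1 \<gamma>1 where 1: "connects t1 x z \<gamma>1" using connects_ex by blast
  obtain t2 \<gamma>2 where 2: "connects t2 z y \<gamma>2" using connects_ex by blast
  \<comment> \<open>\<alpha>(0) is an extended real and might be infinite; a real number strictly
    between it and - min U gives an upper bound of finite negative slope
    \<open>umin + \<beta>\<close>.\<close>
  obtain \<beta> where \<beta>: "mather_alpha A L zero_form < ereal \<beta>" "ereal \<beta> < ereal (- umin)"
    using ereal_dense2[OF \<alpha>] by blast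
  define K where "K = action \<gamma>1 t1 + action \<gamma>2 t2 - umin * (t1 + t2)"
  have "min_action A L zero_form t x y + mather_alpha A L zero_form * ereal t \<le> ereal B"
    \<comment> \<open>The first condition leaves a positive time for resting at z; the second one
      solves K + (umin + \<beta>) t \<le> B for t.\<close>
    if t: "t > max 0 (t1 + t2)" "t \<ge> (K - B) / (- (umin + \<beta>))" for t
  proof -
    let ?w = "t - (t1 + t2)"
    have "connects ?w z z (\<lambda>_. z)" "action (\<lambda>_. z) ?w = umin * ?w"
      using connects_const[of ?w z] t z by simp_all
    then obtain \<gamma>3 where 3: "connects (?w + t2) z y \<gamma>3" "action \<gamma>3 (?w + t2) = umin * ?w + action \<gamma>2 t2"
      using action_concat[OF _ 2, of ?w z "\<lambda>_. z"] by auto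
    obtain \<gamma> where "connects (t1 + (?w + t2)) x y \<gamma>"
      "action \<gamma> (t1 + (?w + t2)) = action \<gamma>1 t1 + action \<gamma>3 (?w + t2)"
      using action_concat[OF 1 3(1)] by blast
    then have \<gamma>: "connects t x y \<gamma>" "action \<gamma> t = K + umin * t"
      using 3(2) by (simp_all add: K_def algebra_simps)
    have "mather_alpha A L zero_form * ereal t \<le> ereal \<beta> * ereal t"
      using t \<beta>(1) by (intro ereal_mult_right_mono) auto
    with min_action_le[OF \<gamma>(1)]
    have "min_action A L zero_form t x y + mather_alpha A L zero_form * ereal t \<le> ereal (K + umin * t) + ereal \<beta> * ereal t"
      unfolding \<gamma>(2) by (rule add_mono)
    also have "\<dots> = ereal (K + (umin + \<beta>) * t)" by (simp add: algebra_simps)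
    also have "\<dots> \<le> ereal B"
      using t(2) \<beta>(2) by (simp add: divide_le_eq algebra_simps split: if_splits)
    finally show ?thesis .
  qed
  then show "peierls_barrier A L zero_form x y \<le> ereal B"
    unfolding peierls_barrier_def
    by (intro Liminf_le eventually_mono[OF eventually_conj[OF eventually_gt_at_top[of "max 0 (t1 + t2)"]
          eventually_ge_at_top[of "(K - B) / (- (umin + \<beta>))"]]]) auto
qed

text \<open>By the triangle inequality the variation of \<delta>(a, .) between x and y is at most
  \<delta>(x, y), whatever \<open>a\<close> is. In a chart this is controlled by
  \<open>excess_chart_estimate\<close>, which is the hypothesis of the Euclidean result; finitely
  many charts suffice by compactness.\<close>

lemma negligible_excess_image:
  assumes U: "Ck_function A r U" and r: "r \<ge> 2 * DIM('e) - 2"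
    and Z: "\<And>x. x \<in> Z \<Longrightarrow> U x = umin"
  shows "negligible ((\<lambda>x. excess a x + excess x a) ` Z)"
proof -
  define F where "F x = excess a x + excess x a" for x
  have F_diff: "\<bar>F x - F y\<bar> \<le> excess x y + excess y x" for x y
    using excess_triangle[of a x y] excess_triangle[of a y x] excess_triangle[of x a y]
      excess_triangle[of y a x] unfolding F_def by linarith
  define \<V> where "\<V> = {V. open V \<and> negligible (F ` (Z \<inter> V))}"
  have "\<exists>V\<in>\<V>. x \<in> V" for x
  proof -
    define \<kappa> where "\<kappa> = chart_at A x"
    have \<kappa>: "\<kappa> \<in> A" "x \<in> fst \<kappa>" unfolding \<kappa>_def by (rule chart_at)+
    obtain \<rho> where \<rho>: "\<rho> > 0" "cball (snd \<kappa> x) \<rho> \<subseteq> snd \<kappa> ` fst \<kappa>"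
      using charts(2)[OF \<kappa>(1)] \<kappa>(2) by (metis imageI open_contains_cball)
    obtain C where C: "C > 0" "\<And>y v. y \<in> cball (snd \<kappa> x) \<rho> \<Longrightarrow> metric_in_chart \<kappa> y v v \<le> C * (norm v)\<^sup>2"
      by (rule metric_in_chart_upper_bound[OF \<kappa>(1) compact_cball \<rho>(2)]) (rule that)
    let ?\<Omega> = "ball (snd \<kappa> x) \<rho>"
    let ?V = "fst \<kappa> \<inter> snd \<kappa> -` ?\<Omega>"
    have \<Omega>: "?\<Omega> \<subseteq> snd \<kappa> ` fst \<kappa>" using \<rho>(2) ball_subset_cball by blast
    have "Ck_on r (snd \<kappa> ` fst \<kappa>) (U \<circ> chart_inv \<kappa>)"
      using U \<kappa>(1) unfolding Ck_function_def by blast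
    then have "Ck_on r ?\<Omega> (\<lambda>y. U (chart_inv \<kappa> y))"
      unfolding o_def using \<Omega> by (rule Ck_on_subset)
    then have u: "Ck_on r ?\<Omega> (\<lambda>y. U (chart_inv \<kappa> y) - umin)"
      by (intro Ck_on_diff Ck_on_const) auto
    have "negligible ((\<lambda>y. F (chart_inv \<kappa> y)) ` snd \<kappa> ` (Z \<inter> ?V))"
    \<comment> \<open>Twice the constant C / 2 + 1 of \<open>excess_chart_estimate\<close>: the
      curve is run through forwards for one summand of \<delta> and backwards for the other.\<close>
    proof (rule negligible_image_zeros[OF open_ball _ r u, where M = "C + 2"])
      show "snd \<kappa> ` (Z \<inter> ?V) \<subseteq> ?\<Omega>" by blast
      show "U (chart_inv \<kappa> y) - umin = 0" if "y \<in> snd \<kappa> ` (Z \<inter> ?V)" for y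
        using that Z charts(5)[OF \<kappa>(1)] by auto
      fix q q' l \<sigma>
      assume h: "l > 0" "\<sigma> > 0" "continuous_on {0..1::real} q'"
        "\<And>s. s \<in> {0..1} \<Longrightarrow> (q has_vector_derivative q' s) (at s within {0..1})"
        "\<And>s. s \<in> {0..1} \<Longrightarrow> norm (q' s) \<le> l" "\<And>s. s \<in> {0..1} \<Longrightarrow> q s \<in> ?\<Omega>"
        "\<And>s. s \<in> {0..1} \<Longrightarrow> U (chart_inv \<kappa> (q s)) - umin \<le> \<sigma>"
      have qC: "metric_in_chart \<kappa> (q s) v v \<le> C * (norm v)\<^sup>2" if "s \<in> {0..1}" for s v
        by (rule C(2)) (use h(6)[OF that] ball_subset_cball in blast)
      have q\<Omega>: "q s \<in> snd \<kappa> ` fst \<kappa>" if "s \<in> {0..1}" for s using h(6)[OF that] \<Omega> by blast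
      have flip: "1 - s \<in> {0..1}" if "s \<in> {0..1}" for s :: real using that by simp
      have im: "(\<lambda>s. 1 - s) ` {0..1::real} = {0..1}" by simp
      have "excess (chart_inv \<kappa> (q 0)) (chart_inv \<kappa> (q 1)) \<le> (C / 2 + 1) * l * sqrt \<sigma>"
        using C(1) by (intro excess_chart_estimate[OF \<kappa>(1) h(1,2,4,3) q\<Omega> qC _ h(5,7)]) auto
      moreover
      have "excess (chart_inv \<kappa> (q (1 - 0))) (chart_inv \<kappa> (q (1 - 1))) \<le> (C / 2 + 1) * l * sqrt \<sigma>"
      proof (rule excess_chart_estimate[OF \<kappa>(1) h(1,2), where q = "\<lambda>s. q (1 - s)" and q' = "\<lambda>s. - q' (1 - s)"])
        fix s :: real assume s: "s \<in> {0..1}"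
        have 1: "((\<lambda>s. 1 - s) has_vector_derivative - 1) (at s within {0..1})"
          by (auto intro!: derivative_eq_intros)
        have 2: "(q has_vector_derivative q' (1 - s)) (at (1 - s) within (\<lambda>s. 1 - s) ` {0..1})"
          unfolding im by (rule h(4)[OF flip[OF s]])
        show "((\<lambda>s. q (1 - s)) has_vector_derivative - q' (1 - s)) (at s within {0..1})"
          using vector_diff_chain_within[OF 1 2] by (simp add: o_def)
        show "norm (- q' (1 - s)) \<le> l" using h(5)[OF flip[OF s]] by simp
      next
        show "continuous_on {0..1} (\<lambda>s. - q' (1 - s))"
          by (intro continuous_intros continuous_on_compose2[OF h(3)]) auto
      qed (use q\<Omega>[OF flip] qC[OF flip] h(7)[OF flip] C(1) in auto)
      ultimately show "\<bar>F (chart_inv \<kappa> (q 0)) - F (chart_inv \<kappa> (q 1))\<bar> \<le> (C + 2) * l * sqrt \<sigma>"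
        using F_diff[of "chart_inv \<kappa> (q 0)" "chart_inv \<kappa> (q 1)"] by (simp add: algebra_simps)
    qed
    moreover have "(\<lambda>y. F (chart_inv \<kappa> y)) ` snd \<kappa> ` (Z \<inter> ?V) = F ` (Z \<inter> ?V)"
      unfolding image_image using charts(5)[OF \<kappa>(1)] by (intro image_cong) auto
    moreover have "open ?V" by (rule continuous_open_preimage[OF charts(3,1)[OF \<kappa>(1)] open_ball])
    ultimately have "?V \<in> \<V>" by (simp add: \<V>_def)
    moreover have "x \<in> ?V" using \<kappa> \<rho>(1) by simp
    ultimately show ?thesis by (intro bexI)
  qed
  then have "UNIV \<subseteq> \<Union>\<V>" by blast
  from compactE[OF compact_UNIV this] obtain \<V>' where \<V>': "\<V>' \<subseteq> \<V>" "finite \<V>'" "UNIV \<subseteq> \<Union>\<V>'"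
    by (auto simp: \<V>_def)
  have "negligible (\<Union>V\<in>\<V>'. F ` (Z \<inter> V))"
    using \<V>' by (intro negligible_Union) (auto simp: \<V>_def)
  moreover have "F ` Z \<subseteq> (\<Union>V\<in>\<V>'. F ` (Z \<inter> V))" using \<V>'(3) by blast
  ultimately show ?thesis unfolding F_def by (rule negligible_subset)
qed

end

lemma totally_disconnected_if_negligible_dist:
  assumes "Metric_space M d"
    and neg: "\<And>P. P \<in> M \<Longrightarrow> negligible ((\<lambda>Q. d P Q) ` M)"
  shows "totally_disconnected_space (Metric_space.mtopology M d)"
  unfolding totally_disconnected_space_def
proof
  interpret Metric_space M d by fact
  fix C assume C: "C \<in> connected_components_of mtopology"
  then have conn: "connectedin mtopology C" and "C \<noteq> {}"
    by (auto intro: connectedin_connected_components_of dest: nonempty_connected_components_of)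
  then obtain P where P: "P \<in> C" by blast
  have CM: "C \<subseteq> M" using connectedin_subset_topspace[OF conn] by simp
  then have PM: "P \<in> M" using P by blast
  have "continuous_map mtopology euclideanreal (d P)"
    unfolding mtopology_is_euclidean[symmetric] Met_TC.continuous_map_to_metric
  proof (intro ballI allI impI)
    fix Q e assume Q: "Q \<in> topspace mtopology" and e: "(e::real) > 0"
    have "d P R \<in> Met_TC.mball (d P Q) e" if "R \<in> mball Q e" for R
      using that PM triangle[of P Q R] triangle[of P R Q] commute[of Q R]
      by (auto simp: dist_real_def)
    then show "\<exists>V. openin mtopology V \<and> Q \<in> V \<and> (\<forall>R\<in>V. d P R \<in> Met_TC.mball (d P Q) e)"
      using Q e by (intro exI[of _ "mball Q e"]) auto
  qed
  from connectedin_continuous_map_image[OF this conn]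
  have "connected (d P ` C)" by simp
  have "Q = P" if Q: "Q \<in> C" for Q
  proof (rule ccontr)
    assume "Q \<noteq> P"
    then have pos: "d P Q > 0" using PM CM Q by (metis mdist_pos_eq subsetD)
    have "{0..d P Q} \<subseteq> d P ` C"
      using connected_contains_Icc[OF \<open>connected (d P ` C)\<close> imageI[OF P] imageI[OF Q]] PM by simp
    then have "negligible {0..d P Q}"
      using CM by (intro negligible_subset[OF neg[OF PM]]) blast
    then show False using pos negligible_interval(1)[of 0 "d P Q"] by (simp add: box_real)
  qed
  then show "\<exists>a. C = {a}" using P by blast
qed

section \<open>The quotient as a metric space\<close>

context mechanical_system
begin

lemma aubry_delta_eq:
  assumes "mather_alpha A L zero_form = ereal (- umin)" "x \<in> aubry_set A L zero_form" "y \<in> aubry_set A L zero_form"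
  shows "aubry_delta A L zero_form x y = ereal (excess x y + excess y x)"
  unfolding aubry_delta_def using barrier_eq_excess aubry_set_subset assms by simp

lemma totally_disconnected_quotient_aubry_set:
  assumes U: "Ck_function A r U" and r: "r \<ge> 2 * DIM('e) - 2"
  shows "totally_disconnected_space
    (Metric_space.mtopology (quotient_aubry_set A L zero_form) (quotient_aubry_dist A L zero_form))"
proof (cases "mather_alpha A L zero_form = ereal (- umin)")
  case False
  then have h: "peierls_barrier A L zero_form x y = - \<infinity>" for x y
    using mather_alpha_le by (intro barrier_eq_minus_infinity) (simp add: less_le)
  \<comment> \<open>Here \<delta>(x, x) is minus infinity for every x, hence never 0.\<close>
  then have "quotient_aubry_set A L zero_form = {}"
    by (simp add: quotient_aubry_set_def aubry_set_def aubry_delta_def)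
  \<comment> \<open>\<open>Metric_space\<close> requires nonnegativity and symmetry also off the
    carrier. They hold because \<open>real_of_ereal\<close> maps minus infinity to 0.\<close>
  moreover have "quotient_aubry_dist A L zero_form = (\<lambda>P Q. 0)"
    by (simp add: quotient_aubry_dist_def aubry_delta_def h fun_eq_iff)
  ultimately show ?thesis
    by (intro totally_disconnected_if_negligible_dist) (simp_all add: Metric_space_def)
next
  case True
  let ?Z = "aubry_set A L zero_form"
  \<comment> \<open>A real-valued function on the whole manifold, symmetric and satisfying the
    triangle inequality; it is identified with \<open>aubry_delta\<close> on the Aubry set, where U
    is minimal.\<close>
  define \<delta> where "\<delta> x y = excess x y + excess y x" for x y
  have \<delta>: "aubry_delta A L zero_form x y = ereal (\<delta> x y)" if "x \<in> ?Z" "y \<in> ?Z" for x y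
    using aubry_delta_eq[OF True that] by (simp add: \<delta>_def)
  define R where "R = {(x, y). x \<in> ?Z \<and> y \<in> ?Z \<and> aubry_delta A L zero_form x y = 0}"
  have R: "(x, y) \<in> R \<longleftrightarrow> x \<in> ?Z \<and> y \<in> ?Z \<and> \<delta> x y = 0" for x y
    using \<delta>[of x y] unfolding R_def by auto
  have \<delta>_nonneg: "\<delta> x y \<ge> 0" for x y unfolding \<delta>_def using excess_nonneg by simp
  have \<delta>_triangle: "\<delta> x z \<le> \<delta> x y + \<delta> y z" for x y z
    unfolding \<delta>_def using excess_triangle[of x z y] excess_triangle[of z x y] by simp
  have \<delta>_sym: "\<delta> x y = \<delta> y x" for x y unfolding \<delta>_def by simp
  have equiv: "equiv ?Z R"
  proof (rule equivI)
    show "R \<subseteq> ?Z \<times> ?Z" using R by auto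
    show "refl_on ?Z R"
    proof (rule refl_onI)
      fix x assume x: "x \<in> ?Z"
      then have "aubry_delta A L zero_form x x = 0" by (simp add: aubry_set_def)
      then show "(x, x) \<in> R" using x by (simp add: R_def)
    qed
    show "sym R" by (rule symI) (use R \<delta>_sym in auto)
    show "trans R"
    proof (rule transI)
      fix x y z assume "(x, y) \<in> R" "(y, z) \<in> R"
      then show "(x, z) \<in> R" using \<delta>_triangle[of x z y] \<delta>_nonneg[of x z] unfolding R by simp
    qed
  qed
  define rep where "rep P = (SOME x. x \<in> P)" for P :: "'m set"
  let ?M = "quotient_aubry_set A L zero_form" and ?d = "quotient_aubry_dist A L zero_form"
  have M: "?M = ?Z // R" by (simp add: quotient_aubry_set_def R_def)
  have rep: "rep P \<in> P" "rep P \<in> ?Z" if "P \<in> ?M" for P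
  proof -
    show "rep P \<in> P"
      unfolding rep_def using in_quotient_imp_non_empty[OF equiv, of P] that M by (simp add: some_in_eq)
    then show "rep P \<in> ?Z"
      using in_quotient_imp_subset[OF equiv, of P] that M by auto
  qed
  have d: "?d P Q = \<delta> (rep P) (rep Q)" if "P \<in> ?M" "Q \<in> ?M" for P Q
    unfolding quotient_aubry_dist_def rep_def[symmetric] using \<delta> rep(2) that by simp
  have "Metric_space ?M ?d"
  proof
    fix P Q
    \<comment> \<open>As \<open>P\<close> and \<open>Q\<close> are arbitrary sets, their chosen
      points may lie off the Aubry set, so the argument uses the sign of the barrier instead of
      \<delta>.\<close>
    show "0 \<le> ?d P Q"
      unfolding quotient_aubry_dist_def aubry_delta_def
      using barrier_nonneg[OF True] by (intro real_of_ereal_pos add_nonneg_nonneg)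
    show "?d P Q = ?d Q P"
      unfolding quotient_aubry_dist_def aubry_delta_def by (simp add: add.commute)
  next
    fix P Q assume PQ: "P \<in> ?M" "Q \<in> ?M"
    show "?d P Q = 0 \<longleftrightarrow> P = Q"
      using quotient_eq_iff[OF equiv PQ[unfolded M] rep(1)[OF PQ(1)] rep(1)[OF PQ(2)]]
        d[OF PQ] R rep(2)[OF PQ(1)] rep(2)[OF PQ(2)] by auto
    fix S assume "S \<in> ?M"
    then show "?d P S \<le> ?d P Q + ?d Q S" using d PQ \<delta>_triangle by simp
  qed
  then show ?thesis
  proof (rule totally_disconnected_if_negligible_dist)
    fix P assume P: "P \<in> ?M"
    \<comment> \<open>The fixed point \<open>a\<close> of \<open>negligible_excess_image\<close> is
      the representative of \<open>P\<close>, and the values over all representatives lie among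
      those over the whole Aubry set.\<close>
    have "negligible (\<delta> (rep P) ` ?Z)"
      unfolding \<delta>_def by (rule negligible_excess_image[OF U r aubry_set_subset[OF True]])
    moreover have "?d P ` ?M \<subseteq> \<delta> (rep P) ` ?Z" using d[OF P] rep(2) by auto
    ultimately show "negligible (?d P ` ?M)" by (rule negligible_subset)
  qed
qed

end

theorem corollary4:
  fixes A :: "('m::t2_space, 'e::euclidean_space) chart set"
    and g :: "'m \<Rightarrow> 'e \<Rightarrow> 'e \<Rightarrow> real"
    and U :: "'m \<Rightarrow> real"
    and L :: "'m \<times> 'e \<Rightarrow> real"
    and r :: nat
  assumes "compact_connected_manifold A"
    and "riemannian_metric A g"
    and "mechanical_lagrangian A g U L"
    and "r \<ge> 2 * DIM('e) - 2"
    and "Ck_function A r U"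
  shows "totally_disconnected_space
           (Metric_space.mtopology (quotient_aubry_set A L (\<lambda>x v. 0))
                                   (quotient_aubry_dist A L (\<lambda>x v. 0)))"
proof -
  have "g x v v \<ge> 0" for x v
  proof (cases "v = 0")
    case True
    have "bilinear (g x)" using assms(2) unfolding riemannian_metric_def by blast
    then show ?thesis using True by (simp add: bilinear_lzero)
  next
    case False
    then have "g x v v > 0" using assms(2) unfolding riemannian_metric_def by blast
    then show ?thesis by simp
  qed
  then have L: "L (x, v) = g x v v / 2 + U x" for x v
    using assms(3) by (simp add: mechanical_lagrangian_def metric_norm_def)
  \<comment> \<open>In dimension one r may be 0, so continuity is all that can be drawn from
    \<open>Ck_function\<close> in general; it is glued from the charts here, before the locale is
    available.\<close>
  have "isCont U x" for x
  proof -
    from assms(1) have A: "(\<Union>\<kappa>\<in>A. fst \<kappa>) = UNIV" "\<forall>\<kappa>\<in>A. is_chart \<kappa>"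
      by (simp_all add: compact_connected_manifold_def smooth_atlas_def)
    then obtain \<kappa> where \<kappa>: "\<kappa> \<in> A" "x \<in> fst \<kappa>" by blast
    then have o: "open (fst \<kappa>)" and h: "homeomorphism (fst \<kappa>) (snd \<kappa> ` fst \<kappa>) (snd \<kappa>) (chart_inv \<kappa>)"
      using A(2) by (simp_all add: is_chart_def)
    have "Ck_on r (snd \<kappa> ` fst \<kappa>) (U \<circ> chart_inv \<kappa>)"
      using assms(5) \<kappa>(1) by (simp add: Ck_function_def)
    then have "continuous_on (snd \<kappa> ` fst \<kappa>) (U \<circ> chart_inv \<kappa>)" by (rule Ck_on_continuous_on)
    then have "continuous_on (fst \<kappa>) (\<lambda>x. (U \<circ> chart_inv \<kappa>) (snd \<kappa> x))"
      by (rule continuous_on_compose2[OF _ homeomorphism_cont1[OF h]]) simp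
    then have "continuous_on (fst \<kappa>) U"
      by (rule continuous_on_eq) (simp add: homeomorphism_apply1[OF h])
    then show ?thesis using o \<kappa>(2) by (simp add: continuous_on_eq_continuous_at)
  qed
  then have "continuous_on UNIV U" by (simp add: continuous_at_imp_continuous_on)
  then interpret mechanical_system A g U L
    using assms(1,2) L by unfold_locales
  show ?thesis by (rule totally_disconnected_quotient_aubry_set[OF assms(5,4)])
qed

end
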